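(* Every triangular Tangle is constructible.
   Context: Fix $r>0$ and let $\mathscr T$ be the tiling of the plane by equilateral triangles of side length $2r$. Center a circle of radius $r$ at each vertex of $\mathscr T$; circles at adjacent vertices are tangent at the midpoint of the common edge. A link is a sixth of one of these circles whose endpoints are two consecutive tangency points with circles at adjacent vertices. A triangular Tangle is a smooth (continuously turning tangent) simple closed curve that is the union of finitely many links. Each circle of radius $r$ centered at a vertex of $\mathscr T$ is a triangular Tangle. The region enclosed is the bounded component of the complement of the curve; a link is convex if, near the link, the enclosed region lies on the same side as the center of its circle, and concave otherwise (always measured with respect to the Tangle containing the link). Operations (each allowed only when the result is a triangular Tangle, and each replacement having the same two endpoints as the replaced sequence): a 4-bulb shear insertion replaces two consecutive convex links by six consecutive links which are, in order, concave, convex, convex, convex, convex, concave; a 4-bulb shear reduction replaces six consecutive links which are, in order, convex, concave, concave, concave, concave, convex by two consecutive concave links; a 3-bulb shear insertion replaces three consecutive links which are, in order, convex, concave, convex by five consecutive links which are, in order, concave, convex, convex, convex, concave; a 3-bulb shear reduction replaces five consecutive links which are, in order, convex, concave, concave, concave, convex by three consecutive links which are, in order, concave, convex, concave; a reflection replaces four consecutive links which are, in order, convex, concave, concave, convex by four consecutive links which are, in order, concave, convex, convex, concave. A triangular Tangle $\tau$ is constructible if there are triangular Tangles $\tau_0,\dots,\tau_k=\tau$ such that $\tau_0$ is a circle of radius $r$ centered at a vertex of $\mathscr T$ and each $\tau_i$ is obtained from $\tau_{i-1}$ by one of these operations. *)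

theory Defs
  imports "HOL-Complex_Analysis.Complex_Analysis"
begin

text \<open>
  The plane is \<^typ>\<open>complex\<close>.  Coordinates are chosen so that the tiling by equilateral
  triangles of side \<open>2 * r\<close> has a vertex at \<open>0\<close> and an edge along the real axis.
\<close>

definition tiling_vertices :: "real \<Rightarrow> complex set" where
  "tiling_vertices r =
    {complex_of_real (2 * r) * (of_int a + of_int b * cis (pi / 3)) | a b :: int. True}"

text \<open>
  The vertices adjacent to \<open>v\<close> are \<open>v + 2 * r * cis (k * pi / 3)\<close> for \<open>k < 6\<close>, so the circle at
  \<open>v\<close> is tangent to theirs at the midpoints \<open>v + r * cis (k * pi / 3)\<close>.  The link with index
  \<open>k\<close> runs from the \<open>k\<close>-th of these points to the next one.
\<close>

definition link_path :: "real \<Rightarrow> complex \<Rightarrow> nat \<Rightarrow> real \<Rightarrow> complex" where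
  "link_path r v k = part_circlepath v r (real k * pi / 3) (real (Suc k) * pi / 3)"

definition links :: "real \<Rightarrow> complex set set" where
  "links r = {path_image (link_path r v k) | v k. v \<in> tiling_vertices r \<and> k < 6}"

text \<open>
  A closed curve with continuously turning tangent is the image of a 1-periodic \<open>C1\<close> map with
  nowhere vanishing derivative; periodicity makes the tangent match at the base point too.
\<close>

definition smooth_simple_closed_curve :: "complex set \<Rightarrow> bool" where
  "smooth_simple_closed_curve C \<longleftrightarrow>
    (\<exists>g :: real \<Rightarrow> complex.
       (\<forall>t. g (t + 1) = g t) \<and>
       g C1_differentiable_on UNIV \<and>
       (\<forall>t. vector_derivative g (at t) \<noteq> 0) \<and>
       simple_path g \<and>
       path_image g = C)"

definition triangular_tangle :: "real \<Rightarrow> complex set \<Rightarrow> bool" where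
  "triangular_tangle r C \<longleftrightarrow>
    smooth_simple_closed_curve C \<and> (\<exists>L. finite L \<and> L \<subseteq> links r \<and> C = \<Union>L)"

definition tangle_links :: "real \<Rightarrow> complex set \<Rightarrow> complex set set" where
  "tangle_links r C = {A \<in> links r. A \<subseteq> C}"

datatype curvature = Convex | Concave

text \<open>
  Which side of the link the enclosed region \<^term>\<open>inside C\<close> lies on is tested near the points
  of the link other than its two endpoints: at an endpoint the curve may pass to the neighbouring
  circle, on whose other side the region then lies.
\<close>

fun link_curvature :: "real \<Rightarrow> complex set \<Rightarrow> curvature \<Rightarrow> complex set \<Rightarrow> bool" where
  "link_curvature r C Convex A \<longleftrightarrow>
    (\<exists>v \<in> tiling_vertices r. \<exists>k<6. A = path_image (link_path r v k) \<and>
      (\<forall>z \<in> A - {pathstart (link_path r v k), pathfinish (link_path r v k)}.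
         \<forall>\<^sub>F w in nhds z. w \<in> inside C \<longleftrightarrow> dist v w < r))"
| "link_curvature r C Concave A \<longleftrightarrow>
    (\<exists>v \<in> tiling_vertices r. \<exists>k<6. A = path_image (link_path r v k) \<and>
      (\<forall>z \<in> A - {pathstart (link_path r v k), pathfinish (link_path r v k)}.
         \<forall>\<^sub>F w in nhds z. w \<in> inside C \<longleftrightarrow> dist v w > r))"

definition link_joins :: "real \<Rightarrow> complex set \<Rightarrow> complex \<Rightarrow> complex \<Rightarrow> bool" where
  "link_joins r A p q \<longleftrightarrow>
    (\<exists>v \<in> tiling_vertices r. \<exists>k<6. A = path_image (link_path r v k) \<and>
      {p, q} = {pathstart (link_path r v k), pathfinish (link_path r v k)})"

fun link_chain :: "real \<Rightarrow> complex set list \<Rightarrow> complex \<Rightarrow> complex \<Rightarrow> bool" where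
  "link_chain r [] p q \<longleftrightarrow> p = q"
| "link_chain r (A # As) p q \<longleftrightarrow> (\<exists>m. link_joins r A p m \<and> link_chain r As m q)"

text \<open>
  Exactly two links of a Tangle meet at each tangency point on it, so distinct links of a Tangle
  that form a chain are consecutive along the curve.
\<close>

definition consecutive_links ::
    "real \<Rightarrow> complex set \<Rightarrow> curvature list \<Rightarrow> complex set list \<Rightarrow> complex \<Rightarrow> complex \<Rightarrow> bool" where
  "consecutive_links r C cs As p q \<longleftrightarrow>
    set As \<subseteq> tangle_links r C \<and> distinct As \<and> link_chain r As p q \<and>
    list_all2 (link_curvature r C) cs As"

definition link_replacement ::
    "real \<Rightarrow> curvature list \<Rightarrow> curvature list \<Rightarrow> complex set \<Rightarrow> complex set \<Rightarrow> bool" where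
  "link_replacement r cs ds C D \<longleftrightarrow>
    triangular_tangle r C \<and> triangular_tangle r D \<and>
    (\<exists>As Bs p q. consecutive_links r C cs As p q \<and> consecutive_links r D ds Bs p q \<and>
       tangle_links r D - set Bs = tangle_links r C - set As)"

definition shear_insertion_4 :: "real \<Rightarrow> complex set \<Rightarrow> complex set \<Rightarrow> bool" where
  "shear_insertion_4 r = link_replacement r
    [Convex, Convex]
    [Concave, Convex, Convex, Convex, Convex, Concave]"

definition shear_reduction_4 :: "real \<Rightarrow> complex set \<Rightarrow> complex set \<Rightarrow> bool" where
  "shear_reduction_4 r = link_replacement r
    [Convex, Concave, Concave, Concave, Concave, Convex]
    [Concave, Concave]"

definition shear_insertion_3 :: "real \<Rightarrow> complex set \<Rightarrow> complex set \<Rightarrow> bool" where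
  "shear_insertion_3 r = link_replacement r
    [Convex, Concave, Convex]
    [Concave, Convex, Convex, Convex, Concave]"

definition shear_reduction_3 :: "real \<Rightarrow> complex set \<Rightarrow> complex set \<Rightarrow> bool" where
  "shear_reduction_3 r = link_replacement r
    [Convex, Concave, Concave, Concave, Convex]
    [Concave, Convex, Concave]"

definition reflection :: "real \<Rightarrow> complex set \<Rightarrow> complex set \<Rightarrow> bool" where
  "reflection r = link_replacement r
    [Convex, Concave, Concave, Convex]
    [Concave, Convex, Convex, Concave]"

definition tangle_operation :: "real \<Rightarrow> complex set \<Rightarrow> complex set \<Rightarrow> bool" where
  "tangle_operation r C D \<longleftrightarrow>
    shear_insertion_4 r C D \<or> shear_reduction_4 r C D \<or>
    shear_insertion_3 r C D \<or> shear_reduction_3 r C D \<or> reflection r C D"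

definition constructible :: "real \<Rightarrow> complex set \<Rightarrow> bool" where
  "constructible r C \<longleftrightarrow>
    (\<exists>v \<in> tiling_vertices r. (tangle_operation r)\<^sup>*\<^sup>* (sphere v r) C)"

end

theory Submission
  imports Defs
begin

text \<open>
  The circles cut the plane into open discs and curved triangles.  A Tangle \<open>C\<close> is determined by
  the finite set \<open>S\<close> of vertices inside it: by smoothness a curved triangle lies on the side of the
  majority of its three vertices, so a link belongs to \<open>C\<close> exactly if its centre is separated by
  \<open>C\<close> from the other two vertices of its triangle.  Conversely, \<open>S\<close> gives a Tangle as soon as its
  boundary walk is a single cycle.  In terms of \<open>S\<close> each of the five operations adds one vertex
  whose neighbours in \<open>S\<close> form an arc of length 1 to 5 in the hexagon around it.  It therefore
  suffices to find, in every \<open>S\<close> with at least two elements, a vertex whose removal reverses such a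
  step.  A boundary vertex that does not disconnect \<open>S\<close> will do: if its neighbours in \<open>S\<close> formed
  two or more arcs, a cross-cut of \<open>C\<close> through the vertex would separate them (Jordan).
\<close>

section \<open>Eisenstein lattice\<close>

definition rot :: "int \<times> int \<Rightarrow> int \<times> int" where
  "rot p = (- snd p, fst p + snd p)"

primrec dir :: "nat \<Rightarrow> int \<times> int" where
  "dir 0 = (1, 0)"
| "dir (Suc k) = rot (dir k)"

declare dir.simps(2) [simp del]

lemma dir_Suc_Suc: "dir (Suc (Suc k)) = dir (Suc k) - dir k"
  by (simp add: dir.simps(2) rot_def prod_eq_iff)

lemmas dir_reduce = numeral_eq_Suc dir_Suc_Suc

lemma dir_add_6_mult: "dir (k + 6 * n) = dir k"
proof (induction n)
  case (Suc n)
  have "dir (k + 6 * Suc n) = dir ((k + 6 * n) + 6)" by (simp add: algebra_simps)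
  also have "\<dots> = dir (k + 6 * n)" by (simp add: dir_reduce)
  finally show ?case using Suc by simp
qed simp

lemma dir_mod_6 [simp]: "dir (k mod 6) = dir k"
  using dir_add_6_mult[of "k mod 6" "k div 6"] by simp

lemma dir_Suc_mod_6 [simp]: "dir (Suc (k mod 6)) = dir (Suc k)"
  by (simp add: dir.simps(2))

lemma dir_cong: "i mod 6 = j mod 6 \<Longrightarrow> dir i = dir j"
  by (metis dir_mod_6)

lemma lt_6_cases: "(k::nat) < 6 \<longleftrightarrow> k = 0 \<or> k = 1 \<or> k = 2 \<or> k = 3 \<or> k = 4 \<or> k = 5"
  by auto

lemma dir_values: "dir 0 = (1,0)" "dir (Suc 0) = (0,1)" "dir 2 = (-1,1)" "dir 3 = (-1,0)"
  "dir 4 = (0,-1)" "dir 5 = (1,-1)" "dir 6 = (1,0)"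
  by (simp_all add: numeral_eq_Suc dir.simps(2) rot_def)

lemma dir_inj: assumes "dir i = dir j" shows "i mod 6 = j mod 6"
proof -
  have "i mod 6 < 6" "j mod 6 < 6" "dir (i mod 6) = dir (j mod 6)" using assms by auto
  then show ?thesis unfolding lt_6_cases by (auto simp: dir_values simp del: dir_mod_6)
qed

lemma dir_nonzero [simp]: "dir k \<noteq> 0"
proof -
  have "k mod 6 < 6" by simp
  then have "dir (k mod 6) \<noteq> 0" unfolding lt_6_cases by (auto simp: dir_values zero_prod_def simp del: dir_mod_6)
  then show ?thesis by simp
qed

lemma double_add_dir_eq:
  assumes "v + v + dir k = w + w + dir m"
  shows "w = v \<and> m mod 6 = k mod 6 \<or> w = v + dir k \<and> m mod 6 = (k + 3) mod 6"
proof -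
  define i j where "i = k mod 6" and "j = m mod 6"
  have ij: "dir k = dir i" "dir m = dir j" "i < 6" "j < 6" by (auto simp: i_def j_def)
  obtain a b c d where vw: "v = (a, b)" "w = (c, d)" by (cases v; cases w)
  have eq: "a + a + fst (dir i) = c + c + fst (dir j)" "b + b + snd (dir i) = d + d + snd (dir j)"
    using assms unfolding vw ij by (simp_all add: prod_eq_iff)
  have "even (fst (dir i) - fst (dir j))" "even (snd (dir i) - snd (dir j))"
    using eq by presburger+
  then have "j = i \<or> j = (i + 3) mod 6"
    using ij(3,4) unfolding lt_6_cases by (elim disjE; simp add: dir_values)
  then have "c = a \<and> d = b \<and> j = i \<or> c = a + fst (dir i) \<and> d = b + snd (dir i) \<and> j = (i + 3) mod 6"
    using eq ij(3) unfolding lt_6_cases by (elim disjE; simp add: dir_values)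
  then show ?thesis unfolding vw ij by (auto simp: prod_eq_iff i_def j_def mod_simps)
qed

lemma dir_basis:
  "\<exists>a b. p = (a * fst (dir k) + b * fst (dir (Suc k)), a * snd (dir k) + b * snd (dir (Suc k)))"
proof (induction k)
  case 0
  show ?case by (rule exI[of _ "fst p"], rule exI[of _ "snd p"]) (simp add: dir.simps(2) rot_def)
next
  case (Suc k)
  then obtain a b where
    "p = (a * fst (dir k) + b * fst (dir (Suc k)), a * snd (dir k) + b * snd (dir (Suc k)))" by blast
  then have "p = ((a + b) * fst (dir (Suc k)) + (- a) * fst (dir (Suc (Suc k))),
                  (a + b) * snd (dir (Suc k)) + (- a) * snd (dir (Suc (Suc k))))"
    by (simp add: dir_Suc_Suc algebra_simps)
  then show ?case by blast
qed

lemma dir_shift: fixes m j :: nat obtains i where "i < 6" "m mod 6 = (j + i) mod 6"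
proof
  show "(m + 5 * j) mod 6 < 6" by simp
  show "m mod 6 = (j + (m + 5 * j) mod 6) mod 6" by presburger
qed

definition omega :: complex where "omega = cis (pi / 3)"

lemma omega_eq: "omega = Complex (1/2) (sqrt 3 / 2)"
  by (simp add: omega_def complex_eq_iff cos_60 sin_60)

lemma omega_sq: "omega * omega = omega - 1"
  by (simp add: omega_eq complex_eq_iff)

definition emb :: "real \<Rightarrow> int \<times> int \<Rightarrow> complex" where
  "emb r p = of_real r * (of_int (fst p) + of_int (snd p) * omega)"

lemma emb_add: "emb r (p + q) = emb r p + emb r q"
  and emb_diff: "emb r (p - q) = emb r p - emb r q"
  and emb_minus: "emb r (- p) = - emb r p"
  and emb_0 [simp]: "emb r 0 = 0"
  by (simp_all add: emb_def algebra_simps)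

lemma emb_rot: "emb r (rot p) = omega * emb r p"
proof -
  have "emb r (rot p) = of_real r * (of_int (fst p) * omega + of_int (snd p) * (omega - 1))"
    by (simp add: emb_def rot_def algebra_simps)
  then show ?thesis by (simp add: emb_def algebra_simps flip: omega_sq)
qed

lemma emb_dir: "emb r (dir k) = of_real r * cis (real k * pi / 3)"
proof (induction k)
  case (Suc k)
  have "cis (real (Suc k) * pi / 3) = omega * cis (real k * pi / 3)"
    by (simp add: omega_def cis_mult field_simps)
  then show ?case using Suc by (simp add: dir.simps(2) emb_rot)
qed (simp add: emb_def)

lemma norm_combo:
  "(norm (of_real x * emb r (dir k) + of_real y * emb r (dir (Suc k))))\<^sup>2 = r\<^sup>2 * (x\<^sup>2 + x * y + y\<^sup>2)"
proof -
  have "of_real x * emb r (dir k) + of_real y * emb r (dir (Suc k))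
     = of_real r * cis (real k * pi / 3) * (of_real x + of_real y * omega)"
    by (simp add: dir.simps(2) emb_rot emb_dir algebra_simps)
  moreover have "(norm (of_real x + of_real y * omega))\<^sup>2 = x\<^sup>2 + x * y + y\<^sup>2"
    unfolding omega_eq cmod_power2 by (simp add: power2_eq_square algebra_simps)
  ultimately show ?thesis by (simp add: norm_mult power_mult_distrib)
qed

definition ctr :: "real \<Rightarrow> int \<times> int \<Rightarrow> complex" where
  "ctr r v = emb r (v + v)"

lemma ctr_eq: "ctr r v = 2 * emb r v"
  by (simp add: ctr_def emb_add)

lemma tiling_vertices_eq: "tiling_vertices r = range (ctr r)"
proof -
  have "complex_of_real (2 * r) * (of_int a + of_int b * cis (pi / 3)) = ctr r (a, b)" for a b
    by (simp add: ctr_eq emb_def omega_def)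
  then show ?thesis unfolding tiling_vertices_def by (auto simp: image_iff) 
qed

text \<open>Oblique coordinates with origin at a vertex, along two consecutive edges, in units of \<open>r\<close>: the edges have length \<open>2\<close>.\<close>

definition sect :: "real \<Rightarrow> int \<times> int \<Rightarrow> nat \<Rightarrow> real \<Rightarrow> real \<Rightarrow> complex" where
  "sect r v k a b = ctr r v + of_real a * emb r (dir k) + of_real b * emb r (dir (Suc k))"

lemma dist_sect_ctr_combo:
  assumes "w - v = (a * fst (dir k) + b * fst (dir (Suc k)), a * snd (dir k) + b * snd (dir (Suc k)))"
  shows "(dist (sect r v k x y) (ctr r w))\<^sup>2 =
     r\<^sup>2 * ((x - 2 * of_int a)\<^sup>2 + (x - 2 * of_int a) * (y - 2 * of_int b) + (y - 2 * of_int b)\<^sup>2)"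
proof -
  have "ctr r w - ctr r v = 2 * emb r (w - v)" by (simp add: ctr_eq emb_diff)
  also have "\<dots> = 2 * (of_int a * emb r (dir k) + of_int b * emb r (dir (Suc k)))"
    unfolding assms by (simp add: emb_def algebra_simps)
  finally have "sect r v k x y - ctr r w =
      of_real (x - 2 * of_int a) * emb r (dir k) + of_real (y - 2 * of_int b) * emb r (dir (Suc k))"
    by (simp add: sect_def algebra_simps)
  then show ?thesis unfolding dist_norm by (simp add: norm_combo del: of_real_diff)
qed

lemma dist_sect_ctr: "(dist (sect r v k x y) (ctr r v))\<^sup>2 = r\<^sup>2 * (x\<^sup>2 + x * y + y\<^sup>2)"
  using dist_sect_ctr_combo[of v v 0 k 0] by (simp add: zero_prod_def)

lemma dist_sect_ctr_dir:
  "(dist (sect r v k x y) (ctr r (v + dir k)))\<^sup>2 = r\<^sup>2 * ((x-2)\<^sup>2 + (x-2) * y + y\<^sup>2)"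
  using dist_sect_ctr_combo[of "v + dir k" v 1 k 0] by simp

lemma dist_sect_ctr_dir_Suc:
  "(dist (sect r v k x y) (ctr r (v + dir (Suc k))))\<^sup>2 = r\<^sup>2 * (x\<^sup>2 + x * (y-2) + (y-2)\<^sup>2)"
  using dist_sect_ctr_combo[of "v + dir (Suc k)" v 0 k 1] by simp

lemma quad_far:
  fixes x y :: real and a b :: int
  assumes "0 \<le> x" "0 \<le> y" "x + y \<le> 2" "(a, b) \<noteq> (0, 0)" "(a, b) \<noteq> (1, 0)" "(a, b) \<noteq> (0, 1)"
  shows "(x - 2 * of_int a)\<^sup>2 + (x - 2 * of_int a) * (y - 2 * of_int b) + (y - 2 * of_int b)\<^sup>2 > 1"
proof -
  define X Y where "X = x - 2 * real_of_int a" and "Y = y - 2 * real_of_int b"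
  have "b \<le> -1 \<or> b \<ge> 2 \<or> a \<le> -1 \<or> a \<ge> 2 \<or> a + b \<le> -1 \<or> a + b \<ge> 2"
    using assms(4-6) by (cases "a = 0"; cases "a = 1"; cases "b = 0"; cases "b = 1"; simp; arith)
  then have "real_of_int b \<le> -1 \<or> real_of_int b \<ge> 2 \<or> real_of_int a \<le> -1 \<or> real_of_int a \<ge> 2
     \<or> real_of_int a + real_of_int b \<le> -1 \<or> real_of_int a + real_of_int b \<ge> 2"
    by linarith
  then have "\<bar>Y\<bar> \<ge> 2 \<or> \<bar>X\<bar> \<ge> 2 \<or> \<bar>X + Y\<bar> \<ge> 2"
    unfolding X_def Y_def using assms(1-3) by (smt (verit))
  then have "Y\<^sup>2 \<ge> 4 \<or> X\<^sup>2 \<ge> 4 \<or> (X + Y)\<^sup>2 \<ge> 4"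
    using abs_le_square_iff[of 2] by auto
  moreover have "X\<^sup>2 + X * Y + Y\<^sup>2 = (X + Y / 2)\<^sup>2 + 3/4 * Y\<^sup>2"
    "X\<^sup>2 + X * Y + Y\<^sup>2 = (Y + X / 2)\<^sup>2 + 3/4 * X\<^sup>2"
    "X\<^sup>2 + X * Y + Y\<^sup>2 = ((X - Y) / 2)\<^sup>2 + 3/4 * (X + Y)\<^sup>2"
    by (simp_all add: power2_eq_square field_simps)
  ultimately have "X\<^sup>2 + X * Y + Y\<^sup>2 > 1"
    using zero_le_power2[of "X + Y/2"] zero_le_power2[of "Y + X/2"] zero_le_power2[of "(X - Y)/2"]
    by (elim disjE) linarith+
  then show ?thesis unfolding X_def Y_def .
qed

lemma dist_sect_far:
  assumes "r > 0" "0 \<le> x" "0 \<le> y" "x + y \<le> 2" "w \<noteq> v" "w \<noteq> v + dir k" "w \<noteq> v + dir (Suc k)"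
  shows "dist (sect r v k x y) (ctr r w) > r"
proof -
  obtain a b where ab:
    "w - v = (a * fst (dir k) + b * fst (dir (Suc k)), a * snd (dir k) + b * snd (dir (Suc k)))"
    using dir_basis by blast
  have w: "w = v + (a * fst (dir k) + b * fst (dir (Suc k)), a * snd (dir k) + b * snd (dir (Suc k)))"
    using ab by (metis add_diff_cancel_left' diff_add_cancel add.commute)
  have "(a, b) \<noteq> (0, 0)" "(a, b) \<noteq> (1, 0)" "(a, b) \<noteq> (0, 1)"

    using assms(5-7) w by (auto simp: zero_prod_def)
  from quad_far[OF assms(2-4) this] have "r\<^sup>2 * 1 < (dist (sect r v k x y) (ctr r w))\<^sup>2"
    unfolding dist_sect_ctr_combo[OF ab] using assms(1) by (intro mult_strict_left_mono) auto
  then show ?thesis using assms(1) by (simp add: power2_less_imp_less)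
qed

section \<open>Links and interstices\<close>

lemma norm_emb: "(norm (emb r p))\<^sup>2 = r\<^sup>2 * of_int ((fst p)\<^sup>2 + fst p * snd p + (snd p)\<^sup>2)"
proof -
  have "emb r p = of_real (real_of_int (fst p)) * emb r (dir 0) + of_real (real_of_int (snd p)) * emb r (dir (Suc 0))"
    by (simp add: emb_def dir.simps(2) rot_def algebra_simps)
  then show ?thesis by (simp only: norm_combo) (simp add: power2_eq_square)
qed

lemma norm_emb_ge:
  assumes "r > 0" "p \<noteq> 0" shows "norm (emb r p) \<ge> r"
proof -
  obtain a b where p: "p = (a, b)" by (cases p)
  have "(2 * a + b)\<^sup>2 + 3 * b\<^sup>2 > 0"
    using assms(2) unfolding p by (cases "b = 0") (auto simp: zero_prod_def intro: add_nonneg_pos)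
  then have "a\<^sup>2 + a * b + b\<^sup>2 \<ge> 1" by (simp add: power2_eq_square algebra_simps)
  then have "r\<^sup>2 * 1 \<le> (norm (emb r p))\<^sup>2" unfolding norm_emb p
    by (intro mult_left_mono) (simp_all flip: of_int_power of_int_mult of_int_add)
  then show ?thesis by (intro power2_le_imp_le[of r]) simp_all
qed

lemma emb_inj: "r > 0 \<Longrightarrow> emb r p = emb r q \<longleftrightarrow> p = q"
  using norm_emb_ge[of r "p - q"] by (cases "p = q") (auto simp: emb_diff)

lemma dist_ctr_ge: "r > 0 \<Longrightarrow> v \<noteq> w \<Longrightarrow> dist (ctr r v) (ctr r w) \<ge> 2 * r"
proof -
  assume "r > 0" "v \<noteq> w"
  moreover have "ctr r v - ctr r w = 2 * emb r (v - w)" by (simp add: ctr_eq emb_diff algebra_simps)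
  ultimately show ?thesis using norm_emb_ge[of r "v - w"] by (simp add: dist_norm norm_mult)
qed

lemma ball_ctr_far: "r > 0 \<Longrightarrow> v \<noteq> w \<Longrightarrow> z \<in> ball (ctr r v) r \<Longrightarrow> dist z (ctr r w) > r"
  using dist_ctr_ge[of r v w] dist_triangle[of "ctr r v" "ctr r w" z] by (simp add: dist_commute)

definition quad :: "real \<Rightarrow> real \<Rightarrow> real" where "quad x y = x\<^sup>2 + x * y + y\<^sup>2"

lemma dist_sect:
  "(dist (sect r v k a b) (ctr r v))\<^sup>2 = r\<^sup>2 * quad a b"
  "(dist (sect r v k a b) (ctr r (v + dir k)))\<^sup>2 = r\<^sup>2 * quad (2 - a - b) b"
  "(dist (sect r v k a b) (ctr r (v + dir (Suc k))))\<^sup>2 = r\<^sup>2 * quad a (2 - a - b)"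
  unfolding dist_sect_ctr dist_sect_ctr_dir dist_sect_ctr_dir_Suc quad_def
  by (simp_all add: power2_eq_square algebra_simps)

lemma dist_less_iff_quad:
  fixes r d q :: real
  assumes "r > 0" "d \<ge> 0" "d\<^sup>2 = r\<^sup>2 * q"
  shows "d < r \<longleftrightarrow> q < 1" "d = r \<longleftrightarrow> q = 1" "r < d \<longleftrightarrow> 1 < q"
proof -
  have *: "x < y \<longleftrightarrow> x\<^sup>2 < y\<^sup>2" if "0 \<le> x" "0 \<le> y" for x y :: real
    using that power_strict_mono[of x y 2] power2_less_imp_less[of x y] by auto
  have "d < r \<longleftrightarrow> d\<^sup>2 < r\<^sup>2" "r < d \<longleftrightarrow> r\<^sup>2 < d\<^sup>2"
    using assms(1,2) *[of d r] *[of r d] by auto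
  moreover from this have "d = r \<longleftrightarrow> d\<^sup>2 = r\<^sup>2" by auto
  ultimately have "d < r \<longleftrightarrow> d\<^sup>2 < r\<^sup>2" "d = r \<longleftrightarrow> d\<^sup>2 = r\<^sup>2" "r < d \<longleftrightarrow> r\<^sup>2 < d\<^sup>2" by auto
  then show "d < r \<longleftrightarrow> q < 1" "d = r \<longleftrightarrow> q = 1" "r < d \<longleftrightarrow> 1 < q"
    using assms(1) unfolding assms(3) by (auto simp: mult_less_cancel_left1 mult_less_cancel_left2 zero_less_mult_iff)
qed

lemmas dist_sect_iff = 
  dist_less_iff_quad[OF _ zero_le_dist dist_sect(1)]
  dist_less_iff_quad[OF _ zero_le_dist dist_sect(2)]
  dist_less_iff_quad[OF _ zero_le_dist dist_sect(3)]

definition acoord :: "real \<Rightarrow> int \<times> int \<Rightarrow> nat \<Rightarrow> complex \<Rightarrow> real" where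
  "acoord r v k z = Re ((z - ctr r v) / emb r (dir k)) - Im ((z - ctr r v) / emb r (dir k)) / sqrt 3"

definition bcoord :: "real \<Rightarrow> int \<times> int \<Rightarrow> nat \<Rightarrow> complex \<Rightarrow> real" where
  "bcoord r v k z = 2 * Im ((z - ctr r v) / emb r (dir k)) / sqrt 3"

lemma sect_eq: "sect r v k a b = ctr r v + emb r (dir k) * (of_real a + of_real b * omega)"
  by (simp add: sect_def dir.simps(2) emb_rot algebra_simps)

lemma sect_coords:
  assumes "r > 0" shows "sect r v k (acoord r v k z) (bcoord r v k z) = z"
proof -
  let ?q = "(z - ctr r v) / emb r (dir k)"
  have nz: "emb r (dir k) \<noteq> 0" using assms emb_inj[of r "dir k" 0] by simp
  have "of_real (acoord r v k z) + of_real (bcoord r v k z) * omega = ?q"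
    unfolding acoord_def bcoord_def omega_eq by (simp add: complex_eq_iff field_simps)
  then show ?thesis unfolding sect_eq using nz by simp
qed

lemma sect_inj:
  assumes "r > 0" "sect r v k a b = sect r v k a' b'" shows "a = a' \<and> b = b'"
proof -
  have "of_real (a - a') * emb r (dir k) + of_real (b - b') * emb r (dir (Suc k)) = 0"
    using assms(2) by (simp add: sect_def algebra_simps)
  then have "r\<^sup>2 * ((a - a')\<^sup>2 + (a - a') * (b - b') + (b - b')\<^sup>2) = 0"
    using norm_combo[of "a - a'" r k "b - b'"] by simp
  then have "(a - a' + (b - b') / 2)\<^sup>2 + 3 * ((b - b') / 2)\<^sup>2 = 0"
    using assms(1) by simp (simp add: power2_eq_square field_simps)
  then have "(a - a' + (b - b') / 2)\<^sup>2 = 0" "3 * ((b - b') / 2)\<^sup>2 = 0"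
    by (simp_all only: add_nonneg_eq_0_iff zero_le_power2 mult_nonneg_nonneg zero_le_numeral)
  then have "a - a' + (b - b') / 2 = 0" "b = b'" by simp_all
  then show ?thesis by simp
qed

lemma coord_sect: "r > 0 \<Longrightarrow> acoord r v k (sect r v k a b) = a" "r > 0 \<Longrightarrow> bcoord r v k (sect r v k a b) = b"
  using sect_inj sect_coords by metis+

lemma isCont_acoord: "r > 0 \<Longrightarrow> isCont (acoord r v k) z" "r > 0 \<Longrightarrow> isCont (bcoord r v k) z"
  using emb_inj[of r "dir k" 0] unfolding acoord_def[abs_def] bcoord_def[abs_def]
  by (auto intro!: continuous_intros)

definition lk :: "real \<Rightarrow> int \<times> int \<Rightarrow> nat \<Rightarrow> complex set" where
  "lk r v k = path_image (link_path r (ctr r v) k)"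

definition node :: "real \<Rightarrow> int \<times> int \<Rightarrow> nat \<Rightarrow> complex" where
  "node r v k = emb r (v + v + dir k)"

lemma node_eq: "node r v k = ctr r v + emb r (dir k)"
  by (simp add: node_def ctr_def emb_add)

lemma node_sect: "node r v k = sect r v k 1 0" "node r v (Suc k) = sect r v k 0 1"
  by (simp_all add: node_eq sect_def)

lemma node_cong: "j mod 6 = k mod 6 \<Longrightarrow> node r v j = node r v k"
  unfolding node_def using dir_cong by metis

lemma node_eqD:
  "r > 0 \<Longrightarrow> node r v k = node r w m \<Longrightarrow>
    w = v \<and> m mod 6 = k mod 6 \<or> w = v + dir k \<and> m mod 6 = (k + 3) mod 6"
  unfolding node_def by (metis emb_inj double_add_dir_eq)

lemma link_path_ends:
  "pathstart (link_path r (ctr r v) k) = node r v k"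
  "pathfinish (link_path r (ctr r v) k) = node r v (Suc k)"
  by (simp_all add: link_path_def node_eq emb_dir cis_conv_exp algebra_simps del: of_nat_Suc)

lemma lk_param: "lk r v k = {ctr r v + r * cis t | t. real k * pi / 3 \<le> t \<and> t \<le> real (Suc k) * pi / 3}"
proof -
  have "real k * pi / 3 \<le> real (Suc k) * pi / 3" by (simp add: field_simps)
  then show ?thesis unfolding lk_def link_path_def by (simp add: path_image_part_circlepath cis_conv_exp del: of_nat_Suc)
qed

lemma lk_sect: "lk r v k = {sect r v k a b | a b. 0 \<le> a \<and> 0 \<le> b \<and> quad a b = 1}"
proof (intro subset_antisym subsetI)
  fix z assume "z \<in> lk r v k"
  then obtain t where t: "z = ctr r v + r * cis t" "real k * pi / 3 \<le> t" "t \<le> real (Suc k) * pi / 3"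
    unfolding lk_param by blast
  define s where "s = t - real k * pi / 3"
  have s: "0 \<le> s" "s \<le> pi / 3" using t by (auto simp: s_def field_simps)
  have "cis t = cis (real k * pi / 3) * cis s" by (simp add: s_def cis_mult)
  then have z: "z = ctr r v + emb r (dir k) * cis s" by (simp add: t(1) emb_dir)
  define a b where "a = 2 / sqrt 3 * sin (pi / 3 - s)" and "b = 2 / sqrt 3 * sin s"
  have a': "a = cos s - sin s / sqrt 3"
    unfolding a_def sin_diff cos_60 sin_60 by (simp add: field_simps)
  have "of_real a + of_real b * omega = cis s"
    unfolding a' b_def omega_eq by (simp add: complex_eq_iff field_simps)
  then have "z = sect r v k a b" unfolding z sect_eq by simp
  moreover have "0 \<le> a" "0 \<le> b" unfolding a_def b_def
    using s pi_gt_zero sin_ge_zero[of s] sin_ge_zero[of "pi / 3 - s"] by simp_all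
  moreover have "quad a b = 1"
  proof -
    have "quad a b = (cos s)\<^sup>2 + (sin s)\<^sup>2 * (3 / (sqrt 3 * sqrt 3))" unfolding quad_def a' b_def
      using sin_cos_squared_add3[of s] by (simp add: power2_eq_square field_simps; linarith)
    then show ?thesis by simp
  qed
  ultimately show "z \<in> {sect r v k a b | a b. 0 \<le> a \<and> 0 \<le> b \<and> quad a b = 1}" by blast
next
  fix z assume "z \<in> {sect r v k a b | a b. 0 \<le> a \<and> 0 \<le> b \<and> quad a b = 1}"
  then obtain a b where ab: "z = sect r v k a b" "0 \<le> a" "0 \<le> b" "quad a b = 1" by blast
  have "(a + b / 2)\<^sup>2 + (b * sqrt 3 / 2)\<^sup>2 = 1"
    using ab(4) by (simp add: quad_def power2_eq_square field_simps)
  then obtain s where s: "0 \<le> s" "s \<le> pi / 2" "a + b / 2 = cos s" "b * sqrt 3 / 2 = sin s"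
    using sincos_total_pi_half[of "a + b/2" "b * sqrt 3 / 2"] ab(2,3) by auto
  have "sin (pi / 3 - s) = sqrt 3 / 2 * a"
    by (simp add: sin_diff cos_60 sin_60 flip: s(3,4)) (simp add: field_simps)
  then have "sin (pi / 3 - s) \<ge> 0" using ab(2) by (metis divide_nonneg_pos mult_nonneg_nonneg real_sqrt_ge_zero zero_le_numeral zero_less_numeral)
  moreover have "sin (pi / 3 - s) = - sin (s - pi / 3)" by (metis minus_diff_eq sin_minus)
  ultimately have "\<not> sin (s - pi / 3) > 0" by simp
  then have s3: "s \<le> pi / 3" using sin_gt_zero[of "s - pi/3"] s(2) pi_gt_zero by fastforce
  have "of_real a + of_real b * omega = cis s"
    using s(3,4) unfolding omega_eq by (simp add: complex_eq_iff)
  then have "z = ctr r v + r * cis (real k * pi / 3 + s)" 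
    unfolding ab(1) sect_eq by (simp add: emb_dir cis_mult)
  then show "z \<in> lk r v k" unfolding lk_param using s(1) s3 by (auto simp: field_simps intro!: exI[of _ "real k * pi / 3 + s"])
qed

lemma sect_cong: "j mod 6 = k mod 6 \<Longrightarrow> sect r v j = sect r v k"
  unfolding sect_def[abs_def] dir.simps(2) using dir_cong[of j k] by simp

lemma lk_cong: "j mod 6 = k mod 6 \<Longrightarrow> lk r v j = lk r v k"
  unfolding lk_sect using sect_cong[of j k r v] by simp

lemma lk_mod [simp]: "lk r v (k mod 6) = lk r v k"
  by (rule lk_cong) simp

lemma links_eq: "links r = {lk r v k | v k. True}"
proof -
  have "\<exists>v' k'. lk r v k = path_image (link_path r v' k') \<and> v' \<in> tiling_vertices r \<and> k' < 6" for v k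
    using lk_mod[of r v k] unfolding lk_def tiling_vertices_eq
    by (intro exI[of _ "ctr r v"] exI[of _ "k mod 6"]) auto
  then show ?thesis unfolding links_def tiling_vertices_eq by (auto simp: lk_def)
qed

lemma lk_subset_sphere: "r > 0 \<Longrightarrow> z \<in> lk r v k \<Longrightarrow> dist z (ctr r v) = r"
  unfolding lk_sect by (auto simp: dist_sect_iff)

lemma lk_endsE:
  assumes "z \<in> lk r v k" "z \<noteq> node r v k" "z \<noteq> node r v (Suc k)"
  obtains a b where "z = sect r v k a b" "0 < a" "0 < b" "quad a b = 1"
proof -
  obtain a b where ab: "z = sect r v k a b" "0 \<le> a" "0 \<le> b" "quad a b = 1"
    using assms(1) unfolding lk_sect by blast
  have "a \<noteq> 0" using ab assms(3) by (auto simp: quad_def node_sect(2) power2_eq_1_iff)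
  moreover have "b \<noteq> 0" using ab assms(2) by (auto simp: quad_def node_sect(1) power2_eq_1_iff)
  ultimately show ?thesis using that ab by simp
qed

lemma quad_1_sum: assumes "quad a b = 1" shows "a + b < 2"
proof (rule ccontr)
  assume "\<not> a + b < 2"
  then have "(a + b)\<^sup>2 \<ge> 2\<^sup>2" by (intro power_mono) auto
  then have "(a + b)\<^sup>2 \<ge> 4" by simp
  moreover have "quad a b = 3/4 * (a + b)\<^sup>2 + ((a - b) / 2)\<^sup>2" by (simp add: quad_def power2_eq_square field_simps)
  ultimately show False using assms zero_le_power2[of "(a - b)/2"] by linarith
qed

lemma quad_1_far:
  assumes "0 < a" "0 < b" "quad a b = 1" shows "quad (2 - a - b) b > 1" "quad a (2 - a - b) > 1"
proof -
  have *: "2 * x + y < 2" if "0 < x" "0 < y" "quad x y = 1" for x y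
  proof -
    have "(2 * x + y)\<^sup>2 = 4 - 3 * y\<^sup>2" using that(3) by (simp add: quad_def power2_eq_square algebra_simps)
    then have "(2 * x + y)\<^sup>2 < 2\<^sup>2" using that(2) by simp
    then show ?thesis using power2_less_imp_less by fastforce
  qed
  have "quad b a = 1" using assms(3) by (simp add: quad_def algebra_simps)
  then have "2 * a + b < 2" "2 * b + a < 2" using * assms by auto
  moreover have "quad (2 - a - b) b = quad a b + 4 - 2 * (2 * a + b)"
     "quad a (2 - a - b) = quad a b + 4 - 2 * (2 * b + a)"
    by (simp_all add: quad_def power2_eq_square algebra_simps)
  ultimately show "quad (2 - a - b) b > 1" "quad a (2 - a - b) > 1" using assms(3) by auto
qed

lemma open_link_far:
  assumes "r > 0" "z = sect r v k a b" "0 < a" "0 < b" "quad a b = 1" "w \<noteq> v"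
  shows "dist z (ctr r w) > r"
proof -
  have "w = v + dir k \<or> w = v + dir (Suc k) \<or> (w \<noteq> v + dir k \<and> w \<noteq> v + dir (Suc k))" by blast
  then show ?thesis using assms quad_1_far[OF assms(3-5)] quad_1_sum[OF assms(5)]
    by (elim disjE) (auto simp: dist_sect_iff intro!: dist_sect_far)
qed

lemma sect_angle_unique:
  assumes "r > 0" "sect r v k a b = sect r v m c d" "0 < a" "0 < b" "0 \<le> c" "0 \<le> d"
  shows "m mod 6 = k mod 6"
proof -
  obtain i where i: "i < 6" "m mod 6 = (k + i) mod 6" using dir_shift by blast
  have m: "sect r v m c d = sect r v (k + i) c d" using sect_cong[OF i(2)] by simp
  have "sect r v (k + 1) c d = sect r v k (- d) (c + d)" "sect r v (k + 2) c d = sect r v k (- c - d) c"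
    "sect r v (k + 3) c d = sect r v k (- c) (- d)" "sect r v (k + 4) c d = sect r v k d (- c - d)"
    "sect r v (k + 5) c d = sect r v k (c + d) (- c)"
    by (simp_all add: sect_def dir_reduce emb_diff emb_minus algebra_simps)
  then have "i = 0" using i(1) assms sect_inj[OF assms(1)] unfolding lt_6_cases m by (elim disjE; fastforce)
  then show ?thesis using i(2) by simp
qed

lemma lk_inter:
  assumes "r > 0" "z \<in> lk r v k" "z \<in> lk r w m" "z \<noteq> node r v k" "z \<noteq> node r v (Suc k)"
  shows "w = v \<and> m mod 6 = k mod 6"
proof -
  obtain a b where ab: "z = sect r v k a b" "0 < a" "0 < b" "quad a b = 1"
    using lk_endsE assms(2,4,5) by metis
  have "w = v" using open_link_far[OF assms(1) ab, of w] lk_subset_sphere[OF assms(1,3)] by auto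
  moreover obtain c d where "z = sect r w m c d" "0 \<le> c" "0 \<le> d" using assms(3) unfolding lk_sect by blast
  ultimately show ?thesis using sect_angle_unique[of r v k a b m c d] ab assms(1) by auto
qed

definition lmid :: "real \<Rightarrow> int \<times> int \<Rightarrow> nat \<Rightarrow> complex" where
  "lmid r v k = sect r v k (1 / sqrt 3) (1 / sqrt 3)"

lemma lmid: "lmid r v k \<in> lk r v k" "r > 0 \<Longrightarrow> lmid r v k \<noteq> node r v k" "r > 0 \<Longrightarrow> lmid r v k \<noteq> node r v (Suc k)"
proof -
  have "quad (1 / sqrt 3) (1 / sqrt 3) = 1" by (simp add: quad_def power2_eq_square)
  then show "lmid r v k \<in> lk r v k" unfolding lk_sect lmid_def by (auto intro!: exI[of _ "1 / sqrt 3"])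
  show "lmid r v k \<noteq> node r v k" "lmid r v k \<noteq> node r v (Suc k)" if "r > 0"
    unfolding lmid_def node_sect(2) using sect_inj[OF that] node_sect(1)[of r v k] by fastforce+
qed

lemma lmid_unique: "r > 0 \<Longrightarrow> lmid r v k \<in> lk r w m \<Longrightarrow> w = v \<and> m mod 6 = k mod 6"
  using lk_inter lmid by blast

lemma lk_eq_iff: "r > 0 \<Longrightarrow> lk r v k = lk r w m \<longleftrightarrow> w = v \<and> m mod 6 = k mod 6"
  using lmid_unique lmid(1) lk_cong by metis

text \<open>The interstice between three mutually tangent circles; it is star-shaped about its centroid \<open>cen\<close>.\<close>

definition tri :: "real \<Rightarrow> int \<times> int \<Rightarrow> nat \<Rightarrow> complex set" where
  "tri r v k = {sect r v k a b | a b. 0 \<le> a \<and> 0 \<le> b \<and> a + b \<le> 2 \<and>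
      1 < quad a b \<and> 1 < quad (2 - a - b) b \<and> 1 < quad a (2 - a - b)}"

definition cen :: "real \<Rightarrow> int \<times> int \<Rightarrow> nat \<Rightarrow> complex" where
  "cen r v k = sect r v k (2/3) (2/3)"

lemma cen_rot: "cen r (v + dir k) (k + 2) = cen r v k"
  by (simp add: cen_def sect_def ctr_eq emb_add dir_reduce emb_diff emb_minus algebra_simps)

lemma cen_cong: "j mod 6 = k mod 6 \<Longrightarrow> cen r v j = cen r v k"
  unfolding cen_def using sect_cong by metis

lemma tri_far:
  assumes "r > 0" "z \<in> tri r v k" shows "dist z (ctr r w) > r"
proof -
  obtain a b where ab: "z = sect r v k a b" "0 \<le> a" "0 \<le> b" "a + b \<le> 2"
      "1 < quad a b" "1 < quad (2 - a - b) b" "1 < quad a (2 - a - b)"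
    using assms(2) unfolding tri_def by blast
  have "w = v \<or> w = v + dir k \<or> w = v + dir (Suc k) \<or> (w \<noteq> v \<and> w \<noteq> v + dir k \<and> w \<noteq> v + dir (Suc k))" by blast
  then show ?thesis using assms(1) ab
    by (elim disjE) (auto simp: dist_sect_iff intro!: dist_sect_far)
qed

lemma quad_star:
  assumes "0 \<le> a" "0 \<le> b" "1 < quad a b" "0 \<le> t" "t \<le> 1"
  shows "1 < quad ((1 - t) * (2/3) + t * a) ((1 - t) * (2/3) + t * b)"
proof -
  have "(a + b)\<^sup>2 = quad a b + a * b" by (simp add: quad_def power2_eq_square algebra_simps)
  then have "(a + b)\<^sup>2 > 1\<^sup>2" using assms by (smt (verit) mult_nonneg_nonneg one_power2)
  then have ab: "a + b > 1" using assms(1,2) power2_less_imp_less[of 1 "a + b"] by simp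
  have "quad ((1 - t) * (2/3) + t * a) ((1 - t) * (2/3) + t * b)
      = t\<^sup>2 * quad a b + 2 * t * (1 - t) * (a + b) + (1 - t)\<^sup>2 * (4/3)"
    by (simp add: quad_def power2_eq_square field_simps)
  also have "\<dots> > t\<^sup>2 * 1 + 2 * t * (1 - t) * 1 + (1 - t)\<^sup>2 * 1"
  proof (cases "t = 0")
    case False
    have "t\<^sup>2 * 1 < t\<^sup>2 * quad a b" using False assms(3) by (intro mult_strict_left_mono) auto
    moreover have "2 * t * (1 - t) * 1 \<le> 2 * t * (1 - t) * (a + b)" using ab assms(4,5) by (intro mult_left_mono) auto
    ultimately show ?thesis using zero_le_power2[of "1 - t"] by linarith
  qed simp
  finally show ?thesis by (simp add: power2_eq_square algebra_simps)
qed

lemma tri_segment: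
  assumes "z \<in> tri r v k" "0 \<le> t" "t \<le> 1"
  shows "(1 - t) *\<^sub>R cen r v k + t *\<^sub>R z \<in> tri r v k"
proof -
  obtain a b where ab: "z = sect r v k a b" "0 \<le> a" "0 \<le> b" "a + b \<le> 2"
      "1 < quad a b" "1 < quad (2 - a - b) b" "1 < quad a (2 - a - b)"
    using assms(1) unfolding tri_def by blast
  define A B where "A = (1 - t) * (2/3) + t * a" and "B = (1 - t) * (2/3) + t * b"
  have C: "2 - A - B = (1 - t) * (2/3) + t * (2 - a - b)" by (simp add: A_def B_def field_simps)
  have "(1 - t) *\<^sub>R cen r v k + t *\<^sub>R z = sect r v k A B"
    unfolding ab cen_def sect_def A_def B_def by (simp add: scaleR_conv_of_real algebra_simps)
  moreover have "1 < quad A B" "1 < quad (2 - A - B) B" "1 < quad A (2 - A - B)"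
    unfolding C unfolding A_def B_def using ab assms(2,3) by (intro quad_star; simp)+
  moreover have "0 \<le> A" "0 \<le> B" "0 \<le> 2 - A - B" 
    unfolding C unfolding A_def B_def using ab assms(2,3) by (auto intro!: add_nonneg_nonneg mult_nonneg_nonneg)
  ultimately show ?thesis unfolding tri_def by (intro CollectI exI[of _ A] exI[of _ B]) simp
qed

lemma cen_in_tri: "cen r v k \<in> tri r v k"
  unfolding cen_def tri_def quad_def by (auto intro!: exI[of _ "2/3"] simp: power2_eq_square)

lemma connected_tri: "connected (tri r v k)"
proof -
  have "closed_segment (cen r v k) z \<subseteq> tri r v k" if "z \<in> tri r v k" for z
    using tri_segment[OF that] by (auto simp: closed_segment_def)
  then have "starlike (tri r v k)" unfolding starlike_def using cen_in_tri by blast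
  then show ?thesis by (rule starlike_imp_connected)
qed

lemma link_local:
  assumes "r > 0" "z \<in> lk r v k" "z \<noteq> node r v k" "z \<noteq> node r v (Suc k)"
  shows "\<forall>\<^sub>F w in nhds z. w \<in> ball (ctr r v) r \<or> w \<in> lk r v k \<or> w \<in> tri r v k"
proof -
  obtain a b where ab: "z = sect r v k a b" "0 < a" "0 < b" "quad a b = 1"
    using lk_endsE assms(2,3,4) by metis
  have ac: "acoord r v k z = a" "bcoord r v k z = b" using ab(1) coord_sect[OF assms(1)] by auto
  note cont = isCont_acoord[OF assms(1), where v = v and k = k and z = z,
    unfolded isCont_def tendsto_at_iff_tendsto_nhds]
  have "v + dir k \<noteq> v" "v + dir (Suc k) \<noteq> v" by auto
  then have d: "dist z (ctr r (v + dir k)) > r" "dist z (ctr r (v + dir (Suc k))) > r"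
    using open_link_far[OF assms(1) ab] by auto
  have e1: "\<forall>\<^sub>F w in nhds z. acoord r v k w > 0" 
    using order_tendstoD(1)[OF cont(1)] ab ac by simp
  have e2: "\<forall>\<^sub>F w in nhds z. bcoord r v k w > 0" 
    using order_tendstoD(1)[OF cont(2)] ab ac by simp
  have e3: "\<forall>\<^sub>F w in nhds z. acoord r v k w + bcoord r v k w < 2"
    using order_tendstoD(2)[OF tendsto_add[OF cont]] quad_1_sum[OF ab(4)] ac by simp
  have t: "((\<lambda>w. dist w c) \<longlongrightarrow> dist z c) (nhds z)" for c
    by (intro tendsto_intros) (simp add: filterlim_ident)
  have e4: "\<forall>\<^sub>F w in nhds z. dist w (ctr r (v + dir k)) > r"
    and e5: "\<forall>\<^sub>F w in nhds z. dist w (ctr r (v + dir (Suc k))) > r"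
    using order_tendstoD(1)[OF t] d by auto
  show ?thesis using e1 e2 e3 e4 e5
  proof eventually_elim
    case (elim w)
    define x y where "x = acoord r v k w" and "y = bcoord r v k w"
    have w: "w = sect r v k x y" using sect_coords[OF assms(1)] by (simp add: x_def y_def)
    have "1 < quad (2 - x - y) y" "1 < quad x (2 - x - y)" 
      using elim(4,5) unfolding w dist_sect_iff[OF assms(1)] by auto
    moreover have "0 < x" "0 < y" "x + y < 2" using elim by (auto simp: x_def y_def)
    moreover have "quad x y < 1 \<or> quad x y = 1 \<or> 1 < quad x y" by linarith
    moreover have "w \<in> ball (ctr r v) r \<longleftrightarrow> quad x y < 1"
      unfolding w mem_ball using dist_sect_iff(1)[OF assms(1)] by (simp add: dist_commute)
    moreover have "quad x y = 1 \<Longrightarrow> w \<in> lk r v k" using \<open>0 < x\<close> \<open>0 < y\<close> unfolding lk_sect w by force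
    moreover have "1 < quad x y \<Longrightarrow> w \<in> tri r v k" using calculation(1-5) unfolding tri_def w by force
    ultimately show ?case by blast
  qed
qed

section \<open>Sides of a link\<close>

lemma connected_inside_iff:
  assumes "connected T" "T \<inter> C = {}" "x \<in> T" "y \<in> T"
  shows "x \<in> inside C \<longleftrightarrow> y \<in> inside C"
proof -
  have "connected_component (- C) x y" "connected_component (- C) y x"
    using assms unfolding connected_component_def by blast+
  then show ?thesis using inside_same_component by blast
qed

lemma ball_not_lk: "r > 0 \<Longrightarrow> z \<in> ball (ctr r v) r \<Longrightarrow> z \<notin> lk r w m"
  using ball_ctr_far[of r v w z] lk_subset_sphere[of r z w m]
  by (cases "w = v") (auto simp: dist_commute)

lemma tri_not_lk: "r > 0 \<Longrightarrow> z \<in> tri r v k \<Longrightarrow> z \<notin> lk r w m"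
  using tri_far[of r z v k w] lk_subset_sphere[of r z w m] by auto

definition link_union :: "real \<Rightarrow> complex set \<Rightarrow> bool" where
  "link_union r C \<longleftrightarrow> (\<exists>L. finite L \<and> L \<subseteq> links r \<and> C = \<Union>L)"

lemma link_unionE:
  assumes "link_union r C" "z \<in> C"
  obtains v k where "z \<in> lk r v k" "lk r v k \<subseteq> C"
  using assms unfolding link_union_def links_eq by blast

lemma link_union_not_in:
  assumes "r > 0" "link_union r C" "z \<in> ball (ctr r v) r \<or> z \<in> tri r v k"
  shows "z \<notin> C"
proof
  assume "z \<in> C"
  then obtain w m where "z \<in> lk r w m" using link_unionE assms(2) by blast
  then show False using assms(3) ball_not_lk[OF assms(1)] tri_not_lk[OF assms(1)] by blast
qed

lemma link_union_disjoint:
  assumes "r > 0" "link_union r C" "\<not> lk r v k \<subseteq> C" "z \<in> lk r v k" "z \<noteq> node r v k" "z \<noteq> node r v (Suc k)"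
  shows "z \<notin> C"
proof
  assume "z \<in> C"
  then obtain w m where wm: "z \<in> lk r w m" "lk r w m \<subseteq> C" using link_unionE assms(2) by blast
  then have "w = v \<and> m mod 6 = k mod 6" using lk_inter assms by blast
  then show False using wm(2) assms(3) lk_cong by metis
qed

lemma ball_state:
  assumes "r > 0" "link_union r C" "w \<in> ball (ctr r v) r"
  shows "w \<in> inside C \<longleftrightarrow> ctr r v \<in> inside C"
proof (rule connected_inside_iff[OF connected_ball _ assms(3)])
  show "ball (ctr r v) r \<inter> C = {}" using link_union_not_in[OF assms(1,2)] by blast
qed (use assms in auto)

lemma tri_state:
  assumes "r > 0" "link_union r C" "w \<in> tri r v k"
  shows "w \<in> inside C \<longleftrightarrow> cen r v k \<in> inside C"
proof (rule connected_inside_iff[OF connected_tri _ assms(3) cen_in_tri])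
  show "tri r v k \<inter> C = {}" using link_union_not_in[OF assms(1,2)] by blast
qed

lemma mid_path:
  assumes "r > 0" "0 \<le> x" "x \<le> 2/3"
  shows "sect r v k x x \<in> ball (ctr r v) r \<or> sect r v k x x = lmid r v k \<or> sect r v k x x \<in> tri r v k"
proof -
  have q: "quad x x = 3 * x\<^sup>2" "quad (2 - x - x) x = 3 * (1 - x)\<^sup>2 + 1" "quad x (2 - x - x) = 3 * (1 - x)\<^sup>2 + 1"
    by (simp_all add: quad_def power2_eq_square algebra_simps)
  consider "quad x x < 1" | "quad x x = 1" | "quad x x > 1" by linarith
  then show ?thesis
  proof cases
    case 1
    then have "sect r v k x x \<in> ball (ctr r v) r"
      using dist_sect_iff(1)[OF assms(1)] by (simp add: dist_commute)
    then show ?thesis by simp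
  next
    case 2
    then have "x\<^sup>2 = (1 / sqrt 3)\<^sup>2" unfolding q by (simp add: power_divide)
    then have "x = 1 / sqrt 3" using assms(2) by (simp only: power2_eq_iff_nonneg divide_nonneg_nonneg real_sqrt_ge_zero zero_le_numeral zero_le_one)
    then show ?thesis by (simp add: lmid_def)
  next
    case 3
    moreover have "(1 - x)\<^sup>2 > 0" using assms(3) by simp
    then have "1 < quad (2 - x - x) x" "1 < quad x (2 - x - x)" unfolding q by simp_all
    ultimately have "sect r v k x x \<in> tri r v k" unfolding tri_def
      using assms by (intro CollectI exI[of _ x]) simp
    then show ?thesis by simp
  qed
qed

lemma not_link_state:
  assumes "r > 0" "link_union r C" "\<not> lk r v k \<subseteq> C"
  shows "ctr r v \<in> inside C \<longleftrightarrow> cen r v k \<in> inside C"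
proof (rule connected_inside_iff)
  let ?T = "(\<lambda>x. sect r v k x x) ` {0..2/3}"
  show "connected ?T" unfolding sect_def
    by (intro connected_continuous_image continuous_intros connected_Icc)
  show "?T \<inter> C = {}"
  proof (intro equalityI subsetI)
    fix z assume z: "z \<in> ?T \<inter> C"
    then obtain x where x: "z = sect r v k x x" "0 \<le> x" "x \<le> 2/3" by auto
    have "z \<in> ball (ctr r v) r \<or> z = lmid r v k \<or> z \<in> tri r v k"
      using mid_path[OF assms(1) x(2,3)] x(1) by blast
    moreover have "lmid r v k \<notin> C" using link_union_disjoint[OF assms] lmid assms(1) by blast
    ultimately show "z \<in> {}"
      using z link_union_not_in[OF assms(1,2)] by blast
  qed auto
  show "ctr r v \<in> ?T" by (auto simp: sect_def intro!: image_eqI[of _ _ 0])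
  show "cen r v k \<in> ?T" by (auto simp: cen_def intro!: image_eqI[of _ _ "2/3"])
qed

lemma triangular_tangle_link_union: "triangular_tangle r C \<Longrightarrow> link_union r C"
  by (simp add: triangular_tangle_def link_union_def)

lemma triangular_tangle_Jordan:
  assumes "triangular_tangle r C"
  shows "inside C \<noteq> {}" "open (inside C)" "bounded (inside C)" "connected C" "closed C"
    "inside C \<inter> outside C = {}" "inside C \<union> outside C = - C"
    "frontier (inside C) = C" "frontier (outside C) = C"
proof -
  obtain g where g: "simple_path g" "path_image g = C" "\<And>t. g (t + 1) = g t"
    using assms unfolding triangular_tangle_def smooth_simple_closed_curve_def by blast
  have "g 1 = g 0" using g(3)[of 0] by simp
  then have "pathfinish g = pathstart g" by (simp add: pathfinish_def pathstart_def)
  from Jordan_inside_outside[OF g(1) this]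
  show "inside C \<noteq> {}" "open (inside C)" "bounded (inside C)"
    "inside C \<inter> outside C = {}" "inside C \<union> outside C = - C"
    "frontier (inside C) = C" "frontier (outside C) = C" unfolding g(2) by auto
  show "connected C" "closed C" 
    using g connected_simple_path_image closed_simple_path_image by blast+
qed

lemma link_state:
  assumes "r > 0" "triangular_tangle r C" "lk r v k \<subseteq> C"
  shows "ctr r v \<in> inside C \<longleftrightarrow> cen r v k \<notin> inside C"
proof -
  note J = triangular_tangle_Jordan[OF assms(2)] and U = triangular_tangle_link_union[OF assms(2)]
  have "lmid r v k \<in> C" using assms(3) lmid by blast
  then have cl: "lmid r v k \<in> closure (inside C)" "lmid r v k \<in> closure (outside C)"
    using J(8,9) unfolding frontier_def by blast+
  obtain T where T: "open T" "lmid r v k \<in> T"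
      "\<And>w. w \<in> T \<Longrightarrow> w \<in> ball (ctr r v) r \<or> w \<in> lk r v k \<or> w \<in> tri r v k"
    using link_local[OF assms(1) lmid(1) lmid(2)[OF assms(1)] lmid(3)[OF assms(1)], of v k]
    unfolding eventually_nhds by metis
  have "T \<inter> inside C \<noteq> {}" "T \<inter> outside C \<noteq> {}"
    using cl T(1,2) open_Int_closure_eq_empty[OF T(1)] by blast+
  then obtain w w' where w: "w \<in> T" "w \<in> inside C" "w' \<in> T" "w' \<in> outside C" by blast
  then have ww: "w \<notin> C" "w' \<notin> C" "w' \<notin> inside C" using J(6,7) by blast+
  then have "w \<in> ball (ctr r v) r \<or> w \<in> tri r v k" "w' \<in> ball (ctr r v) r \<or> w' \<in> tri r v k"
    using T(3)[of w] T(3)[of w'] w assms(3) by blast+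
  then show ?thesis using w ww ball_state[OF assms(1) U, of w] tri_state[OF assms(1) U, of w]
     ball_state[OF assms(1) U, of w'] tri_state[OF assms(1) U, of w'] by blast
qed

lemma link_side:
  assumes "r > 0" "triangular_tangle r C" "lk r v k \<subseteq> C" "z \<in> lk r v k" "z \<noteq> node r v k" "z \<noteq> node r v (Suc k)"
  shows "\<forall>\<^sub>F w in nhds z. w \<in> inside C \<longleftrightarrow> (if ctr r v \<in> inside C then dist (ctr r v) w < r else dist (ctr r v) w > r)"
  using link_local[OF assms(1,4-6)]
proof eventually_elim
  case (elim w)
  note U = triangular_tangle_link_union[OF assms(2)]
  from elim consider "w \<in> ball (ctr r v) r" | "w \<in> lk r v k" | "w \<in> tri r v k" by blast
  then show ?case
  proof cases
    case 1
    then show ?thesis using ball_state[OF assms(1) U 1] by auto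
  next
    case 2
    then have "w \<notin> inside C" using assms(3) triangular_tangle_Jordan[OF assms(2)] by blast
    then show ?thesis using lk_subset_sphere[OF assms(1) 2] by (simp add: dist_commute)
  next
    case 3
    then show ?thesis
      using tri_state[OF assms(1) U 3] tri_far[OF assms(1) 3, of v] link_state[OF assms(1-3)] by (auto simp: dist_commute)
  qed
qed

lemma node_dist:
  assumes "r > 0" "dist (node r v k) (ctr r w) = r" shows "w = v \<or> w = v + dir k"
proof (rule ccontr)
  assume w: "\<not> (w = v \<or> w = v + dir k)"
  have "r < dist (node r v k) (ctr r w)"
  proof (cases "w = v + dir (Suc k)")
    case True
    then show ?thesis using dist_sect_iff(9)[OF assms(1), of v k 1 0] by (simp add: node_sect(1) quad_def)
  next
    case False
    then show ?thesis using w assms(1) unfolding node_sect(1) by (intro dist_sect_far) auto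
  qed
  then show False using assms(2) by simp
qed

lemma near_node_circles:
  assumes "r > 0" "link_union r C"
  shows "\<forall>\<^sub>F w in nhds (node r v k). w \<in> C \<longrightarrow> dist w (ctr r v) = r \<or> dist w (ctr r (v + dir k)) = r"
proof -
  obtain L where L: "finite L" "L \<subseteq> links r" "C = \<Union>L" using assms(2) unfolding link_union_def by blast
  have "\<forall>\<^sub>F w in nhds (node r v k). w \<in> A \<longrightarrow> dist w (ctr r v) = r \<or> dist w (ctr r (v + dir k)) = r"
    if A: "A \<in> L" for A
  proof -
    obtain w m where wm: "A = lk r w m" using A L(2) unfolding links_eq by blast
    show ?thesis
    proof (cases "node r v k \<in> A")
      case True
      then have "w = v \<or> w = v + dir k" using node_dist lk_subset_sphere assms(1) unfolding wm by blast
      then show ?thesis using lk_subset_sphere[OF assms(1)] unfolding wm by (intro always_eventually) blast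
    next
      case False
      have "closed A" unfolding wm lk_def link_path_def by (simp add: closed_path_image)
      then have "\<forall>\<^sub>F w in nhds (node r v k). w \<in> - A" using False by (intro eventually_nhds_in_open) auto
      then show ?thesis by eventually_elim simp
    qed
  qed
  then have "\<forall>\<^sub>F w in nhds (node r v k). \<forall>A\<in>L. w \<in> A \<longrightarrow> dist w (ctr r v) = r \<or> dist w (ctr r (v + dir k)) = r"
    using L(1) by (intro eventually_ball_finite) auto
  then show ?thesis unfolding L(3) by eventually_elim blast
qed

section \<open>Tangles as boundaries of vertex sets\<close>

lemma periodic_int:
  fixes g :: "real \<Rightarrow> 'a"
  assumes "\<And>t. g (t + 1) = g t" shows "g (t + of_int n) = g t"
proof (induction n rule: int_induct[where k = 0])
  case (step1 i)
  then show ?case using assms[of "t + of_int i"] by (simp add: add.assoc)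
next
  case (step2 i)
  then show ?case using assms[of "t + of_int (i - 1)"] by (simp add: add.assoc)
qed simp

lemma unit_circle_Re: 
  "norm (x + 1) = 1 \<Longrightarrow> Re x = - ((Re x)\<^sup>2 + (Im x)\<^sup>2) / 2" "norm (x - 1) = 1 \<Longrightarrow> Re x = ((Re x)\<^sup>2 + (Im x)\<^sup>2) / 2"
proof -
  assume "norm (x + 1) = 1"
  then have "(norm (x + 1))\<^sup>2 = 1" by simp
  then show "Re x = - ((Re x)\<^sup>2 + (Im x)\<^sup>2) / 2"
    unfolding cmod_power2 by (simp add: power2_eq_square algebra_simps)
next
  assume "norm (x - 1) = 1"
  then have "(norm (x - 1))\<^sup>2 = 1" by simp
  then show "Re x = ((Re x)\<^sup>2 + (Im x)\<^sup>2) / 2"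
    unfolding cmod_power2 by (simp add: power2_eq_square algebra_simps)
qed

text \<open>
  In coordinates that put the node at \<open>0\<close> and the centres of the two circles at \<open>-1\<close> and \<open>1\<close>, the
  curve satisfies \<open>\<bar>Re z\<bar> = \<bar>z\<bar>\<^sup>2 / 2\<close> near \<open>0\<close>, so its velocity there is a nonzero multiple of
  \<open>\<i>\<close>.  The points with \<open>Im z > 0\<close> hence come from parameters on one side of the node and form a
  connected set, which cannot meet both circles.
\<close>

lemma no_cusp:
  assumes r: "r > 0" and tan: "triangular_tangle r C"
    and A: "lk r v k \<subseteq> C" and A': "lk r (v + dir k) (k + 2) \<subseteq> C"
  shows False
proof -
  define e where "e = emb r (dir k)"
  define m where "m = node r v k"
  have ne: "norm e = r" "e \<noteq> 0" using r by (auto simp: e_def emb_dir norm_mult)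
  have ev: "ctr r v = m - e" and eu: "ctr r (v + dir k) = m + e"
    by (auto simp: m_def e_def node_eq ctr_eq emb_add)
  obtain g where per: "\<And>t. g (t + 1) = g t" and C1: "g C1_differentiable_on UNIV"
    and nz: "\<And>t. vector_derivative g (at t) \<noteq> 0" and sp: "simple_path g" and im: "path_image g = C"
    using tan unfolding triangular_tangle_def smooth_simple_closed_curve_def by blast
  have pern: "g (t + of_int n) = g t" for t n using periodic_int[of g, OF per] .
  have inj: "\<exists>n::int. s - t = of_int n" if "g s = g t" for s t
  proof -
    have "g (frac s) = g (frac t)"
      using that pern[of "frac s" "\<lfloor>s\<rfloor>"] pern[of "frac t" "\<lfloor>t\<rfloor>"] by (simp add: frac_def)
    moreover have "0 \<le> frac s" "frac s < 1" "0 \<le> frac t" "frac t < 1" by (auto simp: frac_lt_1)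
    ultimately have "frac s = frac t"
      using sp unfolding simple_path_def loop_free_def by fastforce
    then show ?thesis by (intro exI[of _ "\<lfloor>s\<rfloor> - \<lfloor>t\<rfloor>"]) (simp add: frac_def)
  qed
  have "m \<in> lk r v k" unfolding m_def node_sect(1) lk_sect by (intro CollectI exI[of _ 1] exI[of _ 0]) (simp add: quad_def)
  then obtain t0 where t0: "g t0 = m" using A im unfolding path_image_def by blast
  have diff: "g differentiable at t" for t using C1 unfolding C1_differentiable_on_eq by blast
  then have contg: "continuous_on UNIV g"
    by (auto intro!: continuous_at_imp_continuous_on differentiable_imp_continuous_within)
  define D where "D = vector_derivative g (at t0)"
  have gD: "(g has_vector_derivative D) (at t0)" unfolding D_def using diff vector_derivative_works by blast
  define f where "f t = (g t - m) / e" for t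
  define l where "l = D / e"
  have l: "l \<noteq> 0" using nz[of t0] ne unfolding l_def D_def by simp
  have fD: "(f has_vector_derivative l) (at t0)"
    unfolding f_def[abs_def] l_def using gD by (auto intro!: derivative_eq_intros)
  have f0: "f t0 = 0" by (simp add: f_def t0)
  have RD: "((\<lambda>t. Re (f t) / (t - t0)) \<longlongrightarrow> Re l) (at t0)"
    and ID: "((\<lambda>t. Im (f t) / (t - t0)) \<longlongrightarrow> Im l) (at t0)"
    using has_field_derivative_Re[OF fD] has_field_derivative_Im[OF fD] unfolding has_field_derivative_iff by (simp_all add: f0)
  have gt: "(g \<longlongrightarrow> m) (at t0)"
    using contg t0 by (auto simp: continuous_on_eq_continuous_at isCont_def)
  then have ft: "(f \<longlongrightarrow> 0) (at t0)" unfolding f_def[abs_def] using ne by (auto intro!: tendsto_eq_intros)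
  have gC: "g t \<in> C" for t
  proof -
    have "g t = g (frac t)" using pern[of "frac t" "\<lfloor>t\<rfloor>"] by (simp add: frac_def)
    then show ?thesis using im unfolding path_image_def by (auto simp: frac_lt_1 less_imp_le)
  qed
  have circ: "(dist w (ctr r v) = r \<longleftrightarrow> norm ((w - m) / e + 1) = 1)" 
    "(dist w (ctr r (v + dir k)) = r \<longleftrightarrow> norm ((w - m) / e - 1) = 1)" for w
  proof -
    have "(w - m) / e + 1 = (w - (m - e)) / e" "(w - m) / e - 1 = (w - (m + e)) / e" using ne by (auto simp: field_simps)
    then show "(dist w (ctr r v) = r \<longleftrightarrow> norm ((w - m) / e + 1) = 1)" 
    "(dist w (ctr r (v + dir k)) = r \<longleftrightarrow> norm ((w - m) / e - 1) = 1)"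
      unfolding ev eu dist_norm using ne r by (auto simp: norm_divide)
  qed
  have near: "\<forall>\<^sub>F w in nhds m. w \<in> C \<longrightarrow> dist w (ctr r v) = r \<or> dist w (ctr r (v + dir k)) = r"
    using near_node_circles[OF r triangular_tangle_link_union[OF tan]] unfolding m_def .
  have near': "\<forall>\<^sub>F t in at t0. dist (g t) (ctr r v) = r \<or> dist (g t) (ctr r (v + dir k)) = r"
  proof -
    have "\<forall>\<^sub>F t in at t0. g t \<in> C \<longrightarrow> dist (g t) (ctr r v) = r \<or> dist (g t) (ctr r (v + dir k)) = r"
      using gt near by (rule eventually_compose_filterlim[rotated])
    then show ?thesis using gC by simp
  qed
  have "Re l = 0"
  proof -
    have "\<forall>\<^sub>F t in at t0. \<bar>Re (f t) / (t - t0)\<bar> = \<bar>(Re (f t) / (t - t0) * Re (f t) + Im (f t) / (t - t0) * Im (f t)) / 2\<bar>"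
      using near'
    proof eventually_elim
      case (elim t)
      then have "\<bar>Re (f t)\<bar> = \<bar>(Re (f t) * Re (f t) + Im (f t) * Im (f t)) / 2\<bar>"
        using unit_circle_Re[of "f t"] unfolding circ f_def[symmetric] power2_eq_square
          by (metis abs_minus_cancel minus_divide_left)
      moreover have "(Re (f t) / (t - t0) * Re (f t) + Im (f t) / (t - t0) * Im (f t)) / 2
          = (Re (f t) * Re (f t) + Im (f t) * Im (f t)) / 2 / (t - t0)"
        by (simp add: add_divide_distrib mult.commute)
      ultimately show ?case by (simp only: abs_divide)
    qed
    moreover have "((\<lambda>t. \<bar>(Re (f t) / (t - t0) * Re (f t) + Im (f t) / (t - t0) * Im (f t)) / 2\<bar>) \<longlongrightarrow> 
        \<bar>(Re l * Re 0 + Im l * Im 0) / 2\<bar>) (at t0)"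
      by (intro tendsto_intros RD ID ft) simp
    ultimately have "((\<lambda>t. \<bar>Re (f t) / (t - t0)\<bar>) \<longlongrightarrow> 0) (at t0)"
      using tendsto_cong by fastforce
    moreover have "((\<lambda>t. \<bar>Re (f t) / (t - t0)\<bar>) \<longlongrightarrow> \<bar>Re l\<bar>) (at t0)" by (intro tendsto_intros RD)
    ultimately show ?thesis using tendsto_unique[OF at_neq_bot] by fastforce
  qed
  then have Il: "Im l \<noteq> 0" using l by (simp add: complex_eq_iff)
  have "((\<lambda>t. Im (f t) / (t - t0) * Im l) \<longlongrightarrow> Im l * Im l) (at t0)" by (intro tendsto_intros ID)
  moreover have "Im l * Im l > 0" using Il by (simp add: zero_less_mult_iff) linarith
  ultimately have "\<forall>\<^sub>F t in at t0. Im (f t) / (t - t0) * Im l > 0" using order_tendstoD(1) by blast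
  with near' have "\<forall>\<^sub>F t in at t0. Im (f t) / (t - t0) * Im l > 0 \<and>
     (dist (g t) (ctr r v) = r \<or> dist (g t) (ctr r (v + dir k)) = r)" by eventually_elim blast
  then obtain \<delta> where \<delta>: "\<delta> > 0" "\<And>t. t \<noteq> t0 \<Longrightarrow> dist t t0 < \<delta> \<Longrightarrow> Im (f t) / (t - t0) * Im l > 0 \<and>
     (dist (g t) (ctr r v) = r \<or> dist (g t) (ctr r (v + dir k)) = r)"
    unfolding eventually_at by blast
  define K where "K = {t0 - 1/2 .. t0 + 1/2} - ball t0 \<delta>"
  have "compact (g ` K)" unfolding K_def
    using contg by (intro compact_continuous_image continuous_on_subset[OF contg] compact_diff) auto
  moreover have "m \<notin> g ` K"
  proof
    assume "m \<in> g ` K"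
    then obtain s where s: "s \<in> K" "g s = g t0" using t0 by auto
    then obtain n :: int where n: "s - t0 = of_int n" using inj by blast
    moreover have "\<bar>s - t0\<bar> \<le> 1/2" "s \<noteq> t0" using s(1) \<delta>(1) unfolding K_def by (auto simp: abs_if)
    ultimately have "\<bar>of_int n :: real\<bar> < 1" "n \<noteq> 0" by auto
    then show False by linarith
  qed
  ultimately have "\<forall>\<^sub>F w in nhds m. w \<in> - g ` K"
    by (intro eventually_nhds_in_open) (auto simp: open_Compl compact_imp_closed)
  then have loc: "\<forall>\<^sub>F w in nhds m. w \<in> C \<longrightarrow> (\<exists>t. dist t t0 < \<delta> \<and> g t = w)"
  proof eventually_elim
    case (elim w)
    show ?case
    proof
      assume "w \<in> C"
      then obtain s where s: "g s = w" using im unfolding path_image_def by blast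
      define t where "t = s + of_int (- \<lfloor>s - t0 + 1/2\<rfloor>)"
      have "g t = w" unfolding t_def pern s ..
      moreover have "t \<in> {t0 - 1/2 .. t0 + 1/2}" unfolding t_def by simp linarith
      ultimately show "\<exists>t. dist t t0 < \<delta> \<and> g t = w" using elim unfolding K_def
        by (auto simp: dist_commute intro!: exI[of _ t])
    qed
  qed
  define z where "z s = m - e + e * cis s" for s
  define z' where "z' s = m + e - e * cis (- s)" for s
  have "(z \<longlongrightarrow> m - e + e * cis 0) (at_right 0)" "(z' \<longlongrightarrow> m + e - e * cis (- 0)) (at_right 0)"
    unfolding z_def[abs_def] z'_def[abs_def] by (intro tendsto_intros)+
  then have zt: "(z \<longlongrightarrow> m) (at_right 0)" "(z' \<longlongrightarrow> m) (at_right 0)" by simp_all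
  have "\<forall>\<^sub>F s in at_right 0. z s \<in> C \<longrightarrow> (\<exists>t. dist t t0 < \<delta> \<and> g t = z s)"
    "\<forall>\<^sub>F s in at_right 0. z' s \<in> C \<longrightarrow> (\<exists>t. dist t t0 < \<delta> \<and> g t = z' s)"
    using eventually_compose_filterlim[OF loc] zt by blast+
  moreover have "\<forall>\<^sub>F s in at_right 0. (s::real) \<in> {0<..<pi/3}"
    by (intro eventually_at_right_real) simp
  ultimately have "\<forall>\<^sub>F s in at_right 0. s \<in> {0<..<pi/3} \<and> (z s \<in> C \<longrightarrow> (\<exists>t. dist t t0 < \<delta> \<and> g t = z s)) \<and>
     (z' s \<in> C \<longrightarrow> (\<exists>t. dist t t0 < \<delta> \<and> g t = z' s))" by eventually_elim blast
  then have "\<exists>s. s \<in> {0<..<pi/3} \<and> (z s \<in> C \<longrightarrow> (\<exists>t. dist t t0 < \<delta> \<and> g t = z s)) \<and>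
     (z' s \<in> C \<longrightarrow> (\<exists>t. dist t t0 < \<delta> \<and> g t = z' s))"
    by (rule eventually_happens'[OF trivial_limit_at_right_real])
  then obtain s where "s \<in> {0<..<pi/3}" and s34: "z s \<in> C \<longrightarrow> (\<exists>t. dist t t0 < \<delta> \<and> g t = z s)"
     "z' s \<in> C \<longrightarrow> (\<exists>t. dist t t0 < \<delta> \<and> g t = z' s)" by blast
  then have s: "0 < s" "s < pi/3" by auto
  have "z s \<in> lk r v k"
  proof -
    have "e * cis s = r * cis (real k * pi / 3 + s)" by (simp add: e_def emb_dir cis_mult mult.assoc)
    then have "z s = ctr r v + r * cis (real k * pi / 3 + s)" by (simp add: z_def ev)
    then show ?thesis unfolding lk_param using s
      by (intro CollectI exI[of _ "real k * pi / 3 + s"]) (simp add: field_simps)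
  qed
  moreover have "z' s \<in> lk r (v + dir k) (k + 2)"
  proof -
    have "e * cis (- s) = r * (cis (real k * pi / 3) * cis (- s))" by (simp add: e_def emb_dir mult.assoc)
    also have "cis (real k * pi / 3) * cis (- s) = - cis (real k * pi / 3 + - s + pi)"
      by (simp only: cis_mult[symmetric]) simp
    also have "real k * pi / 3 + - s + pi = real (k + 3) * pi / 3 - s" by (simp add: field_simps)
    finally have "z' s = ctr r (v + dir k) + r * cis (real (k + 3) * pi / 3 - s)" by (simp add: z'_def eu)
    then show ?thesis unfolding lk_param using s
      by (intro CollectI exI[of _ "real (k + 3) * pi / 3 - s"]) (simp add: field_simps)
  qed
  ultimately obtain t1 t2 where t1: "dist t1 t0 < \<delta>" "g t1 = z s" and t2: "dist t2 t0 < \<delta>" "g t2 = z' s"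
    using s34 A A' by blast
  have "f t1 = cis s - 1" "f t2 = 1 - cis (- s)"
    unfolding f_def t1 t2 z_def z'_def using ne by (simp_all add: field_simps)
  moreover have "sin s > 0" using s(1,2) pi_gt_zero by (intro sin_gt_zero) linarith+
  ultimately have I: "Im (f t1) > 0" "Im (f t2) > 0" by simp_all
  then have ne0: "t1 \<noteq> t0" "t2 \<noteq> t0" using f0 by auto
  have "Im (f t1) / (t1 - t0) * Im l > 0" "Im (f t2) / (t2 - t0) * Im l > 0"
    using \<delta>(2) ne0 t1 t2 by blast+
  then have same: "(t1 > t0 \<and> t2 > t0) \<or> (t1 < t0 \<and> t2 < t0)"
    using I ne0 by (auto simp: zero_less_mult_iff zero_less_divide_iff divide_less_0_iff mult_less_0_iff)
  have seg: "t \<noteq> t0 \<and> dist t t0 < \<delta>" if "t \<in> closed_segment t1 t2" for t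
    using that same t1(1) t2(1) by (auto simp: closed_segment_eq_real_ivl dist_real_def split: if_splits)
  let ?T = "g ` closed_segment t1 t2"
  have "connected ?T" by (intro connected_continuous_image continuous_on_subset[OF contg] connected_segment) auto
  moreover have "closed (sphere (ctr r v) r)" "closed (sphere (ctr r (v + dir k)) r)" by auto
  moreover have "?T \<subseteq> sphere (ctr r v) r \<union> sphere (ctr r (v + dir k)) r"
    using \<delta>(2) seg by (fastforce simp: dist_commute)
  moreover have "sphere (ctr r v) r \<inter> sphere (ctr r (v + dir k)) r \<inter> ?T = {}"
  proof (rule ccontr)
    assume "\<not> ?thesis"
    then obtain t where t: "t \<in> closed_segment t1 t2" "dist (g t) (ctr r v) = r" "dist (g t) (ctr r (v + dir k)) = r"
      by (auto simp: dist_commute)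
    then have "Re (f t) = - ((Re (f t))\<^sup>2 + (Im (f t))\<^sup>2) / 2" "Re (f t) = ((Re (f t))\<^sup>2 + (Im (f t))\<^sup>2) / 2"
      using unit_circle_Re[of "f t"] unfolding circ f_def[symmetric] by blast+
    moreover have "q = 0" if "x = - q / 2" "x = q / 2" for x q :: real using that by simp
    ultimately have "(Re (f t))\<^sup>2 + (Im (f t))\<^sup>2 = 0" by blast
    then have "Im (f t) = 0" by simp
    moreover have "Im (f t) / (t - t0) * Im l > 0" using \<delta>(2) seg[OF t(1)] by blast
    ultimately show False by simp
  qed
  moreover have "z s \<in> sphere (ctr r v) r \<inter> ?T" "z' s \<in> sphere (ctr r (v + dir k)) r \<inter> ?T"
  proof -
    have "z s \<in> ?T" "z' s \<in> ?T" using t1(2) t2(2) by (metis ends_in_segment imageI)+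
    then show "z s \<in> sphere (ctr r v) r \<inter> ?T" "z' s \<in> sphere (ctr r (v + dir k)) r \<inter> ?T"
      unfolding ev eu z_def z'_def using ne by (auto simp: dist_norm norm_mult)
  qed
  ultimately show False unfolding connected_closed by blast
qed

definition boundary_link :: "(int \<times> int) set \<Rightarrow> int \<times> int \<Rightarrow> nat \<Rightarrow> bool" where
  "boundary_link S v k \<longleftrightarrow> (v \<in> S) \<noteq> (v + dir k \<in> S) \<and> (v \<in> S) \<noteq> (v + dir (Suc k) \<in> S)"

definition curve :: "real \<Rightarrow> (int \<times> int) set \<Rightarrow> complex set" where
  "curve r S = \<Union>{lk r v k | v k. boundary_link S v k}"

definition inner_vertices :: "real \<Rightarrow> complex set \<Rightarrow> (int \<times> int) set" where
  "inner_vertices r C = {v. ctr r v \<in> inside C}"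

lemma boundary_link_cong: "j mod 6 = k mod 6 \<Longrightarrow> boundary_link S v j \<longleftrightarrow> boundary_link S v k"
  unfolding boundary_link_def dir.simps(2) using dir_cong[of j k] by simp

lemma tangle_link_iff:
  assumes "r > 0" "triangular_tangle r C"
  shows "lk r v k \<subseteq> C \<longleftrightarrow> boundary_link (inner_vertices r C) v k"
proof -
  let ?u = "v + dir k" and ?w = "v + dir (Suc k)"
  note U = triangular_tangle_link_union[OF assms(2)]
  have st: "lk r w m \<subseteq> C \<longleftrightarrow> (ctr r w \<in> inside C) \<noteq> (cen r w m \<in> inside C)" for w m
    using link_state[OF assms] not_link_state[OF assms(1) U] by blast
  have w: "?u + dir (k + 2) = ?w" "?w + dir (k + 4) = v" "k + 2 + 2 = k + 4" by (simp_all add: dir_reduce)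
  have c: "cen r ?u (k + 2) = cen r v k" "cen r ?w (k + 4) = cen r v k"
    using cen_rot[of r v k] cen_rot[of r ?u "k + 2"] unfolding w by simp_all
  have v: "cen r v (k + 6) = cen r v k" "lk r v (k + 6) = lk r v k" by (rule cen_cong lk_cong; simp)+
  have "\<not> (lk r v k \<subseteq> C \<and> lk r ?u (k + 2) \<subseteq> C)"
    "\<not> (lk r ?u (k + 2) \<subseteq> C \<and> lk r ?w (k + 4) \<subseteq> C)"
    "\<not> (lk r ?w (k + 4) \<subseteq> C \<and> lk r v k \<subseteq> C)"
    using no_cusp[OF assms, of v k] no_cusp[OF assms, of ?u "k + 2"] no_cusp[OF assms, of ?w "k + 4"]
    unfolding w v(2)[symmetric] by (auto simp: add.commute)
  then show ?thesis unfolding boundary_link_def inner_vertices_def st c by auto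
qed

lemma tangle_eq_curve:
  assumes "r > 0" "triangular_tangle r C" shows "C = curve r (inner_vertices r C)"
proof
  show "C \<subseteq> curve r (inner_vertices r C)"
  proof
    fix z assume "z \<in> C"
    then obtain v k where "z \<in> lk r v k" "lk r v k \<subseteq> C"
      using link_unionE triangular_tangle_link_union assms(2) by metis
    then show "z \<in> curve r (inner_vertices r C)" unfolding curve_def tangle_link_iff[OF assms] by blast
  qed
  show "curve r (inner_vertices r C) \<subseteq> C" unfolding curve_def using tangle_link_iff[OF assms] by blast
qed

lemma finite_bounded_lattice:
  assumes "r > 0" "bounded B" shows "finite {v. ctr r v \<in> B}"
proof -
  obtain M where M: "\<And>z. z \<in> B \<Longrightarrow> norm z \<le> M" using assms(2) unfolding bounded_iff by blast
  define N where "N = \<lceil>M / r\<rceil>"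
  have "{v. ctr r v \<in> B} \<subseteq> {-N..N} \<times> {-N..N}"
  proof
    fix v assume "v \<in> {v. ctr r v \<in> B}"
    then have n: "norm (ctr r v) \<le> M" using M by blast
    obtain a b where v: "v = (a, b)" by (cases v)
    have "(norm (ctr r v))\<^sup>2 = r\<^sup>2 * (4 * of_int (a\<^sup>2 + a * b + b\<^sup>2))"
      unfolding ctr_eq by (simp add: norm_mult power_mult_distrib norm_emb v)
    moreover have "real_of_int (a\<^sup>2) \<le> 4 * of_int (a\<^sup>2 + a * b + b\<^sup>2)" "real_of_int (b\<^sup>2) \<le> 4 * of_int (a\<^sup>2 + a * b + b\<^sup>2)"
    proof -
      have "4 * (a\<^sup>2 + a * b + b\<^sup>2) = (a + 2 * b)\<^sup>2 + 3 * a\<^sup>2" "4 * (a\<^sup>2 + a * b + b\<^sup>2) = (2 * a + b)\<^sup>2 + 3 * b\<^sup>2"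
        by (simp_all add: power2_eq_square algebra_simps)
      then have "a\<^sup>2 \<le> 4 * (a\<^sup>2 + a * b + b\<^sup>2)" "b\<^sup>2 \<le> 4 * (a\<^sup>2 + a * b + b\<^sup>2)"
        by (smt (verit) zero_le_power2)+
      then show "real_of_int (a\<^sup>2) \<le> 4 * of_int (a\<^sup>2 + a * b + b\<^sup>2)" "real_of_int (b\<^sup>2) \<le> 4 * of_int (a\<^sup>2 + a * b + b\<^sup>2)"
        by (metis of_int_le_iff of_int_mult of_int_numeral)+
    qed
    ultimately have "r\<^sup>2 * real_of_int (a\<^sup>2) \<le> (norm (ctr r v))\<^sup>2" "r\<^sup>2 * real_of_int (b\<^sup>2) \<le> (norm (ctr r v))\<^sup>2"
      by (simp_all only: mult_left_mono zero_le_power2)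
    then have "(r * \<bar>of_int a\<bar>)\<^sup>2 \<le> (norm (ctr r v))\<^sup>2" "(r * \<bar>of_int b\<bar>)\<^sup>2 \<le> (norm (ctr r v))\<^sup>2"
      by (simp_all add: power_mult_distrib)
    then have "r * \<bar>of_int a\<bar> \<le> norm (ctr r v)" "r * \<bar>of_int b\<bar> \<le> norm (ctr r v)"
      by (meson norm_ge_zero power2_le_imp_le)+
    then have "\<bar>of_int a\<bar> \<le> M / r" "\<bar>of_int b\<bar> \<le> M / r" using n assms(1) by (auto simp: field_simps)
    then have "\<bar>a\<bar> \<le> N" "\<bar>b\<bar> \<le> N" unfolding N_def by linarith+
    then show "v \<in> {-N..N} \<times> {-N..N}" unfolding v by auto
  qed
  then show ?thesis using finite_subset by blast
qed

lemma finite_inner_vertices: "r > 0 \<Longrightarrow> triangular_tangle r C \<Longrightarrow> finite (inner_vertices r C)"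
  unfolding inner_vertices_def using finite_bounded_lattice triangular_tangle_Jordan(3) by blast

section \<open>Boundary walks\<close>

lemma dir_add_numeral:
  "dir (k + 2) = dir (Suc k) - dir k" "dir (k + 3) = - dir k" "dir (k + 4) = - dir (Suc k)"
  "dir (k + 5) = dir k - dir (Suc k)" "dir (k + 6) = dir k"
  by (simp_all add: dir_reduce)

lemma mod_6_add: "a mod 6 = b mod 6 \<Longrightarrow> (a + c) mod 6 = (b + c) mod (6::nat)"
  by (metis mod_add_left_eq)

lemma mod_6_shift:
  assumes "(a + c) mod 6 = b mod 6" "c + d = 6" shows "a mod 6 = (b + d) mod (6::nat)"
proof -
  have "(a + c + d) mod 6 = (b + d) mod 6" using assms(1) by (rule mod_6_add)
  moreover have "a + c + d = a + 6" using assms(2) by simp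
  ultimately show ?thesis by (simp only: mod_add_self2)
qed

text \<open>
  A pair \<open>(a, i)\<close> with \<open>a\<close> in \<open>S\<close> and its \<open>i\<close>-th neighbour outside \<open>S\<close> stands for the tangency point
  between the two, at which the curve, with \<open>S\<close> on its left, has direction \<open>\<i> * cis (i * pi / 3)\<close>;
  \<open>turn\<close> moves to the next tangency point, and \<open>elk\<close> is the link in between.
\<close>

definition bedges :: "(int \<times> int) set \<Rightarrow> ((int \<times> int) \<times> nat) set" where
  "bedges S = {(a, i). a \<in> S \<and> i < 6 \<and> a + dir i \<notin> S}"

definition turn :: "(int \<times> int) set \<Rightarrow> (int \<times> int) \<times> nat \<Rightarrow> (int \<times> int) \<times> nat" where
  "turn S x = (case x of (a, i) \<Rightarrow>
     if a + dir (Suc i) \<in> S then (a + dir (Suc i), (i + 5) mod 6) else (a, Suc i mod 6))"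

definition unturn :: "(int \<times> int) set \<Rightarrow> (int \<times> int) \<times> nat \<Rightarrow> (int \<times> int) \<times> nat" where
  "unturn S x = (case x of (a, i) \<Rightarrow>
     if a + dir (i + 5) \<in> S then (a + dir (i + 5), Suc i mod 6) else (a, (i + 5) mod 6))"

definition boundary_cycle :: "(int \<times> int) set \<Rightarrow> bool" where
  "boundary_cycle S \<longleftrightarrow> bedges S \<noteq> {} \<and>
     (\<forall>X \<subseteq> bedges S. X \<noteq> {} \<longrightarrow> turn S ` X \<subseteq> X \<longrightarrow> X = bedges S)"

lemma finite_bedges: "finite S \<Longrightarrow> finite (bedges S)"
  by (rule finite_subset[of _ "S \<times> {..<6}"]) (auto simp: bedges_def)

lemma turn_in: "x \<in> bedges S \<Longrightarrow> turn S x \<in> bedges S"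
proof -
  assume "x \<in> bedges S"
  then obtain a i where x: "x = (a, i)" "a \<in> S" "i < 6" "a + dir i \<notin> S" by (auto simp: bedges_def)
  have e: "a + dir (Suc i) + dir ((i + 5) mod 6) = a + dir i" by (simp add: dir_add_numeral)
  show ?thesis unfolding x(1) turn_def bedges_def using x(2,4) e by (auto simp: add.assoc)
qed

lemma unturn_turn: assumes "x \<in> bedges S" shows "unturn S (turn S x) = x"
proof -
  obtain a i where x: "x = (a, i)" "a \<in> S" "i < 6" "a + dir i \<notin> S" using assms by (auto simp: bedges_def)
  show ?thesis
  proof (cases "a + dir (Suc i) \<in> S")
    case True
    have "((i + 5) mod 6 + 5) mod 6 = (i + 4) mod 6" by presburger
    then have "dir ((i + 5) mod 6 + 5) = dir (i + 4)" by (rule dir_cong)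
    then have "a + dir (Suc i) + dir ((i + 5) mod 6 + 5) = a" by (simp add: dir_add_numeral)
    moreover have "Suc ((i + 5) mod 6) mod 6 = i" using x(3) by presburger
    ultimately show ?thesis using True x by (simp add: turn_def unturn_def add.assoc)
  next
    case False
    have "(Suc i mod 6 + 5) mod 6 = i mod 6" by presburger
    then have "dir (Suc i mod 6 + 5) = dir i" by (rule dir_cong)
    moreover have "(Suc i mod 6 + 5) mod 6 = i" using x(3) by presburger
    ultimately show ?thesis using False x unfolding turn_def unturn_def by simp
  qed
qed

lemma turn_inj: "inj_on (turn S) (bedges S)"
  using unturn_turn by (rule inj_on_inverseI)

definition enode :: "real \<Rightarrow> (int \<times> int) \<times> nat \<Rightarrow> complex" where
  "enode r x = node r (fst x) (snd x)"

definition elk :: "(int \<times> int) set \<Rightarrow> (int \<times> int) \<times> nat \<Rightarrow> (int \<times> int) \<times> nat" where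
  "elk S x = (case x of (a, i) \<Rightarrow>
     if a + dir (Suc i) \<in> S then (a + dir i, (i + 2) mod 6) else (a, i))"

definition elink :: "real \<Rightarrow> (int \<times> int) set \<Rightarrow> (int \<times> int) \<times> nat \<Rightarrow> complex set" where
  "elink r S x = lk r (fst (elk S x)) (snd (elk S x))"

lemma enode_inj:
  assumes "r > 0" "x \<in> bedges S" "y \<in> bedges S" "enode r x = enode r y" shows "x = y"
  using node_eqD[of r "fst x" "snd x" "fst y" "snd y"] assms
  by (auto simp: enode_def bedges_def)

lemma enode_turn:
  "enode r (turn S (a, i)) = (if a + dir (Suc i) \<in> S then node r (a + dir i) (i + 2) else node r a (Suc i))"
proof (cases "a + dir (Suc i) \<in> S")
  case True
  have "node r (a + dir (Suc i)) ((i + 5) mod 6) = node r (a + dir (Suc i)) (i + 5)" by (rule node_cong) simp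
  also have "\<dots> = node r (a + dir i) (i + 2)" by (simp add: node_def dir_reduce algebra_simps)
  finally show ?thesis using True by (simp add: turn_def enode_def)
next
  case False
  have "node r a (Suc i mod 6) = node r a (Suc i)" by (rule node_cong) simp
  then show ?thesis using False by (simp add: turn_def enode_def)
qed

lemma elk_nodes:
  "{node r (fst (elk S x)) (snd (elk S x)), node r (fst (elk S x)) (Suc (snd (elk S x)))}
    = {enode r x, enode r (turn S x)}"
proof -
  obtain a i where x: "x = (a, i)" by (cases x)
  have "node r (a + dir i) ((i + 2) mod 6) = node r (a + dir i) (i + 2)"
    "node r (a + dir i) (Suc ((i + 2) mod 6)) = node r (a + dir i) (i + 3)" 
    by (rule node_cong; simp add: mod_Suc_eq add.commute)+
  moreover have "node r (a + dir i) (i + 3) = node r a i" by (simp add: node_def dir_reduce algebra_simps)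
  ultimately show ?thesis unfolding x enode_turn by (auto simp: elk_def enode_def)
qed

lemma elk_inj: "inj_on (elk S) (bedges S)"
proof (rule inj_onI)
  fix x y assume xy: "x \<in> bedges S" "y \<in> bedges S" "elk S x = elk S y"
  obtain a i b j where x: "x = (a, i)" and y: "y = (b, j)" by (cases x; cases y)
  have "i = j" if "(i + 2) mod 6 = (j + 2) mod 6" using xy(1,2) that 
    unfolding x y bedges_def by (auto simp: lt_6_cases)
  then show "x = y" using xy unfolding x y by (auto simp: elk_def bedges_def split: if_splits)
qed

lemma elk_boundary: "x \<in> bedges S \<Longrightarrow> boundary_link S (fst (elk S x)) (snd (elk S x))"
proof -
  assume "x \<in> bedges S"
  then obtain a i where x: "x = (a, i)" "a \<in> S" "i < 6" "a + dir i \<notin> S" by (auto simp: bedges_def)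
  show ?thesis
  proof (cases "a + dir (Suc i) \<in> S")
    case True
    have "boundary_link S (a + dir i) ((i + 2) mod 6) \<longleftrightarrow> boundary_link S (a + dir i) (i + 2)"
      by (rule boundary_link_cong) simp
    moreover have "a + dir i + dir (i + 2) = a + dir (Suc i)" "a + dir i + dir (Suc (i + 2)) = a"
      by (simp_all add: dir_reduce)
    then have "boundary_link S (a + dir i) (i + 2)" unfolding boundary_link_def using True x by metis
    ultimately show ?thesis using True unfolding x elk_def by simp
  qed (use x in \<open>simp add: elk_def boundary_link_def\<close>)
qed

lemma boundary_link_elk:
  assumes "boundary_link S v k"
  obtains x where "x \<in> bedges S" "elk S x = (v, k mod 6)"
proof (cases "v \<in> S")
  case True
  then have "(v, k mod 6) \<in> bedges S" "elk S (v, k mod 6) = (v, k mod 6)"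
    using assms unfolding bedges_def boundary_link_def elk_def by simp_all
  then show ?thesis using that by blast
next
  case False
  define a i where "a = v + dir (Suc k)" and "i = (k + 4) mod 6"
  have "a + dir (k + 4) = v" "a + dir (Suc (k + 4)) = v + dir k" by (simp_all add: a_def dir_reduce)
  then have d: "a + dir i = v" "a + dir (Suc i) = v + dir k" unfolding i_def by (simp_all only: dir_mod_6 dir_Suc_mod_6)
  have "(i + 2) mod 6 = k mod 6" "i < 6" unfolding i_def by presburger+
  moreover have "a \<in> S" "v + dir k \<in> S" using assms False unfolding boundary_link_def a_def by blast+
  ultimately have "(a, i) \<in> bedges S" "elk S (a, i) = (v, k mod 6)"
    unfolding bedges_def elk_def using False d by simp_all
  then show ?thesis using that by blast
qed

lemma curve_eq_elinks: "curve r S = (\<Union>x \<in> bedges S. elink r S x)"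
proof
  show "curve r S \<subseteq> (\<Union>x \<in> bedges S. elink r S x)"
  proof
    fix z assume "z \<in> curve r S"
    then obtain v k where vk: "z \<in> lk r v k" "boundary_link S v k" unfolding curve_def by blast
    then obtain x where "x \<in> bedges S" "elk S x = (v, k mod 6)" using boundary_link_elk by blast
    then show "z \<in> (\<Union>x \<in> bedges S. elink r S x)" using vk unfolding elink_def by force
  qed
  show "(\<Union>x \<in> bedges S. elink r S x) \<subseteq> curve r S"
    unfolding curve_def elink_def using elk_boundary by blast
qed

lemma elink_inter:
  assumes "r > 0" "x \<in> bedges S" "y \<in> bedges S" "x \<noteq> y" "z \<in> elink r S x" "z \<in> elink r S y"
  shows "z \<in> {enode r x, enode r (turn S x)}"
proof (rule ccontr)
  assume "z \<notin> {enode r x, enode r (turn S x)}"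
  then have "fst (elk S y) = fst (elk S x) \<and> snd (elk S y) mod 6 = snd (elk S x) mod 6"
    using lk_inter[OF assms(1), of z "fst (elk S x)" "snd (elk S x)"] assms(5,6) elk_nodes[of r S x] unfolding elink_def by blast
  moreover have "snd (elk S x) < 6" "snd (elk S y) < 6" using assms(2,3) by (auto simp: elk_def bedges_def)
  ultimately have "elk S x = elk S y" by (simp add: prod_eq_iff)
  then show False using elk_inj assms(2-4) by (meson inj_onD)
qed

lemma enode_in_elink: "enode r x \<in> elink r S x" "enode r (turn S x) \<in> elink r S x"
proof -
  have "node r v k \<in> lk r v k" "node r v (Suc k) \<in> lk r v k" for v k
    using pathstart_in_path_image[of "link_path r (ctr r v) k"] pathfinish_in_path_image[of "link_path r (ctr r v) k"]
    unfolding lk_def link_path_ends by auto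
  then show "enode r x \<in> elink r S x" "enode r (turn S x) \<in> elink r S x"
    using elk_nodes[of r S x] unfolding elink_def by (metis insertE insertI1 insertI2 singletonD)+
qed

lemma turn_closed_bij:
  assumes "finite S" "X \<subseteq> bedges S" "turn S ` X \<subseteq> X" shows "turn S ` X = X"
  using assms finite_bedges[OF assms(1)] turn_inj[of S]
  by (metis card_image card_subset_eq finite_subset inj_on_subset)

lemma tangle_boundary_cycle:
  assumes r: "r > 0" and tan: "triangular_tangle r C" and C: "C = curve r S" and fin: "finite S"
  shows "boundary_cycle S"
  unfolding boundary_cycle_def
proof (intro conjI allI impI)
  have "C \<noteq> {}" using triangular_tangle_Jordan[OF tan] by (metis frontier_empty inside_empty)
  then show "bedges S \<noteq> {}" unfolding C curve_eq_elinks by blast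
  fix X assume X: "X \<subseteq> bedges S" "X \<noteq> {}" "turn S ` X \<subseteq> X"
  note fb = finite_bedges[OF fin]
  have tX: "turn S ` X = X" using turn_closed_bij[OF fin X(1,3)] .
  have out: "turn S y \<notin> X" if "y \<in> bedges S - X" for y
  proof
    assume "turn S y \<in> X"
    then obtain x where x: "x \<in> X" "turn S x = turn S y" using tX by (metis imageE)
    then have "x = y" using inj_onD[OF turn_inj] X(1) that by blast
    then show False using x(1) that by blast
  qed
  define U where "U = (\<Union>x \<in> X. elink r S x)"
  define W where "W = (\<Union>x \<in> bedges S - X. elink r S x)"
  have cl: "closed (elink r S x)" for x unfolding elink_def lk_def link_path_def by (simp add: closed_path_image)
  have "closed U" "closed W" unfolding U_def W_def using fb X(1) cl by (auto intro!: closed_UN intro: finite_subset)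
  moreover have "U \<inter> W = {}"
  proof (rule ccontr)
    assume "U \<inter> W \<noteq> {}"
    then obtain z x y where z: "x \<in> X" "y \<in> bedges S - X" "z \<in> elink r S x" "z \<in> elink r S y"
      unfolding U_def W_def by blast
    then have "z \<in> {enode r x, enode r (turn S x)}" "z \<in> {enode r y, enode r (turn S y)}"
      using elink_inter[OF r, of x S y z] elink_inter[OF r, of y S x z] X(1) by blast+
    then obtain x' y' where "x' \<in> {x, turn S x}" "y' \<in> {y, turn S y}" "enode r x' = enode r y'" by blast
    moreover have "{x, turn S x} \<subseteq> X" using z(1) tX by blast
    moreover have "{y, turn S y} \<subseteq> bedges S - X" using z(2) out turn_in by blast
    ultimately show False using enode_inj[OF r, of x' S y'] X(1) by blast
  qed
  moreover have "C = U \<union> W" unfolding C curve_eq_elinks U_def W_def using X(1) by blast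
  moreover have "connected C" using triangular_tangle_Jordan[OF tan] by blast
  ultimately have "U = {} \<or> W = {}" unfolding connected_closed by blast
  moreover have "U \<noteq> {}" using X(2) enode_in_elink unfolding U_def by blast
  ultimately have "bedges S - X = {}" using enode_in_elink unfolding W_def by blast
  then show "X = bedges S" using X(1) by blast
qed

lemma boundary_link_unique:
  assumes "finite S" "finite T" "\<And>v k. boundary_link S v k \<longleftrightarrow> boundary_link T v k"
  shows "S = T"
proof -
  define d where "d v \<longleftrightarrow> (v \<in> S \<longleftrightarrow> v \<in> T)" for v
  have step: "d (v + dir k) = d v" for v k
  proof -
    let ?u = "v + dir k" and ?w = "v + dir (Suc k)"
    have e: "?u + dir (k + 2) = ?w" "?u + dir (Suc (k + 2)) = v" "?w + dir (k + 4) = v" "?w + dir (Suc (k + 4)) = ?u"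
      by (simp_all add: dir_reduce)
    show ?thesis using assms(3)[of v k] assms(3)[of ?u "k + 2"] assms(3)[of ?w "k + 4"]
      unfolding boundary_link_def e d_def by argo
  qed
  have "d (a, b) = d (0, b)" for a b
  proof (induction a rule: int_induct[where k = 0])
    case (step1 i) then show ?case using step[of "(i, b)" 0] by (simp add: dir_values)
  next
    case (step2 i) then show ?case using step[of "(i - 1, b)" 0] by (simp add: dir_values)
  qed simp
  moreover have "d (0, b) = d (0, 0)" for b
  proof (induction b rule: int_induct[where k = 0])
    case (step1 i) then show ?case using step[of "(0, i)" "Suc 0"] by (simp add: dir_values)
  next
    case (step2 i) then show ?case using step[of "(0, i - 1)" "Suc 0"] by (simp add: dir_values)
  qed simp
  ultimately have "d v = d w" for v w by (metis surj_pair)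
  moreover have "infinite (UNIV :: (int \<times> int) set)" by (simp add: finite_prod infinite_UNIV_int)
  then obtain w where "w \<notin> S \<union> T" using assms(1,2) by (metis UNIV_eq_I finite_UnI)
  then have "d w" by (simp add: d_def)
  ultimately have "d v" for v by blast
  then show ?thesis unfolding d_def by blast
qed

lemma finite_extreme:
  assumes "finite K" "K \<noteq> {}"
  obtains a where "a \<in> K" "a + dir 0 \<notin> K" "a + dir 1 \<notin> K"
proof -
  define m where "m = Max (snd ` K)"
  define n where "n = Max (fst ` {x \<in> K. snd x = m})"
  have "m \<in> snd ` K" unfolding m_def using assms by (intro Max_in) auto
  then have "fst ` {x \<in> K. snd x = m} \<noteq> {}" by auto
  then have "n \<in> fst ` {x \<in> K. snd x = m}" unfolding n_def using assms by (intro Max_in) auto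
  then have "(n, m) \<in> K" by auto
  moreover have "(n + 1, m) \<notin> K"
  proof
    assume "(n + 1, m) \<in> K"
    then have "n + 1 \<in> fst ` {x \<in> K. snd x = m}" by force
    then have "n + 1 \<le> n" unfolding n_def using assms by (intro Max_ge) auto
    then show False by simp
  qed
  moreover have "(n, m + 1) \<notin> K"
  proof
    assume "(n, m + 1) \<in> K"
    then have "m + 1 \<in> snd ` K" by force
    then have "m + 1 \<le> m" unfolding m_def using assms by (intro Max_ge) auto
    then show False by simp
  qed
  ultimately show ?thesis using that[of "(n, m)"] by (simp add: dir_values)
qed

definition adj_closed :: "(int \<times> int) set \<Rightarrow> (int \<times> int) set \<Rightarrow> bool" where
  "adj_closed T K \<longleftrightarrow> K \<subseteq> T \<and> (\<forall>a\<in>K. \<forall>i. a + dir i \<in> T \<longrightarrow> a + dir i \<in> K)"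

lemma dir_back: "a + dir i + dir (i + 3) = a" by (simp add: dir_reduce)

lemma adj_closed_Diff: "adj_closed T K \<Longrightarrow> adj_closed T (T - K)"
  unfolding adj_closed_def using dir_back by (metis DiffD1 DiffD2 DiffI Diff_subset subsetD)

definition adj_connected :: "(int \<times> int) set \<Rightarrow> bool" where
  "adj_connected T \<longleftrightarrow> (\<forall>K. adj_closed T K \<longrightarrow> K = {} \<or> K = T)"

lemma boundary_cycle_connected:
  assumes "boundary_cycle S" "finite S" shows "adj_connected S"
  unfolding adj_connected_def
proof (intro allI impI)
  fix K assume K: "adj_closed S K"
  show "K = {} \<or> K = S"
  proof (rule ccontr)
    assume ne: "\<not> (K = {} \<or> K = S)"
    have edge: "\<exists>a \<in> A. (a, 0) \<in> bedges S" if A: "adj_closed S A" "A \<noteq> {}" for A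
    proof -
      have "finite A" using A(1) assms(2) by (auto simp: adj_closed_def intro: finite_subset)
      then obtain a where "a \<in> A" "a + dir 0 \<notin> A" using A(2) finite_extreme by blast
      moreover from this have "a \<in> S" "a + dir 0 \<notin> S" using A(1) unfolding adj_closed_def by blast+
      ultimately show ?thesis unfolding bedges_def by auto
    qed
    define X where "X = {(a, i) \<in> bedges S. a \<in> K}"
    have "turn S ` X \<subseteq> X"
    proof (rule image_subsetI)
      fix x assume "x \<in> X"
      then obtain a i where x: "x = (a, i)" "(a, i) \<in> bedges S" "a \<in> K" unfolding X_def by blast
      then have "turn S x \<in> bedges S" using turn_in by blast
      then show "turn S x \<in> X" using x K unfolding X_def adj_closed_def by (auto simp: turn_def split: if_splits)
    qed
    moreover have "X \<noteq> {}" using edge[OF K] ne unfolding X_def by blast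
    moreover have "X \<subseteq> bedges S" unfolding X_def by blast
    ultimately have "X = bedges S" using assms(1) unfolding boundary_cycle_def by blast
    moreover have "S - K \<noteq> {}" using ne K unfolding adj_closed_def by blast
    ultimately show False using edge[OF adj_closed_Diff[OF K]] unfolding X_def by blast
  qed
qed

text \<open>
  Starting from a boundary vertex \<open>u\<close> and a part \<open>K\<close> of \<open>S - {u}\<close>, take a boundary vertex \<open>v\<close> in
  \<open>K\<close>; if \<open>v\<close> disconnects \<open>S\<close>, the part of \<open>S - {v}\<close> that misses \<open>u\<close> is strictly smaller than \<open>K\<close>.
\<close>

lemma non_cut_vertex:
  assumes "adj_connected S" "finite S" "u \<in> S" "u + dir i \<notin> S" "S \<noteq> {u}"
  obtains v j where "v \<in> S" "v + dir j \<notin> S" "adj_connected (S - {v})"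
proof -
  have "\<exists>v j. v \<in> S \<and> v + dir j \<notin> S \<and> adj_connected (S - {v})"
    if "u \<in> S" "adj_closed (S - {u}) K" "K \<noteq> {}" for u K
    using that
  proof (induction "card K" arbitrary: u K rule: less_induct)
    case less
    have finK: "finite K" using less(3) assms(2) unfolding adj_closed_def by (auto intro: finite_subset)
    obtain v where v: "v \<in> K" "v + dir 0 \<notin> K" "v + dir 1 \<notin> K" using finite_extreme finK less(4) by metis
    have vS: "v \<in> S" "v \<noteq> u" using v(1) less(3) unfolding adj_closed_def by auto
    have "dir 0 \<noteq> dir 1" by (simp add: dir_values)
    then have "v + dir 0 \<noteq> u \<or> v + dir 1 \<noteq> u" by auto
    then obtain j where j: "v + dir j \<notin> S" using v less(3) unfolding adj_closed_def by blast
    show ?case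
    proof (cases "adj_connected (S - {v})")
      case True
      then show ?thesis using vS j by blast
    next
      case False
      then obtain K1 where K1: "adj_closed (S - {v}) K1" "K1 \<noteq> {}" "K1 \<noteq> S - {v}" unfolding adj_connected_def by blast
      have "\<exists>K'. adj_closed (S - {v}) K' \<and> K' \<noteq> {} \<and> u \<notin> K'"
      proof (cases "u \<in> K1")
        case True
        then show ?thesis using adj_closed_Diff[OF K1(1)] K1 unfolding adj_closed_def
          by (intro exI[of _ "S - {v} - K1"]) blast
      qed (use K1 in blast)
      then obtain K' where K': "adj_closed (S - {v}) K'" "K' \<noteq> {}" "u \<notin> K'" by blast
      have "adj_closed S (K' - K)"
        unfolding adj_closed_def
      proof (intro conjI ballI allI impI)
        show "K' - K \<subseteq> S" using K'(1) unfolding adj_closed_def by blast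
        fix a i assume a: "a \<in> K' - K" "a + dir i \<in> S"
        have aS: "a \<in> S - {u}" using a(1) K' unfolding adj_closed_def by blast
        have nK: "a + dir i \<notin> K"
        proof
          assume "a + dir i \<in> K"
          moreover have "a + dir i + dir (i + 3) = a" by (rule dir_back)
          ultimately have "a \<in> K" using less(3) aS unfolding adj_closed_def by metis
          then show False using a(1) by blast
        qed
        then have "a + dir i \<noteq> v" using v(1) by blast
        then show "a + dir i \<in> K' - K" using nK a K'(1) unfolding adj_closed_def by blast
      qed
      then have "K' - K = {} \<or> K' - K = S" using assms(1) unfolding adj_connected_def by blast
      then have "K' \<subseteq> K" using K'(3) less(2) by blast
      moreover have "v \<notin> K'" using K'(1) unfolding adj_closed_def by blast
      ultimately have "K' \<subset> K" using v(1) by blast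
      then have "card K' < card K" using finK by (rule psubset_card_mono[rotated])
      then show ?thesis using less(1) vS(1) K'(1,2) by blast
    qed
  qed
  moreover have "adj_closed (S - {u}) (S - {u})" unfolding adj_closed_def by blast
  moreover have "S - {u} \<noteq> {}" using assms(3,5) by blast
  ultimately show ?thesis using that assms(3) by blast
qed

lemma bedges_iff: "(a, m mod 6) \<in> bedges S \<longleftrightarrow> a \<in> S \<and> a + dir m \<notin> S"
  by (simp add: bedges_def)

lemma turn_mod: "turn S (a, m mod 6) = 
   (if a + dir (Suc m) \<in> S then (a + dir (Suc m), (m + 5) mod 6) else (a, Suc m mod 6))"
  by (simp add: turn_def mod_simps mod_Suc_eq)

lemma bedgesE:
  assumes "x \<in> bedges S" obtains a m where "x = (a, m mod 6)" "a \<in> S" "a + dir m \<notin> S"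
proof -
  obtain a m where "x = (a, m)" "m < 6" "a \<in> S" "a + dir m \<notin> S" using assms unfolding bedges_def by blast
  then show ?thesis using that[of a m] by simp
qed

text \<open>
  The walks around \<open>S\<close> and \<open>S - {u}\<close> agree except between the edges \<open>P\<close> and \<open>Q\<close> below: the former
  passes around \<open>u\<close>, the latter through the edges \<open>w i\<close> that point at \<open>u\<close>.
\<close>

lemma remove_vertex_boundary_cycle:
  assumes cyc: "boundary_cycle S" and u: "u \<in> S" and n: "0 < n" "n < 6"
    and arc: "\<And>i. i < 6 \<Longrightarrow> u + dir (j + i) \<in> S \<longleftrightarrow> i < n"
  shows "boundary_cycle (S - {u})"
proof -
  let ?S = "S - {u}"
  define w where "w i = (u + dir (j + i), (j + i + 3) mod 6)" for i
  define P where "P = (u + dir (j + (n - 1)), (j + n + 1) mod 6)"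
  define Q where "Q = (u + dir j, (j + 4) mod 6)"
  have u0: "u + dir i \<noteq> u" for i by simp
  have inS: "u + dir (j + i) \<in> ?S" if "i < n" for i using arc[of i] that n by simp
  have outS: "u + dir (j + i) \<notin> S" if "n \<le> i" "i < 6" for i using arc[of i] that by simp
  have j6: "u + dir (j + 6) = u + dir j" by (simp add: dir_reduce)
  have w_Suc: "turn ?S (w (Suc i)) = w i" if "Suc i < n" for i
  proof -
    have e: "u + dir (j + Suc i) + dir (Suc (j + Suc i + 3)) = u + dir (j + i)" by (simp add: dir_reduce)
    have "j + Suc i + 3 + 5 = (j + i + 3) + 6" by simp
    then have "(j + Suc i + 3 + 5) mod 6 = (j + i + 3) mod 6" by (simp only: mod_add_self2)
    then show ?thesis unfolding w_def turn_mod e using inS[of i] that by simp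
  qed
  have w_0: "turn ?S (w 0) = Q"
  proof -
    have e: "u + dir (j + 0) + dir (Suc (j + 0 + 3)) = u + dir (j + 5)" by (simp add: dir_reduce)
    have "Suc (j + 0 + 3) = j + 4" by simp
    then show ?thesis unfolding w_def turn_mod Q_def e using outS[of 5] n by (simp add: add.commute)
  qed
  obtain n' where n': "n = Suc n'" using n by (cases n) auto
  have turnP: "turn ?S P = w (n - 1)" 
  proof -
    have e: "u + dir (j + (n - 1)) + dir (Suc (j + n + 1)) = u" using n' by (simp add: dir_reduce)
    show ?thesis unfolding P_def w_def turn_mod e using n' by (simp add: add.commute)
  qed
  have turnP': "fst (turn S P) = u"
  proof -
    have e: "u + dir (j + n') + dir (Suc (j + n + 1)) = u" by (simp add: n' dir_reduce)
    have "n - 1 = n'" using n' by simp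
    then show ?thesis unfolding P_def turn_mod using e u by (simp only: if_True fst_conv)
  qed
  have e: "u + dir (j + n') + dir (j + n + 1) = u + dir (j + n)" "n - 1 = n'" by (simp_all add: n' dir_reduce)
  have P_in: "P \<in> bedges S" "P \<in> bedges ?S"
    unfolding P_def e(2) bedges_iff e(1) using inS[of n'] outS[of n] n n' by simp_all
  have e: "u + dir j + dir (j + 4) = u + dir (j + 5)" by (simp add: dir_reduce)
  have Q_in: "Q \<in> bedges S" unfolding Q_def bedges_iff e using inS[of 0] outS[of 5] n by simp
  have split: "x \<in> bedges S \<or> (\<exists>i<n. x = w i)" if "x \<in> bedges ?S" for x
  proof -
    obtain a m where x: "x = (a, m mod 6)" "a \<in> ?S" "a + dir m \<notin> ?S" using \<open>x \<in> bedges ?S\<close> by (rule bedgesE)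
    show ?thesis
    proof (cases "a + dir m = u")
      case True
      then have a: "a = u + dir (m + 3)" by (auto simp: dir_reduce)
      obtain i where i: "i < 6" "(m + 3) mod 6 = (j + i) mod 6" using dir_shift by blast
      then have a': "a = u + dir (j + i)" unfolding a using dir_cong by metis
      then have "i < n" using x(2) arc i(1) by blast
      moreover have "m mod 6 = (j + i + 3) mod 6" using mod_6_shift[OF i(2), of 3] by simp
      ultimately show ?thesis using x(1) a' unfolding w_def by blast
    qed (use x bedges_iff in auto)
  qed
  have same: "turn S x = turn ?S x" if x: "x \<in> bedges S" "x \<in> bedges ?S" "x \<noteq> P" for x
  proof -
    obtain a m where am: "x = (a, m mod 6)" "a \<in> S" "a + dir m \<notin> S" using x(1) by (rule bedgesE)
    have "a + dir (Suc m) \<noteq> u"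
    proof
      assume "a + dir (Suc m) = u"
      then have a: "a = u + dir (m + 4)" by (auto simp: dir_reduce)
      obtain i where i: "i < 6" "(m + 4) mod 6 = (j + i) mod 6" using dir_shift by blast
      then have a': "a = u + dir (j + i)" unfolding a using dir_cong by metis
      then have "i < n" using am(2) arc i(1) by blast
      have "a + dir m = u + dir (m + 5)" unfolding a by (simp add: dir_add_numeral)
      also have "dir (m + 5) = dir (j + Suc i)" by (rule dir_cong) (use mod_6_add[OF i(2), of 1] in \<open>simp add: add.commute\<close>)
      finally have "\<not> Suc i < n" using am(3) arc[of "Suc i"] n by auto
      with \<open>i < n\<close> have "i = n - 1" by simp
      moreover have "m mod 6 = (j + i + 2) mod 6" using mod_6_shift[OF i(2), of 2] by simp
      ultimately have "x = P" unfolding am(1) a' P_def n' by simp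
      then show False using x(3) by simp
    qed
    then show ?thesis unfolding am(1) turn_mod by simp
  qed
  show ?thesis unfolding boundary_cycle_def
  proof (intro conjI allI impI)
    show "bedges ?S \<noteq> {}" using P_in by blast
    fix X' assume X': "X' \<subseteq> bedges ?S" "X' \<noteq> {}" "turn ?S ` X' \<subseteq> X'"
    have down: "w i \<in> X'" if "w m \<in> X'" "i \<le> m" "m < n" for i m
      using that(2,1,3)
    proof (induction rule: inc_induct)
      case (step k)
      then have "w (Suc k) \<in> X'" "Suc k < n" by auto
      then show ?case using w_Suc[of k] X'(3) by force
    qed
    have wQ: "Q \<in> X'" if "w m \<in> X'" "m < n" for m
      using down[OF that(1) _ that(2), of 0] w_0 X'(3) by force
    define X where "X = (X' \<inter> bedges S) \<union> {x \<in> bedges S. fst x = u \<and> Q \<in> X'}"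
    have "turn S ` X \<subseteq> X"
    proof (rule image_subsetI)
      fix x assume "x \<in> X"
      then consider "x \<in> X'" "x \<in> bedges S" "x \<noteq> P" | "x = P" "P \<in> X'" | "x \<in> bedges S" "fst x = u" "Q \<in> X'"
        unfolding X_def by blast
      then show "turn S x \<in> X"
      proof cases
        case 1
        then have "turn S x \<in> X'" using same[of x] X'(1,3) by auto
        then show ?thesis using turn_in[OF 1(2)] unfolding X_def by blast
      next
        case 2
        then have "w (n - 1) \<in> X'" using turnP X'(3) by force
        then have "Q \<in> X'" using wQ n by simp
        then show ?thesis using turnP' turn_in[OF P_in(1)] 2 unfolding X_def by simp
      next
        case 3
        obtain m where x: "x = (u, m mod 6)" "u + dir m \<notin> S" using 3(1,2) by (elim bedgesE) auto
        show ?thesis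
        proof (cases "u + dir (Suc m) \<in> S")
          case True
          obtain i where i: "i < 6" "m mod 6 = (j + i) mod 6" using dir_shift by blast
          then have "dir m = dir (j + i)" "dir (Suc m) = dir (j + Suc i)"
            using dir_cong[of m "j + i"] by (auto simp: dir.simps(2))
          then have "n \<le> i" "u + dir (j + Suc i) \<in> S" using x(2) True arc[of i] i(1) by auto
          then have "i = 5" using arc[of "Suc i"] i(1) by (cases "Suc i < 6") auto
          then have "dir (Suc m) = dir (j + 6)" using \<open>dir (Suc m) = dir (j + Suc i)\<close> by simp
          then have e: "u + dir (Suc m) = u + dir j" using j6 by simp
          have "m mod 6 = (j + 5) mod 6" using i(2) \<open>i = 5\<close> by simp
          then have "(m + 5) mod 6 = (j + 5 + 5) mod 6" by (rule mod_6_add)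
          also have "j + 5 + 5 = j + 4 + 6" by simp
          finally have "(m + 5) mod 6 = (j + 4) mod 6" by (simp only: mod_add_self2)
          then have "turn S x = Q" using True unfolding x(1) turn_mod Q_def e by simp
          then show ?thesis using 3(3) Q_in unfolding X_def by blast
        next
          case False
          then show ?thesis using turn_in[OF 3(1)] 3 unfolding x(1) turn_mod X_def by simp
        qed
      qed
    qed
    moreover have "X \<subseteq> bedges S" unfolding X_def by blast
    moreover have "X \<noteq> {}"
    proof -
      obtain x where "x \<in> X'" using X'(2) by blast
      then have "x \<in> bedges S \<or> Q \<in> X'" using split X'(1) wQ by blast
      then show ?thesis using \<open>x \<in> X'\<close> Q_in unfolding X_def by blast
    qed
    ultimately have XB: "X = bedges S" using cyc unfolding boundary_cycle_def by blast
    have mem: "x \<in> X'" if "x \<in> bedges S" "fst x \<noteq> u" for x using that XB unfolding X_def by blast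
    have "P \<in> X'" using mem[OF P_in(1)] u0 unfolding P_def by simp
    then have "w (n - 1) \<in> X'" using turnP X'(3) by force
    then have wX: "w i \<in> X'" if "i < n" for i using down[of "n - 1" i] that by simp
    have "bedges ?S \<subseteq> X'"
    proof
      fix x assume x: "x \<in> bedges ?S"
      then have "fst x \<noteq> u" by (auto simp: bedges_def)
      then show "x \<in> X'" using split[OF x] mem wX by blast
    qed
    then show "X' = bedges ?S" using X'(1) by blast
  qed
qed

section \<open>Smooth parametrisation\<close>

lemma smooth_simple_closed_curve_glue:
  fixes \<gamma> d :: "nat \<Rightarrow> real \<Rightarrow> complex" and n :: nat
  assumes n: "0 < n"
    and der: "\<And>j s. (\<gamma> j has_vector_derivative d j s) (at s)"
    and cont: "\<And>j. continuous_on UNIV (d j)"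
    and join: "\<And>j. \<gamma> j 1 = \<gamma> (Suc j) 0" "\<And>j. d j 1 = d (Suc j) 0"
    and wrap: "\<gamma> n = \<gamma> 0" "d n = d 0"
    and nz: "\<And>j s. d j s \<noteq> 0"
    and inj: "\<And>i j s t. i < n \<Longrightarrow> j < n \<Longrightarrow> 0 \<le> s \<Longrightarrow> s < 1 \<Longrightarrow> 0 \<le> t \<Longrightarrow> t < 1 \<Longrightarrow> \<gamma> i s = \<gamma> j t \<Longrightarrow> i = j \<and> s = t"
  shows "smooth_simple_closed_curve (\<Union>j<n. \<gamma> j ` {0..1})"
proof -
  define ix where "ix m = nat (m mod int n)" for m
  have ix_less: "ix m < n" for m using n by (simp add: ix_def nat_less_iff)
  have ix_id: "ix (int j) = j" if "j < n" for j using that by (simp add: ix_def)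
  have ix_add: "ix (m + int n) = ix m" "ix (int n + m) = ix m" for m by (simp_all add: ix_def)
  have ix_Suc: "ix (m + 1) = (if Suc (ix m) = n then 0 else Suc (ix m))" for m
  proof -
    have "(m + 1) mod int n = (m mod int n + 1) mod int n" by (simp add: mod_simps)
    moreover have "0 \<le> m mod int n" "m mod int n < int n" using n by simp_all
    ultimately show ?thesis unfolding ix_def
      by (cases "m mod int n + 1 = int n") (auto simp: nat_add_distrib mod_pos_pos_trivial)
  qed
  have join': "\<gamma> (ix m) 1 = \<gamma> (ix (m + 1)) 0" "d (ix m) 1 = d (ix (m + 1)) 0" for m
    unfolding ix_Suc using join[of "ix m"] wrap by auto
  define G where "G t = \<gamma> (ix \<lfloor>t\<rfloor>) (t - of_int \<lfloor>t\<rfloor>)" for t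
  define H where "H t = d (ix \<lfloor>t\<rfloor>) (t - of_int \<lfloor>t\<rfloor>)" for t
  have GH: "G t = \<gamma> (ix m) (t - of_int m) \<and> H t = d (ix m) (t - of_int m)"
    if "t \<in> {of_int m..of_int m + 1}" for t m
  proof (cases "t = of_int m + 1")
    case True
    then have "\<lfloor>t\<rfloor> = m + 1" by linarith
    then show ?thesis unfolding G_def H_def True using join' by simp
  next
    case False
    then have "\<lfloor>t\<rfloor> = m" using that by (auto simp: floor_eq_iff)
    then show ?thesis unfolding G_def H_def by simp
  qed
  have Gder1: "(G has_vector_derivative H t) (at t within {of_int m..of_int m + 1})"
    if t: "t \<in> {of_int m..of_int m + 1}" for t m
  proof -
    have "(\<gamma> (ix m) \<circ> (\<lambda>t. t - of_int m) has_vector_derivative 1 *\<^sub>R d (ix m) (t - of_int m)) (at t)"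
      by (rule vector_diff_chain_at) (auto intro!: derivative_eq_intros der)
    then have "((\<lambda>t. \<gamma> (ix m) (t - of_int m)) has_vector_derivative H t) (at t within {of_int m..of_int m + 1})"
      using GH[OF t] by (simp add: o_def has_vector_derivative_at_within)
    then show ?thesis using t by (rule has_vector_derivative_transform[rotated 2]) (use GH in auto)
  qed
  have Hcont1: "continuous_on {of_int m..of_int m + 1} H" for m
  proof -
    have "continuous_on {of_int m..of_int m + 1} (\<lambda>t. d (ix m) (t - of_int m))"
      by (intro continuous_on_compose2[OF cont]) (auto intro!: continuous_intros)
    then show ?thesis by (rule continuous_on_eq) (use GH in auto)
  qed
  have Gder: "(G has_vector_derivative H t) (at t)" for t
  proof -
    define m where "m = \<lfloor>t\<rfloor>"
    have t: "of_int m \<le> t" "t < of_int m + 1" unfolding m_def by linarith+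
    show ?thesis
    proof (cases "t = of_int m")
      case True
      have a: "(G has_vector_derivative H t) (at t within {of_int m..of_int m + 1})" using Gder1 t by simp
      have b: "(G has_vector_derivative H t) (at t within {of_int (m - 1)..of_int (m - 1) + 1})"
        by (rule Gder1) (simp add: True)
      have "(G has_vector_derivative H t) (at t within {of_int (m - 1)..of_int (m - 1) + 1} \<union> {of_int m..of_int m + 1})"
        using a b unfolding has_vector_derivative_def has_derivative_within unfolding at_within_union
        by (auto intro: filterlim_sup)
      moreover have "{of_int (m - 1)..of_int (m - 1) + 1} \<union> {of_int m..of_int m + 1} = {of_int m - 1..of_int m + 1 :: real}"
        by auto
      moreover have "at t within {of_int m - 1..of_int m + 1} = at t"
        by (rule at_within_interior) (simp add: True)
      ultimately show ?thesis by simp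
    next
      case False
      then have "at t within {of_int m..of_int m + 1} = at t"
        using t by (intro at_within_interior) simp
      then show ?thesis using Gder1[of t m] t by simp
    qed
  qed
  have Hcont: "continuous_on UNIV H"
  proof -
    have "isCont H t" for t
    proof -
      define m where "m = \<lfloor>t\<rfloor>"
      have t: "of_int m \<le> t" "t < of_int m + 1" unfolding m_def by linarith+
      have "continuous_on ({of_int (m - 1)..of_int (m - 1) + 1} \<union> {of_int m..of_int m + 1}) H"
        by (intro continuous_on_closed_Un Hcont1) auto
      moreover have "{of_int (m - 1)..of_int (m - 1) + 1} \<union> {of_int m..of_int m + 1} = {of_int m - 1..of_int m + 1 :: real}"
        by auto
      ultimately show ?thesis using t by (intro continuous_on_interior[of "{of_int m - 1..of_int m + 1}"]) auto
    qed
    then show ?thesis by (simp add: continuous_on_eq_continuous_at)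
  qed
  define g where "g t = G (of_nat n * t)" for t
  have gder: "(g has_vector_derivative of_nat n *\<^sub>R H (of_nat n * t)) (at t)" for t
  proof -
    have "(G \<circ> (\<lambda>t. of_nat n * t) has_vector_derivative of_nat n *\<^sub>R H (of_nat n * t)) (at t)"
      by (rule vector_diff_chain_at) (auto intro!: derivative_eq_intros Gder)
    then show ?thesis by (simp add: g_def[abs_def] o_def)
  qed
  have gcont: "continuous_on A g" for A
    using gder by (meson continuous_at_imp_continuous_on has_vector_derivative_continuous)
  have per: "g (t + 1) = g t" for t
  proof -
    have "of_nat n * (t + 1) = of_nat n * t + of_int (int n)" by (simp add: algebra_simps)
    then have "\<lfloor>of_nat n * (t + 1)\<rfloor> = \<lfloor>of_nat n * t\<rfloor> + int n" by (simp only: floor_add_int)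
    then show ?thesis unfolding g_def G_def by (simp add: ix_add algebra_simps)
  qed
  have g01: "g 1 = g 0" using per[of 0] by simp
  have gval: "\<exists>j s. j < n \<and> 0 \<le> s \<and> s < 1 \<and> g t = \<gamma> j s \<and> of_nat n * t = of_nat j + s" if "0 \<le> t" "t < 1" for t
  proof -
    have "0 \<le> of_nat n * t" "of_nat n * t < of_nat n" using that n by simp_all
    then have f: "0 \<le> \<lfloor>of_nat n * t\<rfloor>" "\<lfloor>of_nat n * t\<rfloor> < int n" by linarith+
    then have "int (ix \<lfloor>of_nat n * t\<rfloor>) = \<lfloor>of_nat n * t\<rfloor>" by (simp add: ix_def)
    then have "of_nat (ix \<lfloor>of_nat n * t\<rfloor>) = (of_int \<lfloor>of_nat n * t\<rfloor> :: real)" by (metis of_int_of_nat_eq)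
    then show ?thesis unfolding g_def G_def
      by (intro exI[of _ "ix \<lfloor>of_nat n * t\<rfloor>"] exI[of _ "of_nat n * t - of_int \<lfloor>of_nat n * t\<rfloor>"] conjI ix_less)
         (auto, linarith)
  qed
  have ginj: "s = t" if st: "0 \<le> s" "s < 1" "0 \<le> t" "t < 1" "g s = g t" for s t
  proof -
    obtain i x where i: "i < n" "0 \<le> x" "x < 1" "g s = \<gamma> i x" "of_nat n * s = of_nat i + x" using gval[OF st(1,2)] by blast
    obtain j y where j: "j < n" "0 \<le> y" "y < 1" "g t = \<gamma> j y" "of_nat n * t = of_nat j + y" using gval[OF st(3,4)] by blast
    have "i = j \<and> x = y" using inj i j st(5) by metis
    then have "of_nat n * s = of_nat n * t" using i j by simp
    then show ?thesis using n by simp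
  qed
  have sp: "simple_path g" unfolding simple_path_def loop_free_def path_def
  proof (intro conjI ballI impI gcont)
    fix x y :: real assume xy: "x \<in> {0..1}" "y \<in> {0..1}" "g x = g y"
    define x' y' where "x' = (if x = 1 then 0 else x)" and "y' = (if y = 1 then 0 else y)"
    have "g x' = g x" "g y' = g y" using g01 by (auto simp: x'_def y'_def)
    then have "g x' = g y'" using xy(3) by simp
    then have "x' = y'" using xy(1,2) by (intro ginj) (auto simp: x'_def y'_def)
    then show "x = y \<or> x = 0 \<and> y = 1 \<or> x = 1 \<and> y = 0" by (auto simp: x'_def y'_def split: if_splits)
  qed
  have im: "path_image g = (\<Union>j<n. \<gamma> j ` {0..1})"
  proof
    show "path_image g \<subseteq> (\<Union>j<n. \<gamma> j ` {0..1})"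
    proof
      fix z assume "z \<in> path_image g"
      then obtain t where t: "0 \<le> t" "t \<le> 1" "z = g t" unfolding path_image_def by auto
      define t' where "t' = (if t = 1 then 0 else t)"
      have "z = g t'" "0 \<le> t'" "t' < 1" using t g01 by (auto simp: t'_def)
      then show "z \<in> (\<Union>j<n. \<gamma> j ` {0..1})" using gval[of t'] by force
    qed
    show "(\<Union>j<n. \<gamma> j ` {0..1}) \<subseteq> path_image g"
    proof
      fix z assume "z \<in> (\<Union>j<n. \<gamma> j ` {0..1})"
      then obtain j s where j: "j < n" "0 \<le> s" "s \<le> 1" "z = \<gamma> j s" by auto
      have "real j + s \<le> real n" using j by linarith
      then have "(real j + s) / real n \<in> {0..1}" using j n by simp
      moreover have "g ((real j + s) / real n) = z"
        using GH[of "real j + s" "int j"] j n by (simp add: g_def ix_id)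
      ultimately show "z \<in> path_image g" unfolding path_image_def by blast
    qed
  qed
  have "g C1_differentiable_on UNIV" unfolding C1_differentiable_on_def
    using gder by (intro exI[of _ "\<lambda>t. of_nat n *\<^sub>R H (of_nat n * t)"])
      (auto intro!: continuous_intros continuous_on_compose2[OF Hcont])
  moreover have "vector_derivative g (at t) \<noteq> 0" for t
    using vector_derivative_at[OF gder] n nz by (simp add: H_def)
  ultimately show ?thesis unfolding smooth_simple_closed_curve_def using per sp im by blast
qed

definition piece :: "real \<Rightarrow> (int \<times> int) set \<Rightarrow> (int \<times> int) \<times> nat \<Rightarrow> real \<Rightarrow> complex" where
  "piece r S x s = (case x of (a, i) \<Rightarrow>
     if a + dir (Suc i) \<in> S then ctr r (a + dir i) + r * cis ((real i + 3 - s) * (pi / 3))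
     else ctr r a + r * cis ((real i + s) * (pi / 3)))"

definition piece_deriv :: "real \<Rightarrow> (int \<times> int) set \<Rightarrow> (int \<times> int) \<times> nat \<Rightarrow> real \<Rightarrow> complex" where
  "piece_deriv r S x s = (case x of (a, i) \<Rightarrow>
     \<i> * (pi / 3) * r * cis ((if a + dir (Suc i) \<in> S then real i - s else real i + s) * (pi / 3)))"

lemma cis_has_vector_derivative:
  "((\<lambda>s. cis ((a + b * s) * c)) has_vector_derivative \<i> * (b * c) * cis ((a + b * s) * c)) (at s)"
proof -
  have "((\<lambda>z. exp (\<i> * ((of_real a + of_real b * z) * of_real c))) has_field_derivative
      \<i> * (b * c) * exp (\<i> * ((of_real a + of_real b * of_real s) * of_real c))) (at (of_real s))"
    by (auto intro!: derivative_eq_intros)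
  from has_vector_derivative_real_field[OF this]
  show ?thesis by (simp add: cis_conv_exp)
qed

lemma cis_minus_3: "cis ((x - 3) * (pi / 3)) = - cis (x * (pi / 3))"
proof -
  have "x * (pi / 3) = (x - 3) * (pi / 3) + pi" by (simp add: field_simps)
  then show ?thesis by (simp only: cis_mult[symmetric]) simp
qed

lemma piece_has_vector_derivative: "(piece r S x has_vector_derivative piece_deriv r S x s) (at s)"
proof -
  obtain a i where x: "x = (a, i)" by (cases x)
  have "((\<lambda>s. ctr r (a + dir i) + r * cis ((real i + 3 + (-1) * s) * (pi / 3))) has_vector_derivative 
     0 + r * (\<i> * (complex_of_real (-1) * complex_of_real (pi / 3)) * cis ((real i + 3 + (-1) * s) * (pi / 3)))) (at s)"
    using cis_has_vector_derivative[of "real i + 3" "-1" "pi / 3" s]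
    by (intro has_vector_derivative_add has_vector_derivative_const has_vector_derivative_mult_right) simp
  moreover have "cis ((real i - s) * (pi / 3)) = - cis ((real i + 3 + (-1) * s) * (pi / 3))"
    using cis_minus_3[of "real i + 3 + (-1) * s"] by (simp add: algebra_simps)
  moreover have "((\<lambda>s. ctr r a + r * cis ((real i + 1 * s) * (pi / 3))) has_vector_derivative 
     0 + r * (\<i> * (complex_of_real 1 * complex_of_real (pi / 3)) * cis ((real i + 1 * s) * (pi / 3)))) (at s)"
    using cis_has_vector_derivative[of "real i" "1" "pi / 3" s]
    by (intro has_vector_derivative_add has_vector_derivative_const has_vector_derivative_mult_right) simp
  ultimately show ?thesis unfolding x piece_def[abs_def] piece_deriv_def by (auto simp: mult_ac)
qed

lemma piece_0: "piece r S x 0 = enode r x"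
proof -
  obtain a i where x: "x = (a, i)" by (cases x)
  have "cis ((real i + 3) * (pi / 3)) = - cis (real i * (pi / 3))" using cis_minus_3[of "real i + 3"] by simp
  then show ?thesis unfolding x piece_def by (simp add: enode_def node_eq emb_dir ctr_eq emb_add)
qed

lemma piece_deriv_0: "piece_deriv r S x 0 = \<i> * (pi / 3) * emb r (dir (snd x))"
  by (cases x) (simp add: piece_deriv_def emb_dir)

lemma emb_dir_minus: "of_real r * cis ((real i - 1) * (pi / 3)) = emb r (dir (i + 5))"
proof -
  have "real (i + 5) * pi / 3 = (real i - 1) * (pi / 3) + 2 * pi" by (simp add: field_simps)
  then show ?thesis unfolding emb_dir by (simp only: cis_mult[symmetric]) simp
qed

lemma piece_1: "piece r S x 1 = enode r (turn S x)"
proof -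
  obtain a i where x: "x = (a, i)" by (cases x)
  have "of_real r * cis ((real i + 3 - 1) * (pi / 3)) = emb r (dir (i + 2))"
    "of_real r * cis ((real i + 1) * (pi / 3)) = emb r (dir (Suc i))" unfolding emb_dir by (simp_all add: add.commute)
  then show ?thesis unfolding x piece_def enode_turn by (simp only: node_eq prod.case)
qed

lemma piece_deriv_1: "piece_deriv r S x 1 = \<i> * (pi / 3) * emb r (dir (snd (turn S x)))"
proof -
  obtain a i where x: "x = (a, i)" by (cases x)
  have "of_real r * cis ((real i - 1) * (pi / 3)) = emb r (dir ((i + 5) mod 6))"
    "of_real r * cis ((real i + 1) * (pi / 3)) = emb r (dir (Suc i mod 6))"
    unfolding dir_mod_6 emb_dir_minus by (simp_all add: emb_dir add.commute)
  then show ?thesis unfolding x piece_deriv_def turn_def by (simp add: mult.assoc)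
qed

lemma lk_param_unit: "lk r v k = {ctr r v + r * cis ((real k + s) * (pi / 3)) | s. 0 \<le> s \<and> s \<le> 1}"
proof (intro subset_antisym subsetI)
  fix z assume "z \<in> lk r v k"
  then obtain t where t: "z = ctr r v + r * cis t" "real k * pi / 3 \<le> t" "t \<le> real (Suc k) * pi / 3"
    unfolding lk_param by blast
  then show "z \<in> {ctr r v + r * cis ((real k + s) * (pi / 3)) | s. 0 \<le> s \<and> s \<le> 1}"
    by (intro CollectI exI[of _ "t / (pi / 3) - real k"]) (simp add: field_simps)
next
  fix z assume "z \<in> {ctr r v + r * cis ((real k + s) * (pi / 3)) | s. 0 \<le> s \<and> s \<le> 1}"
  then obtain s where "z = ctr r v + r * cis ((real k + s) * (pi / 3))" "0 \<le> s" "s \<le> 1" by blast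
  then show "z \<in> lk r v k" unfolding lk_param
    by (intro CollectI exI[of _ "(real k + s) * (pi / 3)"]) (simp add: field_simps)
qed

lemma piece_image: "piece r S x ` {0..1} = elink r S x"
proof -
  obtain a i where x: "x = (a, i)" by (cases x)
  show ?thesis
  proof (cases "a + dir (Suc i) \<in> S")
    case True
    have "elink r S x = lk r (a + dir i) (i + 2)" using True by (simp add: x elink_def elk_def)
    moreover define f where "f s = ctr r (a + dir i) + r * cis ((real (i + 2) + s) * (pi / 3))" for s
    have "piece r S x = (\<lambda>s. f (1 - s))"
    proof
      fix s
      have "real i + 3 - s = real (i + 2) + (1 - s)" by simp
      then show "piece r S x s = f (1 - s)" using True by (simp only: x piece_def f_def prod.case if_True)
    qed
    moreover have "(\<lambda>s. f (1 - s)) ` {0..1} = {f s | s :: real. 0 \<le> s \<and> s \<le> 1}" for f :: "real \<Rightarrow> complex"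
      by (force simp: image_iff intro: bexI[of _ "1 - s" for s])
    ultimately show ?thesis unfolding lk_param_unit f_def[symmetric] by simp
  next
    case False
    then show ?thesis unfolding x elink_def elk_def lk_param_unit piece_def[abs_def] by (auto simp: image_iff)
  qed
qed

lemma cis_inj_pi: "cis a = cis b \<Longrightarrow> \<bar>a - b\<bar> \<le> pi \<Longrightarrow> a = b"
proof (rule ccontr)
  assume "cis a = cis b" "\<bar>a - b\<bar> \<le> pi" "a \<noteq> b"
  then have "cis (a - b) = 1" by (simp add: cis_divide[symmetric])
  then have "cos \<bar>a - b\<bar> = 1" by (simp add: complex_eq_iff)
  moreover have "cos \<bar>a - b\<bar> < cos 0" using \<open>a \<noteq> b\<close> \<open>\<bar>a - b\<bar> \<le> pi\<close> by (intro cos_monotone_0_pi) auto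
  ultimately show False by simp
qed

lemma piece_inj:
  assumes "r > 0" "0 \<le> s" "s \<le> 1" "0 \<le> t" "t \<le> 1" "piece r S x s = piece r S x t" shows "s = t"
proof -
  have *: "a = b" if "cis (a * (pi / 3)) = cis (b * (pi / 3))" "\<bar>a - b\<bar> \<le> 1" for a b
  proof -
    have "\<bar>a * (pi / 3) - b * (pi / 3)\<bar> = \<bar>a - b\<bar> * (pi / 3)"
      unfolding left_diff_distrib[symmetric] abs_mult by simp
    also have "\<dots> \<le> 1 * (pi / 3)" using that(2) by (intro mult_right_mono) auto
    finally show ?thesis using cis_inj_pi[OF that(1)] pi_gt_zero by auto
  qed
  obtain a i where x: "x = (a, i)" by (cases x)
  show ?thesis using assms(6) *[of "real i + 3 - s" "real i + 3 - t"] *[of "real i + s" "real i + t"] assms(1-5)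
    unfolding x piece_def by (auto split: if_splits)
qed

lemma boundary_cycle_tangle:
  assumes r: "r > 0" and cyc: "boundary_cycle S" and fin: "finite S"
  shows "triangular_tangle r (curve r S)"
proof -
  let ?B = "bedges S"
  note fB = finite_bedges[OF fin]
  obtain x0 where x0: "x0 \<in> ?B" using cyc unfolding boundary_cycle_def by blast
  define x where "x j = (turn S ^^ j) x0" for j
  have xB: "x j \<in> ?B" for j by (induction j) (auto simp: x_def x0 turn_in)
  have x_Suc: "x (Suc j) = turn S (x j)" for j by (simp add: x_def)
  have ret: "x (j - i) = x0" if "x i = x j" "i \<le> j" for i j
    using that
  proof (induction i arbitrary: j)
    case (Suc i)
    then obtain j' where j': "j = Suc j'" by (cases j) auto
    then have "turn S (x i) = turn S (x j')" using Suc.prems x_Suc by simp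
    then have "x i = x j'" using inj_onD[OF turn_inj] xB by blast
    then show ?case using Suc.IH[of j'] Suc.prems j' by simp
  qed (simp add: x_def)
  have "\<not> inj x" using fB xB by (metis finite_imageD finite_subset image_subsetI infinite_UNIV_nat)
  then obtain i j where "i < j" "x i = x j" unfolding inj_def by (metis linorder_neqE_nat)
  then have ex: "0 < j - i \<and> x (j - i) = x0" using ret by simp
  define n where "n = (LEAST n. 0 < n \<and> x n = x0)"
  have n: "0 < n" "x n = x0" using LeastI[of "\<lambda>n. 0 < n \<and> x n = x0", OF ex] unfolding n_def by auto
  have nmin: "x m \<noteq> x0" if "0 < m" "m < n" for m
    using not_less_Least[of m "\<lambda>n. 0 < n \<and> x n = x0"] that unfolding n_def by blast
  have xinj: "i = j" if "i < n" "j < n" "x i = x j" for i j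
    using that
  proof (induction i j rule: linorder_wlog)
    case (le a b)
    then show ?case using ret[of a b] nmin[of "b - a"] by (cases "a = b") auto
  qed auto
  have "x ` {..<n} = ?B"
  proof -
    have "turn S ` x ` {..<n} \<subseteq> x ` {..<n}"
    proof (rule image_subsetI)
      fix y assume "y \<in> x ` {..<n}"
      then obtain j where j: "j < n" "y = x j" by auto
      show "turn S y \<in> x ` {..<n}"
      proof (cases "Suc j = n")
        case True
        then have "turn S y = x 0" using n j x_Suc[of j] by (simp add: x_def)
        then show ?thesis using n by auto
      next
        case False
        then show ?thesis using j x_Suc[of j] by (auto intro!: image_eqI[of _ _ "Suc j"])
      qed
    qed
    moreover have "x ` {..<n} \<subseteq> ?B" "x ` {..<n} \<noteq> {}" using xB n by auto
    ultimately show ?thesis using cyc unfolding boundary_cycle_def by blast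
  qed
  then have "curve r S = (\<Union>j<n. piece r S (x j) ` {0..1})" unfolding curve_eq_elinks piece_image by force
  moreover have "smooth_simple_closed_curve (\<Union>j<n. piece r S (x j) ` {0..1})"
  proof (rule smooth_simple_closed_curve_glue[where d = "\<lambda>j. piece_deriv r S (x j)"])
    show "0 < n" by (rule n)
    show "(piece r S (x j) has_vector_derivative piece_deriv r S (x j) s) (at s)" for j s
      by (rule piece_has_vector_derivative)
    show "continuous_on UNIV (piece_deriv r S (x j))" for j
    proof -
      obtain a i where "x j = (a, i)" by (cases "x j")
      then show ?thesis unfolding piece_deriv_def[abs_def]
        by (cases "a + dir (Suc i) \<in> S") (auto intro!: continuous_intros)
    qed
    show "piece r S (x j) 1 = piece r S (x (Suc j)) 0" for j by (simp add: piece_0 piece_1 x_Suc)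
    show "piece_deriv r S (x j) 1 = piece_deriv r S (x (Suc j)) 0" for j
      by (simp add: piece_deriv_0 piece_deriv_1 x_Suc)
    show "piece r S (x n) = piece r S (x 0)" "piece_deriv r S (x n) = piece_deriv r S (x 0)"
      using n by (simp_all add: x_def)
    show "piece_deriv r S (x j) s \<noteq> 0" for j s using r by (cases "x j") (simp add: piece_deriv_def)
    fix i j s t
    assume ij: "i < n" "j < n" and st: "0 \<le> s" "s < 1" "0 \<le> t" "t < 1" and eq: "piece r S (x i) s = piece r S (x j) t"
    have "x i = x j"
    proof (rule ccontr)
      assume ne: "x i \<noteq> x j"
      let ?z = "piece r S (x i) s"
      have z: "?z \<in> elink r S (x i)" "?z \<in> elink r S (x j)"
        using st eq piece_image[of r S "x i"] piece_image[of r S "x j"] by (metis atLeastAtMost_iff imageI less_imp_le)+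
      have "?z \<noteq> enode r (turn S (x i))" using piece_inj[OF r, of s 1 S "x i"] st piece_1[of r S "x i"] by auto
      then have "?z = enode r (x i)" using elink_inter[OF r xB xB ne z] by blast
      moreover have "?z \<noteq> enode r (turn S (x j))" using piece_inj[OF r, of t 1 S "x j"] st eq piece_1[of r S "x j"] by auto
      then have "?z = enode r (x j)" using elink_inter[OF r xB xB ne[symmetric] z(2,1)] by blast
      ultimately show False using enode_inj[OF r xB xB] ne by metis
    qed
    then show "i = j \<and> s = t" using xinj ij piece_inj[OF r, of s t S "x i"] st eq by simp
  qed
  moreover have "elink r S ` ?B \<subseteq> links r" unfolding links_eq elink_def by blast
  ultimately show ?thesis unfolding triangular_tangle_def using fB curve_eq_elinks[of r S]
    by (metis finite_imageI)
qed

lemma inner_vertices_curve: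
  assumes r: "r > 0" and tan: "triangular_tangle r (curve r S)" and fin: "finite S"
  shows "inner_vertices r (curve r S) = S"
proof (rule boundary_link_unique[OF finite_inner_vertices[OF r tan] fin])
  fix v k
  have "boundary_link (inner_vertices r (curve r S)) v k \<longleftrightarrow> lk r v k \<subseteq> curve r S"
    using tangle_link_iff[OF r tan] by simp
  also have "\<dots> \<longleftrightarrow> boundary_link S v k"
  proof
    assume "lk r v k \<subseteq> curve r S"
    then have "lmid r v k \<in> curve r S" using lmid by blast
    then obtain w m where "lmid r v k \<in> lk r w m" "boundary_link S w m" unfolding curve_def by blast
    then show "boundary_link S v k" using lmid_unique[OF r] boundary_link_cong by metis
  next
    assume "boundary_link S v k"
    then show "lk r v k \<subseteq> curve r S" unfolding curve_def by blast
  qed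
  finally show "boundary_link (inner_vertices r (curve r S)) v k \<longleftrightarrow> boundary_link S v k" .
qed

section \<open>Cross-cuts\<close>

lemma cis_inj_2pi: "cis a = cis b \<Longrightarrow> \<bar>a - b\<bar> < 2 * pi \<Longrightarrow> a = b"
proof -
  assume eq: "cis a = cis b" and lt: "\<bar>a - b\<bar> < 2 * pi"
  have "cis (a - b) = 1" using eq by (simp add: cis_divide[symmetric])
  then have "exp (\<i> * of_real (a - b)) = 1" by (simp add: cis_conv_exp)
  then obtain n :: int where "a - b = of_int (2 * n) * pi" unfolding exp_eq_1 by auto
  moreover from this have "\<bar>of_int n :: real\<bar> < 1" using lt by (simp add: abs_mult)
  then have "n = 0" by linarith
  ultimately show ?thesis by simp
qed

lemma polar_sixths:
  obtains \<theta> where "a \<le> \<theta>" "\<theta> < a + 6" "z = of_real (norm z) * cis (\<theta> * pi / 3)"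
proof -
  define t where "t = Arg z * 3 / pi"
  define m where "m = \<lfloor>(t - a) / 6\<rfloor>"
  have m: "of_int m \<le> (t - a) / 6" "(t - a) / 6 < of_int m + 1" unfolding m_def by linarith+
  define \<theta> where "\<theta> = t + 6 * of_int (- m)"
  have "a \<le> \<theta>" using m(1) by (simp add: \<theta>_def field_simps)
  have "\<theta> < a + 6" using m(2) by (simp add: \<theta>_def field_simps)
  have "\<theta> * pi / 3 = Arg z + 2 * pi * of_int (- m)"
    unfolding \<theta>_def t_def by (simp add: field_simps)
  then have "cis (\<theta> * pi / 3) = cis (Arg z)"
    by (simp only: cis_mult[symmetric] cis_multiple_2pi Ints_of_int mult_1_right)
  then have "z = of_real (norm z) * cis (\<theta> * pi / 3)" using rcis_cmod_Arg[of z] unfolding rcis_def by simp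
  with \<open>a \<le> \<theta>\<close> \<open>\<theta> < a + 6\<close> show ?thesis using that by blast
qed

lemma node_in_curve: "a \<in> S \<Longrightarrow> a + dir i \<notin> S \<Longrightarrow> node r a i \<in> curve r S"
proof -
  assume "a \<in> S" "a + dir i \<notin> S"
  then have "(a, i mod 6) \<in> bedges S" by (simp add: bedges_def)
  moreover have "enode r (a, i mod 6) = node r a i" using node_cong[of "i mod 6" i r a] by (simp add: enode_def)
  ultimately show ?thesis unfolding curve_eq_elinks using enode_in_elink(1)[of r "(a, i mod 6)" S] by auto
qed

lemma node_in_lk: "node r a i \<in> lk r a i" "node r a i \<in> lk r a (i + 5)"
proof -
  show "node r a i \<in> lk r a i"
    using pathstart_in_path_image[of "link_path r (ctr r a) i"] unfolding lk_def link_path_ends .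
  have "node r a (Suc (i + 5)) \<in> lk r a (i + 5)"
    using pathfinish_in_path_image[of "link_path r (ctr r a) (i + 5)"] unfolding lk_def link_path_ends .
  then show "node r a i \<in> lk r a (i + 5)" using node_cong[of "Suc (i + 5)" i r a] by simp
qed

lemma node_notin_curve:
  assumes "r > 0" "a \<in> S" "a + dir i \<in> S" shows "node r a i \<notin> curve r S"
proof
  let ?z = "node r a i"
  assume "?z \<in> curve r S"
  then obtain x where x: "x \<in> bedges S" "?z \<in> elink r S x" unfolding curve_eq_elinks by blast
  have "?z \<in> {enode r x, enode r (turn S x)}"
  proof (rule ccontr)
    assume "\<not> ?thesis"
    then have "?z \<noteq> node r (fst (elk S x)) (snd (elk S x))" "?z \<noteq> node r (fst (elk S x)) (Suc (snd (elk S x)))"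
      using elk_nodes[of r S x] by blast+
    then have "i mod 6 = snd (elk S x) mod 6 \<and> (i + 5) mod 6 = snd (elk S x) mod 6"
      using lk_inter[OF assms(1) _ node_in_lk(1)[of r a i]] lk_inter[OF assms(1) _ node_in_lk(2)[of r a i]]
        x(2) unfolding elink_def by blast
    then have "(i + 5) mod 6 = i mod 6" by simp
    then show False by presburger
  qed
  then obtain y where y: "y \<in> bedges S" "?z = enode r y" using x(1) turn_in by blast
  obtain b m where b: "y = (b, m)" "b \<in> S" "b + dir m \<notin> S" using y(1) by (auto simp: bedges_def)
  have "node r a i = node r b m" using y(2) b by (simp add: enode_def)
  then consider "b = a" "m mod 6 = i mod 6" | "b = a + dir i" "m mod 6 = (i + 3) mod 6"
    using node_eqD[OF assms(1)] by blast
  then show False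
  proof cases
    case 1 then show ?thesis using b assms(3) dir_cong by metis
  next
    case 2
    then have "b + dir m = a" using dir_cong[of m "i + 3"] dir_back by metis
    then show ?thesis using b assms(2) by simp
  qed
qed

lemma edge_cases:
  assumes "r > 0" "0 \<le> s" "s \<le> 2" "z = ctr r a + of_real s * emb r (dir k)"
  shows "z \<in> ball (ctr r a) r \<or> z = node r a k \<or> z \<in> ball (ctr r (a + dir k)) r"
proof -
  have n: "norm (emb r (dir k)) = r" using assms(1) by (simp add: emb_dir norm_mult)
  have "ctr r (a + dir k) - z = of_real (2 - s) * emb r (dir k)"
    unfolding assms(4) by (simp add: ctr_eq emb_add algebra_simps)
  then have "dist (ctr r (a + dir k)) z = (2 - s) * r" using assms(3) n by (simp add: dist_norm norm_mult del: of_real_diff)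
  moreover have "dist (ctr r a) z = s * r" using assms(2,4) n by (simp add: dist_norm norm_mult)
  moreover consider "s < 1" | "s = 1" | "s > 1" by linarith
  ultimately show ?thesis using assms(1,4) by cases (auto simp: node_eq)
qed

lemma ball_not_curve: "r > 0 \<Longrightarrow> z \<in> ball (ctr r v) r \<Longrightarrow> z \<notin> curve r S"
  unfolding curve_def using ball_not_lk by blast

lemma cross_cut_separates:
  assumes r: "r > 0" and tan: "triangular_tangle r (curve r S)" and S: "inner_vertices r (curve r S) = S"
    and u: "u \<in> S" and ord: "i < p" "p < j" "j < q" "q < i + 6"
    and out: "u + dir i \<notin> S" "u + dir j \<notin> S" and ins: "u + dir p \<in> S" "u + dir q \<in> S"
  shows "\<not> adj_connected (S - {u})"
proof
  assume con: "adj_connected (S - {u})"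
  let ?C = "curve r S"
  define u0 where "u0 = ctr r u"
  define e where "e k = emb r (dir k)" for k
  have ne: "norm (e k) = r" for k using r by (simp add: e_def emb_dir norm_mult)
  have nodee: "node r u k = u0 + e k" for k by (simp add: node_eq u0_def e_def)
  have e_cis: "e k = r * cis (real k * pi / 3)" for k by (simp add: e_def emb_dir)
  define m1 m2 where "m1 = node r u i" and "m2 = node r u j"
  have mC: "m1 \<in> ?C" "m2 \<in> ?C" using node_in_curve u out by (auto simp: m1_def m2_def)
  have ij: "e i \<noteq> e j"
  proof
    assume "e i = e j"
    then have "dir i = dir j" using emb_inj[OF r] by (simp add: e_def)
    then have "i mod 6 = j mod 6" by (rule dir_inj)
    then have "6 dvd j - i" using ord by (metis mod_eq_dvd_iff_nat less_imp_le less_trans)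
    then show False using ord by (auto dest: dvd_imp_le)
  qed
  have m12: "m1 \<noteq> m2" using ij by (simp add: m1_def m2_def nodee)
  obtain g where g: "simple_path g" "path_image g = ?C" "\<And>t. g (t + 1) = g t"
    using tan unfolding triangular_tangle_def smooth_simple_closed_curve_def by blast
  have "g 1 = g 0" using g(3)[of 0] by simp
  then have loop: "pathfinish g = pathstart g" by (simp add: pathfinish_def pathstart_def)
  obtain c1 d where arcs: "arc c1" "arc d" "pathstart c1 = m1" "pathfinish c1 = m2"
      "pathstart d = m2" "pathfinish d = m1" "path_image c1 \<inter> path_image d = {m1, m2}"
      "path_image c1 \<union> path_image d = ?C"
    using exists_double_arc[OF g(1) loop _ _ m12] mC g(2) by metis
  define c2 where "c2 = reversepath d"
  have c2: "arc c2" "pathstart c2 = m1" "pathfinish c2 = m2" "path_image c1 \<inter> path_image c2 = {m1, m2}"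
      "path_image c1 \<union> path_image c2 = ?C"
    using arcs by (auto simp: c2_def arc_reversepath)
  define c where "c = linepath m1 u0 +++ linepath u0 m2"
  have seg: "closed_segment u0 (u0 + x) = {u0 + of_real s * x | s. 0 \<le> s \<and> s \<le> 1}" for x
    by (auto simp: closed_segment_def scaleR_conv_of_real algebra_simps)
  have segs: "closed_segment m1 u0 = {u0 + of_real s * e i | s. 0 \<le> s \<and> s \<le> 1}"
    "closed_segment u0 m2 = {u0 + of_real s * e j | s. 0 \<le> s \<and> s \<le> 1}"
    using seg[of "e i"] seg[of "e j"] closed_segment_commute[of m1 u0] by (simp_all add: m1_def m2_def nodee)
  have pc: "path_image c = {u0 + of_real s * e k | s k. 0 \<le> s \<and> s \<le> 1 \<and> (k = i \<or> k = j)}"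
    unfolding c_def by (subst path_image_join) (auto simp: segs)
  have "arc c" unfolding c_def
  proof (rule arc_join)
    have "m1 \<noteq> u0" "u0 \<noteq> m2" using ne[of i] ne[of j] r by (auto simp: m1_def m2_def nodee)
    then show "arc (linepath m1 u0)" "arc (linepath u0 m2)" by (auto intro: arc_linepath)
    show "path_image (linepath m1 u0) \<inter> path_image (linepath u0 m2) \<subseteq> {pathstart (linepath u0 m2)}"
    proof
      fix z assume "z \<in> path_image (linepath m1 u0) \<inter> path_image (linepath u0 m2)"
      then obtain s t where st: "z = u0 + of_real s * e i" "z = u0 + of_real t * e j" "0 \<le> s" "0 \<le> t"
        unfolding path_image_linepath segs by blast
      then have eq: "of_real s * e i = of_real t * e j" by simp
      then have "norm (of_real s * e i) = norm (of_real t * e j)" by simp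
      then have "s = t" using st(3,4) ne r by (simp add: norm_mult)
      then have "s = 0" using eq ij by auto
      then show "z \<in> {pathstart (linepath u0 m2)}" using st by simp
    qed
  qed auto
  have cse: "pathstart c = m1" "pathfinish c = m2" by (simp_all add: c_def)
  have c_ball: "z \<in> ball u0 r \<or> z = m1 \<or> z = m2" if zc: "z \<in> path_image c" for z
  proof -
    obtain s k where z: "z = u0 + of_real s * e k" "0 \<le> s" "s \<le> 1" "k = i \<or> k = j" using zc unfolding pc by blast
    have "dist u0 z = s * r" using z ne by (simp add: dist_norm norm_mult)
    then show ?thesis using z r by (cases "s = 1") (auto simp: m1_def m2_def nodee)
  qed
  have ball_C: "z \<notin> ?C" if "z \<in> ball u0 r" for z using ball_not_curve[OF r] that unfolding u0_def by blast
  have cC: "path_image c \<inter> ?C = {m1, m2}"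
    using c_ball ball_C mC cse pathstart_in_path_image[of c] pathfinish_in_path_image[of c] by auto
  have inside_S: "ctr r v \<in> inside ?C \<longleftrightarrow> v \<in> S" for v using S unfolding inner_vertices_def by blast
  have "u0 \<in> path_image c" unfolding pc by (intro CollectI exI[of _ 0] exI[of _ i]) simp
  then have meet: "path_image c \<inter> inside (path_image c1 \<union> path_image c2) \<noteq> {}"
    using inside_S[of u] u unfolding c2(5) u0_def by blast
  have sub: "{m1, m2} \<subseteq> path_image c1" "{m1, m2} \<subseteq> path_image c2" using c2(4) by blast+
  have i1: "path_image c1 \<inter> path_image c = {m1, m2}" "path_image c2 \<inter> path_image c = {m1, m2}"
    using cC c2(5) sub by blast+
  define I1 I2 where "I1 = inside (path_image c1 \<union> path_image c)" and "I2 = inside (path_image c2 \<union> path_image c)"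
  have I: "I1 \<inter> I2 = {}" "I1 \<union> I2 \<union> (path_image c - {m1, m2}) = inside ?C"
    using split_inside_simple_closed_curve[of c1 m1 m2 c2 c, OF arc_imp_simple_path[OF arcs(1)] arcs(3,4)
        arc_imp_simple_path[OF c2(1)] c2(2,3) arc_imp_simple_path[OF \<open>arc c\<close>] cse m12 c2(4) i1 meet]
    unfolding I1_def I2_def c2(5) by blast+
  have J: "open (inside (path_image b \<union> path_image c)) \<and> path_image c \<subseteq> closure (inside (path_image b \<union> path_image c))"
    if b: "arc b" "pathstart b = m1" "pathfinish b = m2" "path_image b \<inter> path_image c = {m1, m2}" for b
  proof -
    have sp: "simple_path (b +++ reversepath c)"
      by (rule simple_path_join_loop) (use b \<open>arc c\<close> cse in \<open>auto simp: arc_reversepath\<close>)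
    have im: "path_image (b +++ reversepath c) = path_image b \<union> path_image c"
      by (subst path_image_join) (use b cse in auto)
    have "pathfinish (b +++ reversepath c) = pathstart (b +++ reversepath c)" using b cse by simp
    from Jordan_inside_outside[OF sp this, unfolded im]
    show ?thesis unfolding frontier_def by blast
  qed
  have oI: "open I1" "open I2" and clI: "path_image c \<subseteq> closure I1" "path_image c \<subseteq> closure I2"
    using J[OF arcs(1,3,4) i1(1)] J[OF c2(1-3) i1(2)] unfolding I1_def I2_def by blast+
  have disj: "I1 \<inter> path_image c = {}" "I2 \<inter> path_image c = {}"
    unfolding I1_def I2_def using inside_no_overlap by blast+
  have side: "T \<subseteq> I1 \<or> T \<subseteq> I2" if T: "connected T" "T \<inter> ?C = {}" "T \<inter> path_image c = {}" "t \<in> T" "t \<in> inside ?C" for T t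
  proof -
    have "T \<subseteq> inside ?C" using connected_inside_iff[OF T(1,2,4)] T(5) by blast
    then have "T \<subseteq> I1 \<union> I2" using I(2) T(3) by blast
    moreover have "I1 \<inter> I2 \<inter> T = {}" using I(1) by blast
    ultimately have "I1 \<inter> T = {} \<or> I2 \<inter> T = {}" using connectedD[OF T(1) oI] by blast
    then show ?thesis using \<open>T \<subseteq> I1 \<union> I2\<close> by blast
  qed
  define sector where "sector a b = (\<lambda>(\<rho>, \<theta>). u0 + of_real \<rho> * (of_real r * cis (\<theta> * pi / 3))) ` ({0<..<1} \<times> {a<..<b})" for a b :: real
  have sec_ball: "z \<in> ball u0 r" if "z \<in> sector a b" for z a b
    using that r unfolding sector_def by (auto simp: dist_norm norm_mult)
  have sec_inside: "z \<in> inside ?C" if "z \<in> ball u0 r" for z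
    using ball_state[OF r triangular_tangle_link_union[OF tan]] that inside_S[of u] u unfolding u0_def by blast
  have sec_conn: "connected (sector a b)" for a b
    unfolding sector_def case_prod_unfold
    by (intro connected_continuous_image connected_Times connected_Ioo continuous_intros ballI) simp
  have sec_c: "sector a b \<inter> path_image c = {}"
    if ab: "(a, b) = (real i, real j) \<or> (a, b) = (real j, real i + 6)" for a b
  proof (rule ccontr)
    assume "sector a b \<inter> path_image c \<noteq> {}"
    then obtain z where zs: "z \<in> sector a b" and zc: "z \<in> path_image c" by blast
    obtain \<rho> \<theta> where z1: "z = u0 + of_real \<rho> * (of_real r * cis (\<theta> * pi / 3))" and \<rho>: "0 < \<rho>" "a < \<theta>" "\<theta> < b"
    proof -
      obtain x where x: "x \<in> {0<..<1} \<times> {a<..<b}"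
          "z = (case x of (\<rho>, \<theta>) \<Rightarrow> u0 + of_real \<rho> * (of_real r * cis (\<theta> * pi / 3)))"
        using zs unfolding sector_def by blast
      then show ?thesis using that[of "fst x" "snd x"] by (simp add: case_prod_unfold mem_Times_iff)
    qed
    obtain s k where z2: "z = u0 + of_real s * e k" and s: "0 \<le> s" "k = i \<or> k = j" using zc unfolding pc by blast
    from z1 z2 have "u0 + of_real \<rho> * (of_real r * cis (\<theta> * pi / 3)) = u0 + of_real s * e k" by simp
    then have eq: "of_real \<rho> * (of_real r * cis (\<theta> * pi / 3)) = of_real s * (of_real r * cis (real k * pi / 3))"
      by (simp add: e_cis)
    have "norm (of_real \<rho> * (of_real r * cis (\<theta> * pi / 3))) = norm (of_real s * (of_real r * cis (real k * pi / 3)))"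
      by (simp only: eq)
    then have "\<rho> = s" using r \<rho>(1) s(1) by (simp add: norm_mult)
    then have cc: "cis (\<theta> * pi / 3) = cis (real k * pi / 3)" using eq r \<rho>(1) by simp
    have lt: "\<bar>\<theta> - real k\<bar> < 6" and "\<theta> \<noteq> real k" using ab \<rho>(2,3) s(2) ord by auto
    have "\<theta> * pi / 3 - real k * pi / 3 = (\<theta> - real k) * (pi / 3)" by (simp add: algebra_simps)
    then have "\<bar>\<theta> * pi / 3 - real k * pi / 3\<bar> = \<bar>\<theta> - real k\<bar> * (pi / 3)" by (simp only: abs_mult) simp
    also have "\<dots> < 6 * (pi / 3)" using lt by (intro mult_strict_right_mono) auto
    finally have "\<theta> * pi / 3 = real k * pi / 3" using cis_inj_2pi[OF cc] by simp
    then show False using \<open>\<theta> \<noteq> real k\<close> by simp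
  qed
  define X1 X2 where "X1 = sector (real i) (real j)" and "X2 = sector (real j) (real i + 6)"
  have X_c: "X1 \<inter> path_image c = {}" "X2 \<inter> path_image c = {}"
    using sec_c[of "real i" "real j"] sec_c[of "real j" "real i + 6"] unfolding X1_def X2_def by simp_all
  have cover: "z \<in> X1 \<or> z \<in> X2 \<or> z \<in> path_image c" if z: "z \<in> ball u0 r" for z
  proof (cases "z = u0")
    case True
    then show ?thesis using \<open>u0 \<in> path_image c\<close> by simp
  next
    case False
    define \<rho> where "\<rho> = norm (z - u0) / r"
    have \<rho>: "0 < \<rho>" "\<rho> < 1" using z False r by (auto simp: \<rho>_def dist_norm norm_minus_commute)
    obtain \<theta> where \<theta>: "real i \<le> \<theta>" "\<theta> < real i + 6" "z - u0 = of_real (norm (z - u0)) * cis (\<theta> * pi / 3)"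
      using polar_sixths by blast
    then have zz: "z = u0 + of_real \<rho> * (of_real r * cis (\<theta> * pi / 3))"
      using r unfolding \<rho>_def by (simp add: algebra_simps)
    consider "\<theta> = real i" | "real i < \<theta>" "\<theta> < real j" | "\<theta> = real j" | "real j < \<theta>" using \<theta> by linarith
    then show ?thesis
    proof cases
      case 1 then show ?thesis using zz \<rho> unfolding pc e_cis by (auto intro!: exI[of _ \<rho>] exI[of _ i])
    next
      case 2 then show ?thesis using zz \<rho> unfolding X1_def sector_def by auto
    next
      case 3 then show ?thesis using zz \<rho> unfolding pc e_cis by (auto intro!: exI[of _ \<rho>] exI[of _ j])
    next
      case 4 then show ?thesis using zz \<rho> \<theta> unfolding X2_def sector_def by auto
    qed
  qed
  have in_sec: "u0 + of_real s * e k \<in> sector a b" if "0 < s" "s < 1" "a < real k" "real k < b" for s k a b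
    using that unfolding sector_def e_cis by (auto intro!: image_eqI[of _ _ "(s, real k)"])
  have yp: "u0 + of_real (1/2) * e p \<in> X1" and yq: "u0 + of_real (1/2) * e q \<in> X2"
    unfolding X1_def X2_def using ord by (intro in_sec; simp)+
  have X12: "X1 \<subseteq> I1 \<or> X1 \<subseteq> I2" "X2 \<subseteq> I1 \<or> X2 \<subseteq> I2"
  proof -
    have "X \<subseteq> I1 \<or> X \<subseteq> I2" if X: "X = X1 \<or> X = X2" for X
    proof -
      obtain x where x: "x \<in> X" using X yp yq by blast
      show ?thesis
      proof (rule side)
        show "connected X" "X \<inter> path_image c = {}" using X sec_conn X_c unfolding X1_def X2_def by blast+
        show "X \<inter> ?C = {}" using X sec_ball ball_C unfolding X1_def X2_def by blast
        show "x \<in> X" by (rule x)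
        show "x \<in> inside ?C" using x X sec_ball sec_inside unfolding X1_def X2_def by blast
      qed
    qed
    then show "X1 \<subseteq> I1 \<or> X1 \<subseteq> I2" "X2 \<subseteq> I1 \<or> X2 \<subseteq> I2" by blast+
  qed
  have "I1 \<inter> ball u0 r \<noteq> {}" "I2 \<inter> ball u0 r \<noteq> {}"
    using clI \<open>u0 \<in> path_image c\<close> open_Int_closure_eq_empty[OF open_ball, of u0 r] r
    by (metis Int_commute centre_in_ball disjoint_iff subsetD)+
  then have "I1 \<inter> (X1 \<union> X2) \<noteq> {}" "I2 \<inter> (X1 \<union> X2) \<noteq> {}" using cover disj by blast+
  then have opp: "X1 \<subseteq> I1 \<and> X2 \<subseteq> I2 \<or> X1 \<subseteq> I2 \<and> X2 \<subseteq> I1" using X12 I(1) by blast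
  have c_far: "z \<notin> path_image c" if "z \<notin> ?C" "z \<notin> ball u0 r" for z using that c_ball mC by blast
  have seg_C: "z \<notin> ?C" if "a \<in> S" "a + dir k \<in> S" "0 \<le> s" "s \<le> 2" "z = ctr r a + of_real s * emb r (dir k)" for a k s z
    using edge_cases[OF r that(3,4,5)] ball_not_curve[OF r] node_notin_curve[OF r that(1,2)] by blast
  have spoke: "ctr r (u + dir k) \<in> I \<longleftrightarrow> u0 + of_real (1/2) * e k \<in> I"
    if k: "u + dir k \<in> S" "u0 + of_real (1/2) * e k \<in> X" "X = X1 \<or> X = X2" "I = I1 \<or> I = I2"
      and lt: "(X = X1 \<and> real i < real k \<and> real k < real j) \<or> (X = X2 \<and> real j < real k \<and> real k < real i + 6)" for k X I
  proof -
    let ?T = "(\<lambda>s. u0 + of_real s * e k) ` {1/2..2}"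
    have "?T \<subseteq> I1 \<or> ?T \<subseteq> I2"
    proof (rule side)
      show "connected ?T" by (intro connected_continuous_image continuous_intros connected_Icc)
      show "?T \<inter> ?C = {}" using seg_C[OF u k(1)] unfolding u0_def e_def by fastforce
      show "?T \<inter> path_image c = {}"
      proof (intro equalityI subsetI)
        fix z assume z: "z \<in> ?T \<inter> path_image c"
        then obtain s where "s \<in> {1/2..2}" and z1: "z = u0 + of_real s * e k" by blast
        then have s: "z = u0 + of_real s * e k" "1/2 \<le> s" "s \<le> 2" by simp_all
        show "z \<in> {}"
        proof (cases "s < 1")
          case True
          then have "z \<in> X" using in_sec[of s] s lt unfolding X1_def X2_def by auto
          then show ?thesis using z k(3) X_c by blast
        next
          case False
          have "z \<notin> ?C" using seg_C[OF u k(1), of s] s unfolding u0_def e_def by simp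
          moreover have "z \<notin> ball u0 r" using False s r ne by (simp add: dist_norm norm_mult)
          ultimately show ?thesis using z c_far by blast
        qed
      qed auto
      show "u0 + of_real 2 * e k \<in> ?T" by (intro imageI) simp
      have "u0 + of_real 2 * e k = ctr r (u + dir k)" by (simp add: u0_def e_def ctr_eq emb_add)
      then show "u0 + of_real 2 * e k \<in> inside ?C" using inside_S k(1) by simp
    qed
    moreover have "ctr r (u + dir k) \<in> ?T" by (auto simp: u0_def e_def ctr_eq emb_add intro!: image_eqI[of _ _ 2])
    moreover have "u0 + of_real (1/2) * e k \<in> ?T" by (intro imageI) simp
    ultimately show ?thesis using k(4) I(1) by blast
  qed
  define K where "K = {v \<in> S - {u}. ctr r v \<in> I1}"
  have "adj_closed (S - {u}) K" unfolding adj_closed_def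
  proof (intro conjI ballI allI impI)
    show "K \<subseteq> S - {u}" unfolding K_def by blast
    fix a k assume a: "a \<in> K" and b: "a + dir k \<in> S - {u}"
    have aS: "a \<in> S" "a \<noteq> u" using a unfolding K_def by auto
    let ?T = "(\<lambda>s. ctr r a + of_real s * emb r (dir k)) ` {0..2}"
    have "?T \<subseteq> I1 \<or> ?T \<subseteq> I2"
    proof (rule side)
      show "connected ?T" by (intro connected_continuous_image continuous_intros connected_Icc)
      show TC: "?T \<inter> ?C = {}" using seg_C[OF aS(1)] b by fastforce
      show "?T \<inter> path_image c = {}"
      proof (intro equalityI subsetI)
        fix z assume z: "z \<in> ?T \<inter> path_image c"
        then obtain s where "s \<in> {0..2}" and z1: "z = ctr r a + of_real s * emb r (dir k)" by blast
        then have s: "z = ctr r a + of_real s * emb r (dir k)" "0 \<le> s" "s \<le> 2" by simp_all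
        have "z \<in> ball (ctr r a) r \<or> z = node r a k \<or> z \<in> ball (ctr r (a + dir k)) r"
          using edge_cases[OF r s(2,3,1)] .
        then have "z \<notin> ball u0 r"
          using ball_ctr_far[OF r, of a u z] ball_ctr_far[OF r, of "a + dir k" u z] aS b
            ball_not_lk[OF r, of z u a k] node_in_lk(1)[of r a k] unfolding u0_def
          by (auto simp: dist_commute)
        then show "z \<in> {}" using c_far z TC by blast
      qed auto
      show "ctr r a \<in> ?T" by (auto intro!: image_eqI[of _ _ 0])
      show "ctr r a \<in> inside ?C" using inside_S aS by simp
    qed
    moreover have "ctr r a \<in> ?T" by (auto intro!: image_eqI[of _ _ 0])
    moreover have "ctr r (a + dir k) \<in> ?T" by (auto simp: ctr_eq emb_add intro!: image_eqI[of _ _ 2])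
    ultimately show "a + dir k \<in> K" using a b I(1) unfolding K_def by blast
  qed
  then have "K = {} \<or> K = S - {u}" using con unfolding adj_connected_def by blast
  moreover have "u + dir p \<in> S - {u}" "u + dir q \<in> S - {u}" using ins by auto
  moreover have "ctr r (u + dir p) \<in> I1 \<longleftrightarrow> u0 + of_real (1/2) * e p \<in> I1"
    "ctr r (u + dir q) \<in> I1 \<longleftrightarrow> u0 + of_real (1/2) * e q \<in> I1"
    using spoke[OF ins(1) yp, of I1] spoke[OF ins(2) yq, of I1] ord by simp_all
  ultimately show False using opp yp yq I(1) unfolding K_def by blast
qed

lemma contiguous_arc:
  assumes r: "r > 0" and tan: "triangular_tangle r (curve r S)" and S: "inner_vertices r (curve r S) = S"
    and u: "u \<in> S" and out: "u + dir i0 \<notin> S" and con: "adj_connected S" "adj_connected (S - {u})" and ne: "S \<noteq> {u}"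
  obtains j n where "0 < n" "n < 6" "\<And>i. i < 6 \<Longrightarrow> u + dir (j + i) \<in> S \<longleftrightarrow> i < n"
proof -
  have "\<exists>p. u + dir p \<in> S"
  proof (rule ccontr)
    assume "\<nexists>p. u + dir p \<in> S"
    then have "adj_closed S {u}" using u unfolding adj_closed_def by blast
    then show False using con(1) ne unfolding adj_connected_def by blast
  qed
  then obtain p where p: "u + dir p \<in> S" ..
  obtain t where "p mod 6 = (i0 + t) mod 6" using dir_shift by blast
  then have t: "u + dir (i0 + t) \<in> S" using p dir_cong by metis
  define t0 where "t0 = (LEAST t. u + dir (i0 + t) \<in> S)"
  have t0: "u + dir (i0 + t0) \<in> S" unfolding t0_def using t by (rule LeastI)
  have "t0 \<noteq> 0" using t0 out by (cases "t0 = 0") auto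
  then obtain t1 where t1: "t0 = Suc t1" by (cases t0) auto
  define j where "j = i0 + t0"
  have j: "u + dir j \<in> S" using t0 by (simp add: j_def)
  have "dir (j + 5) = dir (i0 + t1)" by (rule dir_cong) (simp add: j_def t1)
  moreover have "u + dir (i0 + t1) \<notin> S" using not_less_Least[of t1 "\<lambda>t. u + dir (i0 + t) \<in> S"] t1 unfolding t0_def by auto
  ultimately have j5: "u + dir (j + 5) \<notin> S" by simp
  define n where "n = (LEAST n. u + dir (j + n) \<notin> S)"
  have n: "u + dir (j + n) \<notin> S" unfolding n_def using j5 by (rule LeastI)
  have n5: "n \<le> 5" unfolding n_def using j5 by (rule Least_le)
  have below: "u + dir (j + i) \<in> S" if "i < n" for i using not_less_Least[of i "\<lambda>n. u + dir (j + n) \<notin> S"] that unfolding n_def by blast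
  have "n \<noteq> 0" using n j by (cases "n = 0") auto
  moreover have "u + dir (j + i) \<notin> S" if i: "i < 6" "n \<le> i" for i
  proof
    assume ii: "u + dir (j + i) \<in> S"
    have "i \<noteq> n" "i \<noteq> 5" using ii n j5 by auto
    then have "j + n < j + i" "j + i < j + 5" "j + 5 < j + 6" "j + 6 < j + n + 6" using i \<open>n \<noteq> 0\<close> by auto
    moreover have "u + dir (j + 6) \<in> S" using j by (simp add: dir_add_numeral)
    ultimately show False using cross_cut_separates[OF r tan S u _ _ _ _ n j5 ii] con(2) by blast
  qed
  ultimately show ?thesis using that[of n j] below n5 by (auto simp: not_less[symmetric])
qed

section \<open>The operations\<close>

lemma link_curvature_boundary:
  assumes r: "r > 0" and tan: "triangular_tangle r (curve r S)" and S: "inner_vertices r (curve r S) = S"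
    and b: "boundary_link S v k"
  shows "link_curvature r (curve r S) (if v \<in> S then Convex else Concave) (lk r v k)"
proof -
  have sub: "lk r v (k mod 6) \<subseteq> curve r S" using b unfolding lk_mod curve_def by blast
  have st: "ctr r v \<in> inside (curve r S) \<longleftrightarrow> v \<in> S" using S unfolding inner_vertices_def by blast
  have A: "lk r v k = path_image (link_path r (ctr r v) (k mod 6))" using lk_mod[of r v k] unfolding lk_def by simp
  have v: "ctr r v \<in> tiling_vertices r" unfolding tiling_vertices_eq by blast
  have k6: "k mod 6 < 6" by simp
  have side: "\<forall>z \<in> lk r v k - {node r v (k mod 6), node r v (Suc (k mod 6))}.
      \<forall>\<^sub>F w in nhds z. w \<in> inside (curve r S) \<longleftrightarrow> (if v \<in> S then dist (ctr r v) w < r else dist (ctr r v) w > r)"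
    using link_side[OF r tan sub] unfolding st lk_mod by blast
  show ?thesis
  proof (cases "v \<in> S")
    case True
    show ?thesis unfolding if_P[OF True] link_curvature.simps
      by (rule bexI[OF _ v], rule exI[of _ "k mod 6"]) 
         (intro conjI k6 A, unfold link_path_ends, rule side[unfolded if_P[OF True]])
  next
    case False
    show ?thesis unfolding if_not_P[OF False] link_curvature.simps
      by (rule bexI[OF _ v], rule exI[of _ "k mod 6"]) 
         (intro conjI k6 A, unfold link_path_ends, rule side[unfolded if_not_P[OF False]])
  qed
qed

lemma link_joins_lk:
  "link_joins r (lk r v k) (node r v k) (node r v (Suc k))"
  "link_joins r (lk r v k) (node r v (Suc k)) (node r v k)"
proof -
  have "node r v (k mod 6) = node r v k" "node r v (Suc (k mod 6)) = node r v (Suc k)"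
    by (rule node_cong; simp add: mod_Suc_eq)+
  then have "\<exists>c\<in>tiling_vertices r. \<exists>j<6. lk r v k = path_image (link_path r c j) \<and>
     {node r v k, node r v (Suc k)} = {pathstart (link_path r c j), pathfinish (link_path r c j)}"
    unfolding tiling_vertices_eq
    by (intro bexI[of _ "ctr r v"] exI[of _ "k mod 6"]) (simp_all add: link_path_ends flip: lk_def)
  then show "link_joins r (lk r v k) (node r v k) (node r v (Suc k))"
    "link_joins r (lk r v k) (node r v (Suc k)) (node r v k)"
    unfolding link_joins_def by (simp_all add: insert_commute)
qed

lemma link_chain_append: "link_chain r (xs @ ys) p q \<longleftrightarrow> (\<exists>m. link_chain r xs p m \<and> link_chain r ys m q)"
  by (induction xs arbitrary: p) auto

lemma link_chain_circle:
  assumes "a \<le> b"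
  shows "link_chain r (map (\<lambda>i. lk r u (j + i)) [a..<b]) (node r u (j + a)) (node r u (j + b))"
    and "link_chain r (map (\<lambda>i. lk r u (j + i)) (rev [a..<b])) (node r u (j + b)) (node r u (j + a))"
proof -
  show "link_chain r (map (\<lambda>i. lk r u (j + i)) [a..<b]) (node r u (j + a)) (node r u (j + b))"
    using assms
  proof (induction b rule: dec_induct)
    case (step b)
    then show ?case using link_joins_lk(1)[of r u "j + b"] by (auto simp: link_chain_append)
  qed simp
  show "link_chain r (map (\<lambda>i. lk r u (j + i)) (rev [a..<b])) (node r u (j + b)) (node r u (j + a))"
    using assms
  proof (induction b rule: dec_induct)
    case (step b)
    then show ?case using link_joins_lk(2)[of r u "j + b"] by auto
  qed simp
qed

lemma list_all2_replicate_left: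
  "length xs = n \<Longrightarrow> (\<And>x. x \<in> set xs \<Longrightarrow> P c x) \<Longrightarrow> list_all2 P (replicate n c) xs"
  by (auto simp: list_all2_conv_all_nth)

lemma tangle_links_curve:
  assumes "r > 0" "triangular_tangle r (curve r S)" "inner_vertices r (curve r S) = S"
  shows "tangle_links r (curve r S) = {lk r v k | v k. boundary_link S v k}"
  using tangle_link_iff[OF assms(1,2)] unfolding assms(3) tangle_links_def links_eq by blast

lemma mod_6_add_cancel:
  assumes "(j + x) mod 6 = (j + y) mod (6::nat)" "x < 6" "y < 6" shows "x = y"
proof -
  obtain a b where "j + x + 6 * a = j + y + 6 * b" using assms(1) unfolding nat_mod_eq_iff by blast
  then have "x + 6 * a = y + 6 * b" by simp
  then show ?thesis using assms(2,3) by presburger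
qed

text \<open>
  \<open>n = 1\<close> and \<open>n = 2\<close> are the 4-bulb and 3-bulb insertions, \<open>n = 3\<close> is the reflection, and \<open>n = 4\<close>
  and \<open>n = 5\<close> are the 3-bulb and 4-bulb reductions.
\<close>

lemma insert_vertex_operation:
  assumes r: "r > 0" and tan: "triangular_tangle r (curve r S)" "inner_vertices r (curve r S) = S"
    and tan': "triangular_tangle r (curve r (S - {u}))" "inner_vertices r (curve r (S - {u})) = S - {u}"
    and u: "u \<in> S" and n: "0 < n" "n < 6"
    and arc: "\<And>i. i < 6 \<Longrightarrow> u + dir (j + i) \<in> S \<longleftrightarrow> i < n"
  shows "tangle_operation r (curve r (S - {u})) (curve r S)"
proof -
  let ?S = "S - {u}"
  have u0: "u + dir i \<noteq> u" for i by simp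
  have inS: "u + dir (j + i) \<in> S" if "i < n" for i using arc[of i] that n by simp
  have outS: "u + dir (j + i) \<notin> S" if "n \<le> i" "i < 6" for i using arc[of i] that by simp
  have j6: "u + dir (j + 6) = u + dir j" by (simp add: dir_reduce)
  obtain n' where n': "n = Suc n'" using n by (cases n) auto
  define a1 where "a1 = u + dir j"
  define a2 where "a2 = u + dir (j + n')"
  define b1 where "b1 = u + dir (j + 5)"
  define b2 where "b2 = u + dir (j + n)"
  define As where "As = lk r a1 (j + 3) # map (\<lambda>i. lk r u (j + i)) [0..<n'] @ [lk r a2 (j + n + 1)]"
  define Bs where "Bs = lk r b1 (j + 1) # map (\<lambda>i. lk r u (j + i)) (rev [n..<5]) @ [lk r b2 (j + n + 3)]"
  have a1d: "a1 + dir (j + 3) = u" "a1 + dir (Suc (j + 3)) = b1" by (simp_all add: a1_def b1_def dir_reduce)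
  have a2d: "a2 + dir (j + n + 1) = b2" "a2 + dir (Suc (j + n + 1)) = u" by (simp_all add: a2_def b2_def n' dir_reduce)
  have b1d: "b1 + dir (j + 1) = a1" "b1 + dir (Suc (j + 1)) = u" by (simp_all add: a1_def b1_def dir_reduce)
  have b2d: "b2 + dir (j + n + 3) = u" "b2 + dir (Suc (j + n + 3)) = a2" by (simp_all add: a2_def b2_def n' dir_reduce)
  have mem: "a1 \<in> S" "a2 \<in> S" "b1 \<notin> S" "b2 \<notin> S" "a1 \<noteq> u" "a2 \<noteq> u" "b1 \<noteq> u" "b2 \<noteq> u"
    using inS[of 0] inS[of n'] outS[of 5] outS[of n] n n' by (auto simp: a1_def a2_def b1_def b2_def)
  define nr where "nr v k \<longleftrightarrow> v = u \<or> v + dir k = u \<or> v + dir (Suc k) = u" for v k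
  have nr_cong: "nr v k \<longleftrightarrow> nr v m" if "k mod 6 = m mod 6" for v k m
    using dir_cong[OF that] unfolding nr_def dir.simps(2) by simp
  have bA1: "boundary_link ?S a1 (j + 3)" unfolding boundary_link_def a1d using mem by simp
  have bA2: "boundary_link ?S a2 (j + n + 1)" unfolding boundary_link_def a2d using mem by simp
  have bA: "boundary_link ?S u (j + i)" if "i < n'" for i
    unfolding boundary_link_def using inS[of i] inS[of "Suc i"] that n' u0[of "j + i"] u0[of "Suc (j + i)"] by auto
  have bB1: "boundary_link S b1 (j + 1)" unfolding boundary_link_def b1d using mem u by simp
  have bB2: "boundary_link S b2 (j + n + 3)" unfolding boundary_link_def b2d using mem u by simp
  have bB: "boundary_link S u (j + i)" if "n \<le> i" "i < 5" for i
    unfolding boundary_link_def using outS[of i] outS[of "Suc i"] that u by auto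
  have setA: "\<exists>v k. A = lk r v k \<and> nr v k \<and> boundary_link ?S v k" if mem: "A \<in> set As" for A
  proof -
    have "nr a1 (j + 3)" "nr a2 (j + n + 1)" "\<And>i. nr u i" unfolding nr_def using a1d a2d by auto
    moreover have "A = lk r a1 (j + 3) \<or> A = lk r a2 (j + n + 1) \<or> (\<exists>i<n'. A = lk r u (j + i))"
      using mem unfolding As_def by (simp add: image_iff Bex_def)
    ultimately show ?thesis using bA1 bA2 bA by blast
  qed
  have setB: "\<exists>v k. A = lk r v k \<and> nr v k \<and> boundary_link S v k" if mem: "A \<in> set Bs" for A
  proof -
    have "nr b1 (j + 1)" "nr b2 (j + n + 3)" "\<And>i. nr u i" unfolding nr_def using b1d b2d by auto
    moreover have "A = lk r b1 (j + 1) \<or> A = lk r b2 (j + n + 3) \<or> (\<exists>i. n \<le> i \<and> i < 5 \<and> A = lk r u (j + i))"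
      using mem unfolding Bs_def by (simp add: image_iff Bex_def)
    ultimately show ?thesis using bB1 bB2 bB by blast
  qed
  have far: "boundary_link S v k \<longleftrightarrow> boundary_link ?S v k" if "\<not> nr v k" for v k
    using that unfolding boundary_link_def nr_def by simp
  have locate: "\<exists>i<6. dir m = dir (j + i) \<and> m mod 6 = (j + i) mod 6" for m
    using dir_shift[of m j] dir_cong by metis
  have nearA: "lk r v k \<in> set As" if near: "nr v k" and b: "boundary_link ?S v k" for v k
  proof -
    consider "v = u" | "v + dir k = u" | "v + dir (Suc k) = u" using near unfolding nr_def by blast
    then show ?thesis
    proof cases
      case 1
      obtain i where i: "i < 6" "dir k = dir (j + i)" "k mod 6 = (j + i) mod 6" using locate by blast
      have i': "dir (Suc k) = dir (j + Suc i)" using i(2) by (simp add: dir.simps(2))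
      have "u + dir (j + i) \<in> S" "u + dir (j + Suc i) \<in> S"
        using b unfolding 1 boundary_link_def i(2) i' by auto
      then have "i < n" "Suc i < n" using arc[of i] arc[of "Suc i"] i(1) n by auto
      then show ?thesis using lk_cong[OF i(3)] n' unfolding 1 As_def by auto
    next
      case 2
      then have v: "v = u + dir (k + 3)" by (auto simp: dir_reduce)
      obtain i where i: "i < 6" "dir (k + 3) = dir (j + i)" "(k + 3) mod 6 = (j + i) mod 6" using locate by blast
      have "v + dir (Suc k) = u + dir (k + 3 + 5)" unfolding v by (simp add: dir_reduce)
      also have "dir (k + 3 + 5) = dir (j + i + 5)" using mod_6_add[OF i(3)] by (rule dir_cong)
      finally have v': "v + dir (Suc k) = u + dir (j + i + 5)" .
      have "v \<in> S" "u + dir (j + i + 5) \<notin> S" using b unfolding boundary_link_def 2 v'[symmetric] using v' u0[of "j + i + 5"] by auto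
      then have "i < n" using arc[OF i(1)] v i(2) by simp
      have "i = 0"
      proof (cases i)
        case (Suc i')
        then have "dir (j + i + 5) = dir (j + i')" by (intro dir_cong) simp
        then show ?thesis using \<open>u + dir (j + i + 5) \<notin> S\<close> inS[of i'] \<open>i < n\<close> Suc by simp
      qed
      then have "v = a1" "k mod 6 = (j + 3) mod 6" using v i(2) mod_6_shift[OF i(3), of 3] by (auto simp: a1_def)
      then show ?thesis using lk_cong[of k "j + 3"] unfolding As_def by simp
    next
      case 3
      then have v: "v = u + dir (k + 4)" by (auto simp: dir_reduce)
      obtain i where i: "i < 6" "dir (k + 4) = dir (j + i)" "(k + 4) mod 6 = (j + i) mod 6" using locate by blast
      have "v + dir k = u + dir (Suc (k + 4))" unfolding v by (simp add: dir_reduce)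
      also have "dir (Suc (k + 4)) = dir (j + Suc i)" by (simp only: add_Suc_right dir.simps(2) i(2))
      finally have v': "v + dir k = u + dir (j + Suc i)" .
      have "v \<in> S" "u + dir (j + Suc i) \<notin> S" using b unfolding boundary_link_def 3 v'[symmetric] using v' u0[of "j + Suc i"] by auto
      then have "i < n" "\<not> Suc i < n" using arc[OF i(1)] v i(2) inS[of "Suc i"] by auto
      then have "i = n'" using n' by simp
      then have "v = a2" "k mod 6 = (j + n + 1) mod 6" using v i(2) mod_6_shift[OF i(3), of 2] n' by (auto simp: a2_def)
      then show ?thesis using lk_cong[of k "j + n + 1"] unfolding As_def by simp
    qed
  qed
  have nearB: "lk r v k \<in> set Bs" if near: "nr v k" and b: "boundary_link S v k" for v k
  proof -
    consider "v = u" | "v + dir k = u" | "v + dir (Suc k) = u" using near unfolding nr_def by blast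
    then show ?thesis
    proof cases
      case 1
      obtain i where i: "i < 6" "dir k = dir (j + i)" "k mod 6 = (j + i) mod 6" using locate by blast
      have i': "dir (Suc k) = dir (j + Suc i)" using i(2) by (simp add: dir.simps(2))
      have o: "u + dir (j + i) \<notin> S" "u + dir (j + Suc i) \<notin> S"
        using b u unfolding 1 boundary_link_def i(2) i' by auto
      then have "n \<le> i" using inS[of i] by force
      moreover have "i \<noteq> 5" using o(2) j6 inS[of 0] n by (auto simp: add.commute)
      ultimately show ?thesis using lk_cong[OF i(3)] i(1) unfolding 1 Bs_def by auto
    next
      case 2
      then have v: "v = u + dir (k + 3)" by (auto simp: dir_reduce)
      obtain i where i: "i < 6" "dir (k + 3) = dir (j + i)" "(k + 3) mod 6 = (j + i) mod 6" using locate by blast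
      have "v + dir (Suc k) = u + dir (k + 3 + 5)" unfolding v by (simp add: dir_reduce)
      also have "dir (k + 3 + 5) = dir (j + i + 5)" using mod_6_add[OF i(3)] by (rule dir_cong)
      finally have v': "v + dir (Suc k) = u + dir (j + i + 5)" .
      have vS: "v \<notin> S" "u + dir (j + i + 5) \<in> S" using b u unfolding boundary_link_def 2 v' by auto
      then have ni: "n \<le> i" using inS[of i] v i(2) by force
      then obtain i' where Suc: "i = Suc i'" using n by (cases i) auto
      then have "dir (j + i + 5) = dir (j + i')" by (intro dir_cong) simp
      then have "i' < n" using vS(2) arc[of i'] i(1) Suc by simp
      then have "i = n" using ni Suc by simp
      then have "v = b2" "k mod 6 = (j + n + 3) mod 6" using v i(2) mod_6_shift[OF i(3), of 3] by (auto simp: b2_def)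
      then show ?thesis using lk_cong[of k "j + n + 3"] unfolding Bs_def by simp
    next
      case 3
      then have v: "v = u + dir (k + 4)" by (auto simp: dir_reduce)
      obtain i where i: "i < 6" "dir (k + 4) = dir (j + i)" "(k + 4) mod 6 = (j + i) mod 6" using locate by blast
      have "v + dir k = u + dir (Suc (k + 4))" unfolding v by (simp add: dir_reduce)
      also have "dir (Suc (k + 4)) = dir (j + Suc i)" by (simp only: add_Suc_right dir.simps(2) i(2))
      finally have v': "v + dir k = u + dir (j + Suc i)" .
      have vS: "v \<notin> S" "u + dir (j + Suc i) \<in> S" using b u unfolding boundary_link_def 3 v' by auto
      then have "n \<le> i" using inS[of i] v i(2) by force
      then have i5: "i = 5" using vS(2) arc[of "Suc i"] i(1) by (cases "Suc i < 6") auto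
      then have "k mod 6 = (j + 5 + 2) mod 6" using mod_6_shift[OF i(3), of 2] by simp
      also have "j + 5 + 2 = j + 1 + 6" by simp
      finally have "k mod 6 = (j + 1) mod 6" by (simp only: mod_add_self2)
      moreover have "v = b1" using v i(2) i5 by (simp add: b1_def)
      ultimately show ?thesis using lk_cong[of k "j + 1"] unfolding Bs_def by simp
    qed
  qed
  have TC: "tangle_links r (curve r ?S) = {lk r v k | v k. boundary_link ?S v k}"
    and TD: "tangle_links r (curve r S) = {lk r v k | v k. boundary_link S v k}"
    using tangle_links_curve[OF r tan'] tangle_links_curve[OF r tan] .
  have not_in: "lk r v k \<notin> set As" "lk r v k \<notin> set Bs" if "\<not> nr v k" for v k
    using setA[of "lk r v k"] setB[of "lk r v k"] that lk_eq_iff[OF r] nr_cong by metis+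
  have repl: "tangle_links r (curve r S) - set Bs = tangle_links r (curve r ?S) - set As"
  proof (intro subset_antisym subsetI)
    fix A assume "A \<in> tangle_links r (curve r S) - set Bs"
    then obtain v k where A: "A = lk r v k" "boundary_link S v k" "A \<notin> set Bs" unfolding TD by blast
    then have "\<not> nr v k" using nearB by blast
    then show "A \<in> tangle_links r (curve r ?S) - set As" using A far not_in unfolding TC by blast
  next
    fix A assume "A \<in> tangle_links r (curve r ?S) - set As"
    then obtain v k where A: "A = lk r v k" "boundary_link ?S v k" "A \<notin> set As" unfolding TC by blast
    then have "\<not> nr v k" using nearA by blast
    then show "A \<in> tangle_links r (curve r S) - set Bs" using A far not_in unfolding TD by blast
  qed
  have inj_u: "inj_on (\<lambda>i. lk r u (j + i)) {..<6}"
  proof (rule inj_onI)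
    fix x y assume "x \<in> {..<6}" "y \<in> {..<6}" "lk r u (j + x) = lk r u (j + y)"
    then show "x = y" using lk_eq_iff[OF r] mod_6_add_cancel[of j y x] by auto
  qed
  have ne_u: "lk r w k \<noteq> lk r u m" "lk r u m \<noteq> lk r w k" if "w \<noteq> u" for w k m
    using lk_eq_iff[OF r, of w k u m] that by auto
  have "distinct As"
  proof -
    have "lk r a1 (j + 3) \<noteq> lk r a2 (j + n + 1)"
    proof
      assume "lk r a1 (j + 3) = lk r a2 (j + n + 1)"
      then have e: "dir j = dir (j + n')" "(j + n + 1) mod 6 = (j + 3) mod 6" using lk_eq_iff[OF r] by (auto simp: a1_def a2_def)
      then have "j mod 6 = (j + n') mod 6" by (intro dir_inj)
      then have "n' = 0" using n n' mod_6_add_cancel[of j 0 n'] by auto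
      then have "(j + 2) mod 6 = (j + 3) mod 6" using e(2) n' by simp
      then show False using mod_6_add_cancel[of j 2 3] by simp
    qed
    moreover have "distinct (map (\<lambda>i. lk r u (j + i)) [0..<n'])"
      unfolding distinct_map using n n' by (auto intro: inj_on_subset[OF inj_u])
    ultimately show ?thesis unfolding As_def using ne_u[OF mem(5)] ne_u[OF mem(6)] by auto
  qed
  have "distinct Bs"
  proof -
    have "lk r b1 (j + 1) \<noteq> lk r b2 (j + n + 3)"
    proof
      assume "lk r b1 (j + 1) = lk r b2 (j + n + 3)"
      then have e: "dir (j + 5) = dir (j + n)" "(j + n + 3) mod 6 = (j + 1) mod 6" using lk_eq_iff[OF r] by (auto simp: b1_def b2_def)
      then have "(j + 5) mod 6 = (j + n) mod 6" by (intro dir_inj)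
      then have "n = 5" using n mod_6_add_cancel[of j 5 n] by auto
      then have "j + n + 3 = j + 2 + 6" by simp
      then have "(j + 2) mod 6 = (j + 1) mod 6" using e(2) by (simp only: mod_add_self2)
      then show False using mod_6_add_cancel[of j 2 1] by simp
    qed
    moreover have "distinct (map (\<lambda>i. lk r u (j + i)) (rev [n..<5]))"
      unfolding distinct_map using n by (auto intro: inj_on_subset[OF inj_u])
    ultimately show ?thesis unfolding Bs_def using ne_u[OF mem(7)] ne_u[OF mem(8)] by auto
  qed
  define p q where "p = node r a1 (Suc (j + 3))" and "q = node r a2 (j + n + 1)"
  have nodes: "node r a1 (j + 3) = node r u (j + 0)" "node r a2 (Suc (j + n + 1)) = node r u (j + n')"
    "node r b1 (Suc (j + 1)) = node r u (j + 5)" "node r b2 (j + n + 3) = node r u (j + n)"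
    "node r b1 (j + 1) = p" "node r b2 (Suc (j + n + 3)) = q"
    by (simp_all add: node_def p_def q_def a1_def a2_def b1_def b2_def n' dir_reduce algebra_simps)
  have chA: "link_chain r As p q"
  proof -
    have "link_joins r (lk r a1 (j + 3)) p (node r u (j + 0))"
      unfolding p_def nodes(1)[symmetric] by (rule link_joins_lk)
    moreover have "link_joins r (lk r a2 (j + n + 1)) (node r u (j + n')) q"
      unfolding q_def nodes(2)[symmetric] by (rule link_joins_lk)
    ultimately show ?thesis unfolding As_def using link_chain_circle(1)[of 0 n' r u j]
      by (auto simp: link_chain_append)
  qed
  have chB: "link_chain r Bs p q"
  proof -
    have "link_joins r (lk r b1 (j + 1)) p (node r u (j + 5))"
      unfolding nodes(5)[symmetric] nodes(3)[symmetric] by (rule link_joins_lk)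
    moreover have "link_joins r (lk r b2 (j + n + 3)) (node r u (j + n)) q"
      unfolding nodes(4)[symmetric] nodes(6)[symmetric] by (rule link_joins_lk)
    moreover have "link_chain r (map (\<lambda>i. lk r u (j + i)) (rev [n..<5])) (node r u (j + 5)) (node r u (j + n))"
      using link_chain_circle(2)[of n 5 r u j] n by simp
    ultimately show ?thesis unfolding Bs_def by (auto simp: link_chain_append)
  qed
  have curv': "link_curvature r (curve r ?S) (if v \<in> ?S then Convex else Concave) (lk r v k)" if "boundary_link ?S v k" for v k
    using link_curvature_boundary[OF r tan' that] .
  have curv: "link_curvature r (curve r S) (if v \<in> S then Convex else Concave) (lk r v k)" if "boundary_link S v k" for v k
    using link_curvature_boundary[OF r tan that] .
  have cA: "list_all2 (link_curvature r (curve r ?S)) (Convex # replicate n' Concave @ [Convex]) As"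
    unfolding As_def using curv'[OF bA1] curv'[OF bA2] curv'[OF bA] mem
    by (auto intro!: list_all2_appendI list_all2_replicate_left simp del: link_curvature.simps)
  have cB: "list_all2 (link_curvature r (curve r S)) (Concave # replicate (5 - n) Convex @ [Concave]) Bs"
    unfolding Bs_def using curv[OF bB1] curv[OF bB2] curv[OF bB] mem u
    by (auto intro!: list_all2_appendI list_all2_replicate_left simp del: link_curvature.simps)
  have "set As \<subseteq> tangle_links r (curve r ?S)" "set Bs \<subseteq> tangle_links r (curve r S)"
    unfolding TC TD using setA setB by blast+
  then have "consecutive_links r (curve r ?S) (Convex # replicate n' Concave @ [Convex]) As p q"
    "consecutive_links r (curve r S) (Concave # replicate (5 - n) Convex @ [Concave]) Bs p q"
    unfolding consecutive_links_def using chA chB cA cB \<open>distinct As\<close> \<open>distinct Bs\<close> by blast+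
  then have R: "link_replacement r (Convex # replicate n' Concave @ [Convex]) (Concave # replicate (5 - n) Convex @ [Concave])
     (curve r ?S) (curve r S)"
    unfolding link_replacement_def using tan(1) tan'(1) repl by blast
  have "n' = 0 \<or> n' = 1 \<or> n' = 2 \<or> n' = 3 \<or> n' = 4" using n n' by auto
  then show ?thesis using R[unfolded n'] unfolding tangle_operation_def shear_insertion_4_def shear_reduction_4_def
      shear_insertion_3_def shear_reduction_3_def reflection_def
    by (elim disjE) (simp_all add: numeral_eq_Suc)
qed

lemma curve_singleton:
  assumes "r > 0" shows "curve r {v} = sphere (ctr r v) r"
proof
  show "curve r {v} \<subseteq> sphere (ctr r v) r"
  proof
    fix z assume "z \<in> curve r {v}"
    then obtain w k where wk: "z \<in> lk r w k" "boundary_link {v} w k" unfolding curve_def by blast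
    have "w = v"
    proof (rule ccontr)
      assume "w \<noteq> v"
      then have "w + dir k = w + dir (Suc k)" using wk(2) unfolding boundary_link_def by auto
      then have "k mod 6 = Suc k mod 6" using dir_inj[of k "Suc k"] by simp
      then show False by (simp add: mod_Suc split: if_splits)
    qed
    then show "z \<in> sphere (ctr r v) r" using lk_subset_sphere[OF assms wk(1)] by (simp add: dist_commute)
  qed
  show "sphere (ctr r v) r \<subseteq> curve r {v}"
  proof
    fix z assume "z \<in> sphere (ctr r v) r"
    then have nz: "norm (z - ctr r v) = r" by (simp add: dist_norm norm_minus_commute)
    obtain \<theta> where \<theta>: "0 \<le> \<theta>" "z - ctr r v = of_real r * cis (\<theta> * pi / 3)"
      using polar_sixths[of 0 "z - ctr r v"] nz by metis
    define k where "k = nat \<lfloor>\<theta>\<rfloor>"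
    have k: "real k \<le> \<theta>" "\<theta> \<le> real k + 1" unfolding k_def using \<theta>(1) by linarith+
    have "z = ctr r v + of_real r * cis ((real k + (\<theta> - real k)) * (pi / 3))" using \<theta>(2) by (simp add: algebra_simps)
    then have "z \<in> lk r v k" unfolding lk_param_unit using k by (intro CollectI exI[of _ "\<theta> - real k"]) auto
    moreover have "boundary_link {v} v k" unfolding boundary_link_def by simp
    ultimately show "z \<in> curve r {v}" unfolding curve_def by blast
  qed
qed

lemma constructible_curve:
  assumes r: "r > 0" and "finite S" "boundary_cycle S"
  shows "constructible r (curve r S)"
  using assms(2,3)
proof (induction "card S" arbitrary: S rule: less_induct)
  case less
  have tan: "triangular_tangle r (curve r S)" "inner_vertices r (curve r S) = S"
    using boundary_cycle_tangle[OF r less(3,2)] inner_vertices_curve[OF r _ less(2)] by blast+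
  have con: "adj_connected S" using boundary_cycle_connected less by blast
  have "S \<noteq> {}" using less(3) unfolding boundary_cycle_def bedges_def by blast
  then obtain a where a: "a \<in> S" "a + dir 0 \<notin> S" using finite_extreme less(2) by blast
  show ?case
  proof (cases "S = {a}")
    case True
    then have "curve r S = sphere (ctr r a) r" using curve_singleton[OF r, of a] by simp
    moreover have "ctr r a \<in> tiling_vertices r" unfolding tiling_vertices_eq by blast
    ultimately show ?thesis unfolding constructible_def by (metis rtranclp.rtrancl_refl)
  next
    case False
    obtain u i where u: "u \<in> S" "u + dir i \<notin> S" "adj_connected (S - {u})"
      using non_cut_vertex[OF con less(2) a False] by blast
    have ne: "S \<noteq> {u}" using False a by blast
    obtain j n where jn: "0 < n" "n < 6" "\<And>i. i < 6 \<Longrightarrow> u + dir (j + i) \<in> S \<longleftrightarrow> i < n"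
      by (rule contiguous_arc[OF r tan u(1,2) con u(3) ne]) (rule that, blast+)
    have cyc: "boundary_cycle (S - {u})" using remove_vertex_boundary_cycle[OF less(3) u(1) jn] .
    have fin: "finite (S - {u})" "card (S - {u}) < card S"
      using less(2) card_Diff1_less[OF less(2) u(1)] by blast+
    have tan': "triangular_tangle r (curve r (S - {u}))" "inner_vertices r (curve r (S - {u})) = S - {u}"
      using boundary_cycle_tangle[OF r cyc fin(1)] inner_vertices_curve[OF r _ fin(1)] by blast+
    have "constructible r (curve r (S - {u}))" using less(1)[OF fin(2,1) cyc] .
    moreover have "tangle_operation r (curve r (S - {u})) (curve r S)"
      using insert_vertex_operation[OF r tan tan' u(1) jn] .
    ultimately show ?thesis unfolding constructible_def by (meson rtranclp.rtrancl_into_rtrancl)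
  qed
qed

theorem theorem5p2:
  fixes r :: real and C :: "complex set"
  assumes "r > 0" and "triangular_tangle r C"
  shows "constructible r C"
proof -
  have fin: "finite (inner_vertices r C)" using finite_inner_vertices[OF assms] .
  have C: "C = curve r (inner_vertices r C)" using tangle_eq_curve[OF assms] .
  have "boundary_cycle (inner_vertices r C)" using tangle_boundary_cycle[OF assms C fin] .
  then show ?thesis using constructible_curve[OF assms(1) fin] C by simp
qed

end
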